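(* Let $\mathfrak g=A_1^{(1)}$, let $\Lambda$ be a dominant integral weight of $\mathfrak g$ of level $m\ge 1$, and let $\lambda$ be a maximal dominant weight of the irreducible highest weight module $L(\Lambda)$. Let $\tau\in\mathbb H$ (the complex upper half plane) and let $t\in\mathbb C$ with $0<|t|<1$. Then the $t$-string function $c^{\Lambda}_{\lambda}(t,\tau)$ is equal to the constant term, i.e. the coefficient of $z^0$ in the Laurent series expansion in the annulus $|t|<|z|<|t|^{-1}$, of the product $$\Theta_L(\tau,t,z)\;\eta^{(-3)}(\tau,t,z)\;P(t,z),$$ where $L=L(\Lambda,\lambda)=(A,B)+\mathbb Z^2$ is the translate of $\mathbb{Z}^2$ attached to $(\Lambda,\lambda)$, and $\Theta_L$, $\eta^{(-3)}$, $P$ are the deformed Hecke modular form, deformed eta factor and Poisson kernel defined in the context.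
   Context: **Affine data.** $\mathfrak g=A_1^{(1)}$ is the affine Lie algebra with generalized Cartan matrix $\begin{pmatrix}2&-2\\-2&2\end{pmatrix}$ and Cartan subalgebra $\mathfrak h$. The dual space $\mathfrak h^*$ has basis $\{\alpha_1,\delta,\Lambda_0\}$; the simple roots are $\alpha_1$ and $\alpha_0=\delta-\alpha_1$, where $\delta$ is the null root. The symmetric bilinear form on $\mathfrak h^*$ is given by $(\alpha_1|\alpha_1)=2$, $(\Lambda_0|\delta)=1$, $(\alpha_1|\delta)=(\alpha_1|\Lambda_0)=(\delta|\delta)=(\Lambda_0|\Lambda_0)=0$. The level of $\lambda\in\mathfrak h^*$ is $(\lambda|\delta)$. The positive roots are $\Delta_+=\{\alpha_1+(n-1)\delta,\ -\alpha_1+n\delta,\ n\delta:\ n\ge1\}$ (all multiplicities $1$), and $Q_+=\mathbb Z_{\ge0}\Delta_+$. The Weyl vector $\rho$ satisfies $(\rho|\Lambda_0)=0$, $(\rho|\alpha_1)=1$, $(\rho|\delta)=2$. $W$ is the Weyl group, generated by the reflections $r_0,r_1$, $r_i(\mu)=\mu-(\mu|\alpha_i)\alpha_i$, with length function $\ell$. A weight $\mu$ is dominant integral if $(\mu|\alpha_0),(\mu|\alpha_1)\in\mathbb Z_{\ge0}$. $L(\Lambda)$ is the irreducible $\mathfrak g$-module of highest weight $\Lambda$; a weight $\lambda$ of $L(\Lambda)$ is maximal if $\lambda+\delta$ is not a weight of $L(\Lambda)$. **$t$-string function.** The $t$-Kostant partition function $K(\beta,t)$ is defined by $\prod_{\alpha\in\Delta_+}\frac{1}{1-te(-\alpha)}=\sum_{\beta\in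 Q_+}K(\beta,t)e(-\beta)$, and $K(\beta,t)=0$ for $\beta\notin Q_+$. For dominant integral $\Lambda,\mu$, Lusztig's $t$-analog of weight multiplicity is $$m^{\Lambda}_{\mu}(t)=\sum_{w\in W}(-1)^{\ell(w)}K\big(w(\Lambda+\rho)-(\mu+\rho),t\big).$$ For $\Lambda$ of level $m\ge1$ and $\lambda$ a maximal dominant weight of $L(\Lambda)$, with $q=e^{2\pi i\tau}$, and $q^{r}:=e^{2\pi i\tau r}$ for rational $r$, define $$c^\Lambda_\lambda(t,\tau)=q^{s_\Lambda(\lambda)}\sum_{k\ge0}m^\Lambda_{\lambda-k\delta}(t)\,q^k,\qquad s_\Lambda(\lambda)=\frac{|\Lambda+\rho|^2}{2(m+2)}-\frac{|\lambda|^2}{2m}-\frac{|\rho|^2}{4},$$ where $|\gamma|^2=(\gamma|\gamma)$. **The lattice translate.** Let $x_0=\frac{(\Lambda+\rho|\alpha_1)}{2(m+2)}$ and $y_0=\frac{(\lambda|\alpha_1)}{2m}$. If $x_0\ge y_0$ put $(A,B)=(x_0,y_0)$; otherwise put $(A,B)=(\tfrac12-x_0,\tfrac12-y_0)$. Let $M=\mathbb Z^2$ and $L=L(\Lambda,\lambda)=(A,B)+M$. **Quadratic form and groups.** For $v=(x,y)\in\mathbb R^2$ let $N(v)=2(m+2)x^2-2my^2$, and let $\mathrm{sign}(v)=1$ if $x\ge0$ and $-1$ if $x<0$. $M^*$ is the lattice dual to $M$ with respect to the bilinear form induced by $N$, i.e. $M^*=\frac1{2(m+2)}\mathbb Z\oplus\frac1{2m}\mathbb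 Z$. $O(N)$ is the group of invertible linear operators on $\mathbb R^2$ preserving $N$, and $SO_0(N)$ is its identity component. Put $G=\{g\in SO_0(N):gM=M\}$ and $G_0=\{g\in G: g\text{ fixes }M^*/M\text{ pointwise}\}$. Let $\zeta(x,y)=(-x,y)$ and $\widetilde G=\langle\zeta\rangle\ltimes G\subset O(N)$. Let $U^+=\{(x,y)\in\mathbb R^2:N(x,y)>0\}$. The set $$\widetilde F=\{(x,y):x>0,\ 0\le y\le x\}\cup\{(x,y):0>y>x\}$$ is a fundamental domain for the action of $\widetilde G$ on $U^+$; for $v\in U^+$, $v^\dagger=(x^\dagger,y^\dagger)$ denotes the unique element of $\widetilde F$ in the $\widetilde G$-orbit of $v$. **The three functions.** $$\Theta_L(\tau,t,z)=\sum_{\substack{v\in L\cap U^+\\ v\bmod G_0}}\mathrm{sign}(v)\,e^{\pi i\tau N(v)}\,t^{2(y^\dagger-B)}\,z^{(m+2)x^\dagger-my^\dagger-\frac12},$$ a sum over representatives of $G_0$-orbits in $L\cap U^+$ (the exponents of $t$ and $z$ are integers); $$\eta^{(-3)}(\tau,t,z)=e^{-i\pi\tau/4}\prod_{n=1}^\infty\frac1{(1-te^{2\pi in\tau})(1-tze^{2\pi in\tau})(1-tz^{-1}e^{2\pi in\tau})};$$ $$P(t,z)=\frac{1-t^2}{(1-tz)(1-tz^{-1})}=\sum_{n\in\mathbb Z}t^{|n|}z^n .$$ All three are holomorphic on $\{(\tau,t,z):\tau\in\mathbb H,\ 0<|t|<1,\ |t|<|z|<|t|^{-1}\}$. *)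

theory Defs
  imports "HOL-Analysis.Analysis" "HOL-Library.Multiset"
begin

section \<open>Weights of the affine Lie algebra of type A_1^(1)\<close>

text \<open>A weight is given by its coordinates in the ordered basis
  \<open>\<alpha>\<^sub>1\<close>, \<open>\<delta>\<close>, \<open>\<Lambda>\<^sub>0\<close> of the dual of the (complex, three-dimensional) Cartan subalgebra.\<close>

type_synonym weight = "complex ^ 3"

definition alpha1 :: weight where "alpha1 = axis 1 1"
definition null_root :: weight where "null_root = axis 2 1"
definition Lambda0 :: weight where "Lambda0 = axis 3 1"

definition bform :: "weight \<Rightarrow> weight \<Rightarrow> complex" where
  "bform u v = 2 * u $ 1 * v $ 1 + u $ 2 * v $ 3 + u $ 3 * v $ 2"

text \<open>The index type \<open>2\<close> has exactly the two elements \<open>0\<close> and \<open>1\<close>.\<close>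

definition simple_root :: "2 \<Rightarrow> weight" where
  "simple_root i = (if i = 0 then null_root - alpha1 else alpha1)"

definition rho :: weight where
  "rho = (1 / 2) *s alpha1 + 2 *s Lambda0"

lemma bform_basis:
  "bform alpha1 alpha1 = 2" "bform Lambda0 null_root = 1"
  "bform alpha1 null_root = 0" "bform alpha1 Lambda0 = 0"
  "bform null_root null_root = 0" "bform Lambda0 Lambda0 = 0"
  "bform u v = bform v u"
  by (simp_all add: bform_def alpha1_def null_root_def Lambda0_def axis_def)

lemma bform_rho:
  "bform rho Lambda0 = 0" "bform rho alpha1 = 1" "bform rho null_root = 2"
  by (simp_all add: bform_def rho_def alpha1_def null_root_def Lambda0_def axis_def)

definition level :: "weight \<Rightarrow> complex" where
  "level \<mu> = bform \<mu> null_root"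

definition dominant_integral :: "weight \<Rightarrow> bool" where
  "dominant_integral \<mu> \<longleftrightarrow> (\<forall>i. bform \<mu> (simple_root i) \<in> \<nat>)"

definition reflection :: "2 \<Rightarrow> weight \<Rightarrow> weight" where
  "reflection i \<mu> = \<mu> - bform \<mu> (simple_root i) *s simple_root i"

definition word_elem :: "2 list \<Rightarrow> weight \<Rightarrow> weight" where
  "word_elem is = foldr (\<lambda>i w. reflection i \<circ> w) is id"

definition weyl_group :: "(weight \<Rightarrow> weight) set" where
  "weyl_group = range word_elem"

definition weyl_length :: "(weight \<Rightarrow> weight) \<Rightarrow> nat" where
  "weyl_length w = (LEAST n. \<exists>is. length is = n \<and> word_elem is = w)"


section \<open>Irreducible highest weight modules\<close>

definition commutator :: "('v \<Rightarrow> 'v) \<Rightarrow> ('v \<Rightarrow> 'v) \<Rightarrow> 'v \<Rightarrow> 'v::ab_group_add" where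
  "commutator a b = (\<lambda>v. a (b v) - b (a v))"

text \<open>The affine Lie algebra with generalized Cartan matrix (2, -2; -2, 2) is presented by
  Chevalley generators \<open>e\<^sub>i\<close>, \<open>f\<^sub>i\<close>, the Cartan subalgebra, and the Chevalley-Serre relations;
  a module is thus a complex vector space with operators satisfying these relations.
  The Cartan subalgebra is identified with its dual through the nondegenerate form \<open>bform\<close>:
  \<open>H \<gamma>\<close> is the action of the element \<open>h\<close> with \<open>\<mu>(h) = bform \<mu> \<gamma>\<close> for all \<open>\<mu>\<close>. Since
  \<open>bform \<alpha>\<^sub>i \<alpha>\<^sub>i = 2\<close>, the coroot of \<open>\<alpha>\<^sub>i\<close> acts by \<open>H \<alpha>\<^sub>i\<close>. In the Serre relations
  \<open>3 = 1 - a\<^sub>i\<^sub>j\<close>.\<close>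

locale affine_module = vector_space scale
  for scale :: "complex \<Rightarrow> 'v \<Rightarrow> 'v::ab_group_add" +
  fixes e f :: "2 \<Rightarrow> 'v \<Rightarrow> 'v" and H :: "weight \<Rightarrow> 'v \<Rightarrow> 'v"
  assumes linear_e: "Vector_Spaces.linear scale scale (e i)"
    and linear_f: "Vector_Spaces.linear scale scale (f i)"
    and linear_H: "Vector_Spaces.linear scale scale (H \<gamma>)"
    and H_add: "H (\<gamma> + \<gamma>') v = H \<gamma> v + H \<gamma>' v"
    and H_scale: "H (c *s \<gamma>) v = scale c (H \<gamma> v)"
    and H_H: "commutator (H \<gamma>) (H \<gamma>') = (\<lambda>_. 0)"
    and H_e: "commutator (H \<gamma>) (e i) = (\<lambda>v. scale (bform (simple_root i) \<gamma>) (e i v))"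
    and H_f: "commutator (H \<gamma>) (f i) = (\<lambda>v. scale (- bform (simple_root i) \<gamma>) (f i v))"
    and e_f: "commutator (e i) (f j) = (if i = j then H (simple_root i) else (\<lambda>_. 0))"
    and serre_e: "i \<noteq> j \<Longrightarrow> (commutator (e i) ^^ 3) (e j) = (\<lambda>_. 0)"
    and serre_f: "i \<noteq> j \<Longrightarrow> (commutator (f i) ^^ 3) (f j) = (\<lambda>_. 0)"
begin

definition weight_space :: "weight \<Rightarrow> 'v set" where
  "weight_space \<mu> = {v. \<forall>\<gamma>. H \<gamma> v = scale (bform \<mu> \<gamma>) v}"

definition is_weight :: "weight \<Rightarrow> bool" where
  "is_weight \<mu> \<longleftrightarrow> weight_space \<mu> \<noteq> {0}"

definition maximal_weight :: "weight \<Rightarrow> bool" where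
  "maximal_weight \<mu> \<longleftrightarrow> is_weight \<mu> \<and> \<not> is_weight (\<mu> + null_root)"

definition submodule :: "'v set \<Rightarrow> bool" where
  "submodule S \<longleftrightarrow> subspace S \<and>
     (\<forall>v\<in>S. (\<forall>i. e i v \<in> S \<and> f i v \<in> S) \<and> (\<forall>\<gamma>. H \<gamma> v \<in> S))"

definition irreducible_module :: bool where
  "irreducible_module \<longleftrightarrow> (\<exists>v::'v. v \<noteq> 0) \<and> (\<forall>S. submodule S \<longrightarrow> S = {0} \<or> S = UNIV)"

definition highest_weight_vector :: "weight \<Rightarrow> 'v \<Rightarrow> bool" where
  "highest_weight_vector \<Lambda> v \<longleftrightarrow> v \<noteq> 0 \<and> v \<in> weight_space \<Lambda> \<and> (\<forall>i. e i v = 0)"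

text \<open>In an irreducible module any highest weight vector generates the module, so this
  determines the module up to isomorphism.\<close>

definition irreducible_highest_weight :: "weight \<Rightarrow> bool" where
  "irreducible_highest_weight \<Lambda> \<longleftrightarrow>
     irreducible_module \<and> (\<exists>v. highest_weight_vector \<Lambda> v)"

end


section \<open>The t-analog of weight multiplicity and the t-string function\<close>

definition positive_roots :: "weight set" where
  "positive_roots =
     {alpha1 + of_nat (n - 1) *s null_root | n::nat. n \<ge> 1} \<union>
     {- alpha1 + of_nat n *s null_root | n::nat. n \<ge> 1} \<union>
     {of_nat n *s null_root | n::nat. n \<ge> 1}"

text \<open>Expanding each factor \<open>1 / (1 - t e(-\<alpha>))\<close> of the product over the positive roots as a
  geometric series, the coefficient of \<open>e(-\<beta>)\<close> is the sum of \<open>t ^ size M\<close> over all finite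
  multisets \<open>M\<close> of positive roots with sum \<open>\<beta>\<close>. There are finitely many of these (see
  \<open>finite_kostant_partitions\<close>), and none unless \<open>\<beta>\<close> is in the positive cone of the root lattice.\<close>

definition kostant_partitions :: "weight \<Rightarrow> weight multiset set" where
  "kostant_partitions \<beta> = {M. set_mset M \<subseteq> positive_roots \<and> \<Sum>\<^sub># M = \<beta>}"

definition kostant :: "weight \<Rightarrow> complex \<Rightarrow> complex" where
  "kostant \<beta> t = (\<Sum>M\<in>kostant_partitions \<beta>. t ^ size M)"

lemma finite_kostant_partitions: "finite (kostant_partitions \<beta>)"
proof -
  define ht :: "weight \<Rightarrow> real" where "ht u = Re (u $ 1) + 2 * Re (u $ 2)" for u
  have ht_add: "ht (u + v) = ht u + ht v" for u v by (simp add: ht_def)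
  have ht0: "ht 0 = 0" by (simp add: ht_def)
  have ht_pos: "ht u \<ge> 1" if "u \<in> positive_roots" for u
    using that
    by (auto simp: positive_roots_def ht_def alpha1_def null_root_def axis_def of_nat_diff)
  have ht_size: "real (size M) \<le> ht (\<Sum>\<^sub># M)" if "set_mset M \<subseteq> positive_roots" for M
    using that
  proof (induction M)
    case (add x M)
    then show ?case using ht_pos[of x] by (simp add: ht_add)
  qed (simp add: ht0)
  have ht_mem: "ht x \<le> ht (\<Sum>\<^sub># M)" if M: "set_mset M \<subseteq> positive_roots" and "x \<in># M" for M x
  proof -
    obtain M' where M': "M = add_mset x M'" using \<open>x \<in># M\<close> by (metis mset_add)
    have "0 \<le> real (size M')" by simp
    also have "\<dots> \<le> ht (\<Sum>\<^sub># M')" by (rule ht_size) (use M M' in auto)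
    finally show ?thesis by (simp add: M' ht_add)
  qed
  define N where "N = nat \<lceil>ht \<beta>\<rceil> + 2"
  define R where "R = (\<lambda>n. alpha1 + of_nat (n - 1) *s null_root) ` {..N} \<union>
     (\<lambda>n. - alpha1 + of_nat n *s null_root) ` {..N} \<union> (\<lambda>n. of_nat n *s null_root) ` {..N}"
  have finR: "finite R" by (simp add: R_def)
  have in_R: "x \<in> R" if "x \<in> positive_roots" "ht x \<le> ht \<beta>" for x
  proof -
    have le: "n \<le> N" if "real n \<le> ht \<beta> + 2" for n using that unfolding N_def by linarith
    from that show ?thesis unfolding positive_roots_def R_def
      by (auto simp: ht_def alpha1_def null_root_def axis_def of_nat_diff intro!: le imageI)
  qed
  have "kostant_partitions \<beta> \<subseteq> mset ` {xs. set xs \<subseteq> R \<and> length xs \<le> N}"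
  proof
    fix M assume M: "M \<in> kostant_partitions \<beta>"
    obtain xs where xs: "M = mset xs" by (metis ex_mset)
    have "real (size M) \<le> ht \<beta>" using M ht_size[of M] by (simp add: kostant_partitions_def)
    hence "length xs \<le> N" unfolding xs N_def by simp linarith
    moreover have "set xs \<subseteq> R"
      using M ht_mem[of M] in_R by (auto simp: kostant_partitions_def xs)
    ultimately show "M \<in> mset ` {xs. set xs \<subseteq> R \<and> length xs \<le> N}" using xs by blast
  qed
  thus ?thesis
    using finite_lists_length_le[OF finR, of N] by (meson finite_imageI finite_subset)
qed

text \<open>The sum over the infinite Weyl group has only finitely many nonzero terms.\<close>

definition lusztig_mult :: "weight \<Rightarrow> weight \<Rightarrow> complex \<Rightarrow> complex" where
  "lusztig_mult \<Lambda> \<mu> t =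
     (\<Sum>\<^sub>\<infinity>w\<in>weyl_group. (-1) ^ weyl_length w * kostant (w (\<Lambda> + rho) - (\<mu> + rho)) t)"

definition s_exponent :: "nat \<Rightarrow> weight \<Rightarrow> weight \<Rightarrow> complex" where
  "s_exponent m \<Lambda> lam = bform (\<Lambda> + rho) (\<Lambda> + rho) / (2 * (of_nat m + 2))
     - bform lam lam / (2 * of_nat m) - bform rho rho / 4"

definition t_string_function :: "nat \<Rightarrow> weight \<Rightarrow> weight \<Rightarrow> complex \<Rightarrow> complex \<Rightarrow> complex" where
  "t_string_function m \<Lambda> lam t \<tau> =
     exp (2 * of_real pi * \<i> * \<tau> * s_exponent m \<Lambda> lam) *
     (\<Sum>k. lusztig_mult \<Lambda> (lam - of_nat k *s null_root) t * exp (2 * of_real pi * \<i> * \<tau>) ^ k)"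


section \<open>The indefinite quadratic form and its groups\<close>

text \<open>Linear operators on the plane are given by their matrices, so that the identity component
  of the orthogonal group is taken in the usual topology.\<close>

definition qbil :: "nat \<Rightarrow> real ^ 2 \<Rightarrow> real ^ 2 \<Rightarrow> real" where
  "qbil m u v = 2 * (real m + 2) * u $ 1 * v $ 1 - 2 * real m * u $ 2 * v $ 2"

definition qform :: "nat \<Rightarrow> real ^ 2 \<Rightarrow> real" where
  "qform m v = 2 * (real m + 2) * (v $ 1)\<^sup>2 - 2 * real m * (v $ 2)\<^sup>2"

lemma qform_eq_qbil: "qform m v = qbil m v v"
  by (simp add: qform_def qbil_def power2_eq_square)

definition lattice_M :: "(real ^ 2) set" where
  "lattice_M = {v. \<forall>i. v $ i \<in> \<int>}"

definition dual_M :: "nat \<Rightarrow> (real ^ 2) set" where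
  "dual_M m = {u. \<forall>v\<in>lattice_M. qbil m u v \<in> \<int>}"

definition orth_group :: "nat \<Rightarrow> (real ^ 2 ^ 2) set" where
  "orth_group m = {g. invertible g \<and> (\<forall>v. qform m (g *v v) = qform m v)}"

definition SO0 :: "nat \<Rightarrow> (real ^ 2 ^ 2) set" where
  "SO0 m = connected_component_set (orth_group m) (mat 1)"

definition group_G :: "nat \<Rightarrow> (real ^ 2 ^ 2) set" where
  "group_G m = {g \<in> SO0 m. (*v) g ` lattice_M = lattice_M}"

definition group_G0 :: "nat \<Rightarrow> (real ^ 2 ^ 2) set" where
  "group_G0 m = {g \<in> group_G m. \<forall>v\<in>dual_M m. g *v v - v \<in> lattice_M}"

definition zeta :: "real ^ 2 ^ 2" where
  "zeta = vector [vector [-1, 0], vector [0, 1]]"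

definition group_Gt :: "nat \<Rightarrow> (real ^ 2 ^ 2) set" where
  "group_Gt m = {h ** g | h g. h \<in> {mat 1, zeta} \<and> g \<in> group_G m}"

definition U_plus :: "nat \<Rightarrow> (real ^ 2) set" where
  "U_plus m = {v. qform m v > 0}"

definition fund_domain :: "(real ^ 2) set" where
  "fund_domain = {v. v $ 1 > 0 \<and> 0 \<le> v $ 2 \<and> v $ 2 \<le> v $ 1} \<union> {v. 0 > v $ 2 \<and> v $ 2 > v $ 1}"

definition dagger :: "nat \<Rightarrow> real ^ 2 \<Rightarrow> real ^ 2" where
  "dagger m v = (THE u. u \<in> fund_domain \<and> (\<exists>g\<in>group_Gt m. u = g *v v))"

definition sign :: "real ^ 2 \<Rightarrow> int" where
  "sign v = (if v $ 1 \<ge> 0 then 1 else -1)"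

text \<open>The vector \<open>(A, B)\<close>. The two values of \<open>bform\<close> are integers for the weights of interest,
  so taking real parts only changes the type.\<close>

definition shift_AB :: "nat \<Rightarrow> weight \<Rightarrow> weight \<Rightarrow> real ^ 2" where
  "shift_AB m \<Lambda> lam =
     (let x0 = Re (bform (\<Lambda> + rho) alpha1) / (2 * (real m + 2));
          y0 = Re (bform lam alpha1) / (2 * real m)
      in if x0 \<ge> y0 then vector [x0, y0] else vector [1 / 2 - x0, 1 / 2 - y0])"

definition lattice_L :: "real ^ 2 \<Rightarrow> (real ^ 2) set" where
  "lattice_L c = (+) c ` lattice_M"


section \<open>The three functions and the constant term\<close>

text \<open>The exponents of \<open>t\<close> and \<open>z\<close> are integers, for which \<open>powr\<close> is the ordinary integer power
  of a nonzero base. The parameter \<open>c\<close> is the vector \<open>(A, B)\<close>.\<close>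

definition theta_term ::
    "nat \<Rightarrow> real ^ 2 \<Rightarrow> complex \<Rightarrow> complex \<Rightarrow> complex \<Rightarrow> real ^ 2 \<Rightarrow> complex" where
  "theta_term m c \<tau> t z v =
     of_int (sign v) * exp (of_real pi * \<i> * \<tau> * of_real (qform m v)) *
     t powr of_real (2 * (dagger m v $ 2 - c $ 2)) *
     z powr of_real ((real m + 2) * dagger m v $ 1 - real m * dagger m v $ 2 - 1 / 2)"

text \<open>The sum runs over orbits; the term does not depend on the representative chosen.\<close>

definition G0_orbits :: "nat \<Rightarrow> (real ^ 2) set \<Rightarrow> (real ^ 2) set set" where
  "G0_orbits m S = (\<lambda>v. (\<lambda>g. g *v v) ` group_G0 m) ` S"

definition Theta_L ::
    "nat \<Rightarrow> real ^ 2 \<Rightarrow> complex \<Rightarrow> complex \<Rightarrow> complex \<Rightarrow> complex" where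
  "Theta_L m c \<tau> t z =
     (\<Sum>\<^sub>\<infinity>X\<in>G0_orbits m (lattice_L c \<inter> U_plus m). theta_term m c \<tau> t z (SOME v. v \<in> X))"

definition eta_deformed :: "complex \<Rightarrow> complex \<Rightarrow> complex \<Rightarrow> complex" where
  "eta_deformed \<tau> t z = exp (- \<i> * of_real pi * \<tau> / 4) *
     (\<Prod>k. let q = exp (2 * of_real pi * \<i> * of_nat (Suc k) * \<tau>)
           in 1 / ((1 - t * q) * (1 - t * z * q) * (1 - t * inverse z * q)))"

definition poisson_kernel :: "complex \<Rightarrow> complex \<Rightarrow> complex" where
  "poisson_kernel t z = (1 - t\<^sup>2) / ((1 - t * z) * (1 - t * inverse z))"

definition laurent_series_on_annulus ::
    "(complex \<Rightarrow> complex) \<Rightarrow> real \<Rightarrow> real \<Rightarrow> (int \<Rightarrow> complex) \<Rightarrow> bool" where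
  "laurent_series_on_annulus F r R a \<longleftrightarrow>
     (\<forall>z. r < norm z \<and> norm z < R \<longrightarrow> ((\<lambda>n. a n * z powi n) has_sum F z) UNIV)"

end

theory Submission
  imports Defs
begin

text \<open>
  Write \<open>q = exp (2 \<pi> \<i> \<tau>)\<close>, \<open>J = (\<Lambda> + \<rho> | \<alpha>\<^sub>1)\<close> and \<open>j = (\<lambda> | \<alpha>\<^sub>1)\<close>. Everything is expressed through the numbers
  \<open>c(a) = \<Sum>\<^sub>i K(a \<alpha>\<^sub>1 + i \<delta>, t) q\<^sup>i\<close> (\<open>string_coeff\<close>), the coefficients of \<open>z\<^sup>a\<close> in
  \<open>\<Psi>(z) = \<Phi>(z) / (1 - t z)\<close>, where \<open>\<Phi>\<close> is the infinite product in \<open>\<eta>\<^sup>(\<^sup>-\<^sup>3\<^sup>)\<close>.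

  The string function. The Weyl group consists of the maps \<open>affine_refl s k\<close>, with a sign \<open>s\<close> and a
  translation \<open>k \<alpha>\<^sub>1\<close>. Exchanging the sums over the Weyl group and over the string gives
  \<open>\<Sum> \<plusminus> q\<^sup>Q c(a(s, k))\<close> with \<open>Q\<close> quadratic in \<open>k\<close> (\<open>t_string_function_eq\<close>). The definition of \<open>c\<close> sums over
  all integers \<open>i\<close>, the string function over the weights \<open>\<lambda> - i \<delta>\<close> with \<open>i \<ge> 0\<close> only; they
  agree because a maximal dominant weight is \<open>\<Lambda> - n \<alpha>\<^sub>0\<close> or \<open>\<Lambda> - n \<alpha>\<^sub>1\<close>
  (\<open>maximal_dominant_weight_cases\<close>), so that for \<open>i < 0\<close> no Kostant partition exists
  (\<open>kostant_eq_0\<close>).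

  The product. From \<open>\<Psi>(z) + (t / z) \<Psi>(1 / z) = \<Phi>(z) P(t, z)\<close> the coefficients of \<open>\<Phi> P\<close> are
  \<open>g(a) = c(a) + t c(- a - 1)\<close> (\<open>poisson_coeff\<close>). The diagram automorphism of the root system
  gives \<open>c(- a) = q\<^sup>a c(a)\<close>, and the reflection in \<open>\<alpha>\<^sub>1\<close> gives \<open>g(- a) = g(a)\<close>. Hence
  \<open>c(a) = g(a) - t q\<^bsup>a + 1\<^esup> c(a + 1)\<close>, and iterating in either direction
  (\<open>string_coeff_expansion\<close>)
  shows that \<open>c(a)\<close> is the sum of \<open>(- t)\<^sup>n q\<^bsup>n a + n (n + 1) / 2\<^esup> g(a + n)\<close> over \<open>n \<ge> 0\<close>,
  and also minus the sum of the same terms over \<open>n < 0\<close>.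

  The comparison. After this substitution the exponent of \<open>q\<close> is \<open>N(u) / 2\<close>, up to the shift \<open>1/8\<close>, for
  \<open>u = (\<plusminus>A + k + n/2, B + n/2)\<close>. The form \<open>N\<close> is indefinite, and one expansion
  for all \<open>k\<close> would meet directions in which \<open>N\<close> is negative. Using the first expansion for large
  \<open>k\<close> and the second one for small \<open>k\<close> selects exactly the \<open>u\<close> in the fundamental domain of the extended group, where \<open>N\<close> is positive and the double sum converges
  absolutely. On the other side, the orbits of \<open>L \<inter> U\<^sup>+\<close> under \<open>G\<^sub>0\<close> are
  parametrized by the same \<open>u\<close> (\<open>bij_betw_cone_orbits\<close>): the four sign and parity classes of \<open>(\<plusminus>, n)\<close> are the
  four cosets \<open>L\<close>, \<open>\<zeta>L\<close>, \<open>gL\<close>, \<open>g\<zeta>L\<close>, where \<open>g \<in> G\<close> has the matrix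
  \<open>(m + 1, m; m + 2, m + 1)\<close> and \<open>g\<^sup>2\<close> lies in \<open>G\<^sub>0\<close>. Picking out the constant term then gives the same sum
  (\<open>string_terms_sum\<close>). The case distinction in the definition of \<open>(A, B)\<close> is absorbed by the
  symmetry \<open>c(- a) = q\<^sup>a c(a)\<close>, which exchanges \<open>(A, B)\<close> with \<open>(1/2 - A, 1/2 - B)\<close>
  (\<open>string_terms_flip\<close>).
\<close>

section \<open>Weights in coordinates\<close>

lemma two_cases: "(i::2) = 0 \<or> i = 1"
  using exhaust_2[of i] by auto

lemma weight_eq_iff: "(u::weight) = v \<longleftrightarrow> u $ 1 = v $ 1 \<and> u $ 2 = v $ 2 \<and> u $ 3 = v $ 3"
  by (simp add: vec_eq_iff forall_3)

lemma weight_coords [simp]: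
  "alpha1 $ 1 = 1" "alpha1 $ 2 = 0" "alpha1 $ 3 = 0"
  "null_root $ 1 = 0" "null_root $ 2 = 1" "null_root $ 3 = 0"
  "Lambda0 $ 1 = 0" "Lambda0 $ 2 = 0" "Lambda0 $ 3 = 1"
  "rho $ 1 = 1 / 2" "rho $ 2 = 0" "rho $ 3 = 2"
  "simple_root 0 $ 1 = -1" "simple_root 0 $ 2 = 1" "simple_root 0 $ 3 = 0"
  "simple_root 1 $ 1 = 1" "simple_root 1 $ 2 = 0" "simple_root 1 $ 3 = 0"
  by (simp_all add: alpha1_def null_root_def Lambda0_def rho_def simple_root_def axis_def)

lemma bform_separates:
  assumes "\<mu> \<noteq> \<nu>"
  obtains \<gamma> where "bform \<mu> \<gamma> \<noteq> bform \<nu> \<gamma>"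
proof -
  have "bform \<mu> alpha1 \<noteq> bform \<nu> alpha1 \<or> bform \<mu> null_root \<noteq> bform \<nu> null_root
      \<or> bform \<mu> Lambda0 \<noteq> bform \<nu> Lambda0"
    using assms by (auto simp: bform_def weight_eq_iff)
  thus ?thesis using that by blast
qed

lemma bform_linear [simp]:
  "bform (u + v) w = bform u w + bform v w" "bform (u - v) w = bform u w - bform v w"
  "bform (c *s u) w = c * bform u w"
  by (simp_all add: bform_def algebra_simps)

section \<open>Maximal dominant weights\<close>

context affine_module
begin

sublocale e: Vector_Spaces.linear scale scale "e i" for i by (rule linear_e)
sublocale f: Vector_Spaces.linear scale scale "f i" for i by (rule linear_f)
sublocale H: Vector_Spaces.linear scale scale "H \<gamma>" for \<gamma> by (rule linear_H)

lemma e_f_apply: "e i (f j v) = f j (e i v) + (if i = j then H (simple_root i) v else 0)"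
  using fun_cong[OF e_f[of i j], of v] by (auto simp: commutator_def algebra_simps split: if_splits)

lemma H_f_apply: "H \<gamma> (f i v) = f i (H \<gamma> v) - scale (bform (simple_root i) \<gamma>) (f i v)"
  using fun_cong[OF H_f[of \<gamma> i], of v] by (simp add: commutator_def algebra_simps)

lemma H_e_apply: "H \<gamma> (e i v) = e i (H \<gamma> v) + scale (bform (simple_root i) \<gamma>) (e i v)"
  using fun_cong[OF H_e[of \<gamma> i], of v] by (simp add: commutator_def algebra_simps)

lemma weight_spaceD: "v \<in> weight_space \<mu> \<Longrightarrow> H \<gamma> v = scale (bform \<mu> \<gamma>) v"
  by (simp add: weight_space_def)

lemma subspace_weight_space: "subspace (weight_space \<mu>)"
  by (auto simp: subspace_def weight_space_def H.add H.scale scale_right_distrib mult.commute)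

lemma f_weight_space: "v \<in> weight_space \<mu> \<Longrightarrow> f i v \<in> weight_space (\<mu> - simple_root i)"
  by (auto simp: weight_space_def H_f_apply f.scale scale_left_diff_distrib)

lemma e_weight_space: "v \<in> weight_space \<mu> \<Longrightarrow> e i v \<in> weight_space (\<mu> + simple_root i)"
  by (auto simp: weight_space_def H_e_apply e.scale scale_left_distrib)

text \<open>Weight spaces for distinct weights are independent: the operator \<open>H \<gamma> - (\<nu> | \<gamma>)\<close>, for \<open>\<gamma>\<close>
  separating \<open>\<nu>\<close> from \<open>\<mu>\<close>, kills the weight space of \<open>\<nu>\<close> and acts on that of \<open>\<mu>\<close>
  by a nonzero scalar, which removes \<open>\<nu>\<close> from the family.\<close>

lemma weight_space_independent:
  assumes "finite F" "x \<in> span (\<Union>\<nu>\<in>F. weight_space \<nu>)" "x \<in> weight_space \<mu>" "\<mu> \<notin> F"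
  shows "x = 0"
  using assms
proof (induction F arbitrary: x rule: finite_induct)
  case empty
  then show ?case by simp
next
  case (insert \<nu> F)
  have "x \<in> span (weight_space \<nu> \<union> (\<Union>\<nu>\<in>F. weight_space \<nu>))"
    using insert.prems by simp
  then obtain x1 y where x: "x = x1 + y" and x1: "x1 \<in> weight_space \<nu>"
    and y: "y \<in> span (\<Union>\<nu>\<in>F. weight_space \<nu>)"
    by (auto simp: span_Un span_eq_iff[THEN iffD2, OF subspace_weight_space])
  obtain \<gamma> where \<gamma>: "bform \<mu> \<gamma> \<noteq> bform \<nu> \<gamma>"
    using insert.prems by (metis bform_separates insertI1)
  let ?D = "\<lambda>w. H \<gamma> w - scale (bform \<nu> \<gamma>) w"
  have "?D y \<in> span (\<Union>\<nu>\<in>F. weight_space \<nu>)"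
    using y
  proof (induction rule: span_induct_alt)
    case base
    then show ?case by (simp add: span_zero)
  next
    case (step c w z)
    obtain \<kappa> where \<kappa>: "\<kappa> \<in> F" "w \<in> weight_space \<kappa>" using step by blast
    have "?D (scale c w + z) = scale (c * (bform \<kappa> \<gamma> - bform \<nu> \<gamma>)) w + ?D z"
      using weight_spaceD[OF \<kappa>(2), of \<gamma>]
      by (simp add: H.add H.scale scale_right_distrib scale_left_diff_distrib algebra_simps)
    thus ?case using step \<kappa> by (metis span_add span_scale span_base UN_I)
  qed
  moreover have "?D y = scale (bform \<mu> \<gamma> - bform \<nu> \<gamma>) x"
    using weight_spaceD[OF x1, of \<gamma>] weight_spaceD[OF insert.prems(2), of \<gamma>] x
    by (simp add: H.add scale_left_diff_distrib scale_right_distrib algebra_simps)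
  ultimately have "scale (bform \<mu> \<gamma> - bform \<nu> \<gamma>) x \<in> span (\<Union>\<nu>\<in>F. weight_space \<nu>)" by simp
  hence "x \<in> span (\<Union>\<nu>\<in>F. weight_space \<nu>)"
    using \<gamma> span_scale[of "scale (bform \<mu> \<gamma> - bform \<nu> \<gamma>) x" _ "inverse (bform \<mu> \<gamma> - bform \<nu> \<gamma>)"] by simp
  thus ?case using insert by auto
qed

definition f_word :: "2 list \<Rightarrow> 'v \<Rightarrow> 'v" where
  "f_word is v = foldr f is v"

lemma f_word_weight:
  assumes "v \<in> weight_space \<Lambda>"
  shows "\<exists>a b::nat. f_word is v \<in> weight_space (\<Lambda> - of_nat a *s alpha1 - of_nat b *s simple_root 0)"
proof (induction "is")
  case Nil
  have "\<Lambda> - of_nat 0 *s alpha1 - of_nat 0 *s simple_root 0 = \<Lambda>" by simp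
  then show ?case using assms unfolding f_word_def by (metis foldr.simps(1) id_apply)
next
  case (Cons i "is")
  then obtain a b where "f_word is v \<in> weight_space (\<Lambda> - of_nat a *s alpha1 - of_nat b *s simple_root 0)"
    by blast
  from f_weight_space[OF this, of i]
  have *: "f_word (i # is) v \<in> weight_space (\<Lambda> - of_nat a *s alpha1 - of_nat b *s simple_root 0 - simple_root i)"
    by (simp add: f_word_def)
  have "i = 0 \<or> i = 1" by (rule two_cases)
  thus ?case
  proof
    assume i: "i = 0"
    have "\<Lambda> - of_nat a *s alpha1 - of_nat b *s simple_root 0 - simple_root i =
        \<Lambda> - of_nat a *s alpha1 - of_nat (Suc b) *s simple_root 0"
      by (simp add: i weight_eq_iff algebra_simps)
    thus ?thesis using * by metis
  next
    assume i: "i = 1"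
    have "\<Lambda> - of_nat a *s alpha1 - of_nat b *s simple_root 0 - simple_root i =
        \<Lambda> - of_nat (Suc a) *s alpha1 - of_nat b *s simple_root 0"
      by (simp add: i weight_eq_iff algebra_simps)
    thus ?thesis using * by metis
  qed
qed

text \<open>Commuting an \<open>e\<^sub>i\<close> through a word in the \<open>f\<^sub>j\<close> only leaves shorter words, because the highest
  weight vector is killed by every \<open>e\<^sub>i\<close>.\<close>

lemma submodule_f_words:
  assumes v: "highest_weight_vector \<Lambda> v"
  shows "submodule (span (range (\<lambda>is. f_word is v)))"
proof -
  let ?S = "span (range (\<lambda>is. f_word is v))"
  have v': "v \<in> weight_space \<Lambda>" "\<And>i. e i v = 0" using v by (auto simp: highest_weight_vector_def)
  have closed: "h w \<in> ?S" if "Vector_Spaces.linear scale scale h"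
    "\<And>is. h (f_word is v) \<in> ?S" "w \<in> ?S" for h w
  proof -
    interpret h: Vector_Spaces.linear scale scale h by fact
    show ?thesis using that(3)
      by (induction rule: span_induct_alt)
         (use that(2) in \<open>auto simp: h.add h.scale intro!: span_add span_scale span_zero\<close>)
  qed
  have f: "f i w \<in> ?S" if "w \<in> ?S" for i w
  proof (rule closed[OF linear_f _ that])
    fix "is" show "f i (f_word is v) \<in> ?S"
      by (rule span_base) (auto simp: f_word_def image_iff intro!: exI[of _ "i # is"])
  qed
  have Hw: "H \<gamma> (f_word is v) \<in> ?S" for \<gamma> "is"
    using f_word_weight[OF v'(1), of "is"] weight_spaceD span_scale span_base by (metis rangeI)
  have H: "H \<gamma> w \<in> ?S" if "w \<in> ?S" for \<gamma> w
    by (rule closed[OF linear_H Hw that])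
  have ew: "e i (f_word is v) \<in> ?S" for i "is"
  proof (induction "is")
    case Nil
    then show ?case by (simp add: f_word_def v' span_zero)
  next
    case (Cons j "is")
    have "e i (f_word (j # is) v) =
        f j (e i (f_word is v)) + (if i = j then H (simple_root i) (f_word is v) else 0)"
      by (simp add: f_word_def e_f_apply)
    thus ?case using f[OF Cons] Hw by (auto intro: span_add)
  qed
  have e: "e i w \<in> ?S" if "w \<in> ?S" for i w
    by (rule closed[OF linear_e ew that])
  show ?thesis unfolding submodule_def using e f H by auto
qed

text \<open>By irreducibility the words in the \<open>f\<^sub>i\<close> span the module, and each of them is a weight vector; the
  independence of weight spaces excludes all other weights.\<close>

lemma weight_in_cone:
  assumes irr: "irreducible_module" and v: "highest_weight_vector \<Lambda> v" and \<mu>: "is_weight \<mu>"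
  shows "\<exists>a b::nat. \<mu> = \<Lambda> - of_nat a *s alpha1 - of_nat b *s simple_root 0"
proof -
  have v': "v \<in> weight_space \<Lambda>" "v \<noteq> 0" using v by (auto simp: highest_weight_vector_def)
  have "v \<in> range (\<lambda>is. f_word is v)" by (auto simp: f_word_def image_iff intro!: exI[of _ "[]"])
  hence "span (range (\<lambda>is. f_word is v)) \<noteq> {0}" using v'(2) by (metis span_base singletonD)
  hence U: "span (range (\<lambda>is. f_word is v)) = UNIV"
    using irr submodule_f_words[OF v] by (auto simp: irreducible_module_def)
  obtain x where x: "x \<in> weight_space \<mu>" "x \<noteq> 0"
    using \<mu> subspace_0[OF subspace_weight_space, of \<mu>] unfolding is_weight_def by blast
  have "x \<in> span (range (\<lambda>is. f_word is v))" using U by simp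
  then obtain T r where T: "finite T" "T \<subseteq> range (\<lambda>is. f_word is v)" "x = (\<Sum>a\<in>T. scale (r a) a)"
    unfolding span_explicit by blast
  have "\<forall>w\<in>T. \<exists>a b::nat. w \<in> weight_space (\<Lambda> - of_nat a *s alpha1 - of_nat b *s simple_root 0)"
    using T(2) f_word_weight[OF v'(1)] by fastforce
  then obtain a b where ab: "\<And>w. w \<in> T \<Longrightarrow>
      w \<in> weight_space (\<Lambda> - of_nat (a w :: nat) *s alpha1 - of_nat (b w :: nat) *s simple_root 0)"
    by metis
  let ?F = "(\<lambda>w. \<Lambda> - of_nat (a w) *s alpha1 - of_nat (b w) *s simple_root 0) ` T"
  have "x \<in> span (\<Union>\<nu>\<in>?F. weight_space \<nu>)"
    unfolding T(3) using ab by (intro span_sum span_scale span_base) blast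
  hence "\<mu> \<in> ?F" using weight_space_independent[of ?F x \<mu>] T(1) x by blast
  thus ?thesis by blast
qed

lemma f_power_weight_space:
  assumes "v \<in> weight_space \<Lambda>"
  shows "(f i ^^ n) v \<in> weight_space (\<Lambda> - of_nat n *s simple_root i)"
proof (induction n)
  case 0
  then show ?case using assms by simp
next
  case (Suc n)
  have "\<Lambda> - of_nat (Suc n) *s simple_root i = \<Lambda> - of_nat n *s simple_root i - simple_root i"
    by (simp add: weight_eq_iff algebra_simps)
  then show ?case using f_weight_space[OF Suc, of i] by (metis funpow.simps(2) o_apply)
qed

lemma e_f_power:
  assumes v: "v \<in> weight_space \<Lambda>" "e i v = 0"
  shows "e i ((f i ^^ Suc n) v) =
    scale (of_nat (Suc n) * (bform \<Lambda> (simple_root i) - of_nat n)) ((f i ^^ n) v)"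
proof (induction n)
  case 0
  then show ?case using v by (simp add: e_f_apply weight_spaceD)
next
  case (Suc n)
  have b: "bform (simple_root i) (simple_root i) = 2"
    using two_cases[of i] by (auto simp: bform_def)
  have "e i ((f i ^^ Suc (Suc n)) v) = f i (e i ((f i ^^ Suc n) v)) + H (simple_root i) ((f i ^^ Suc n) v)"
    by (simp add: e_f_apply)
  also have "H (simple_root i) ((f i ^^ Suc n) v) =
      scale (bform \<Lambda> (simple_root i) - 2 * of_nat (Suc n)) ((f i ^^ Suc n) v)"
    unfolding weight_spaceD[OF f_power_weight_space[OF v(1)]]
    using b by (simp add: algebra_simps)
  also have "f i (e i ((f i ^^ Suc n) v)) =
      scale (of_nat (Suc n) * (bform \<Lambda> (simple_root i) - of_nat n)) ((f i ^^ Suc n) v)"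
    unfolding Suc by (simp add: f.scale)
  also have "\<dots> + scale (bform \<Lambda> (simple_root i) - 2 * of_nat (Suc n)) ((f i ^^ Suc n) v) =
     scale (of_nat (Suc (Suc n)) * (bform \<Lambda> (simple_root i) - of_nat (Suc n))) ((f i ^^ Suc n) v)"
    unfolding scale_left_distrib[symmetric] by (rule arg_cong2[where f = scale]) (auto simp: algebra_simps)
  finally show ?case .
qed

text \<open>The \<open>sl\<^sub>2\<close> argument: \<open>e\<^sub>i\<close> maps \<open>f\<^sub>i\<^sup>n\<^sup>+\<^sup>1 v\<close> to \<open>(n + 1)(j - n)\<close> times \<open>f\<^sub>i\<^sup>n v\<close>.\<close>

lemma f_power_nonzero:
  assumes v: "highest_weight_vector \<Lambda> v" and "bform \<Lambda> (simple_root i) = of_nat j" "n \<le> j"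
  shows "(f i ^^ n) v \<noteq> 0"
  using assms(3)
proof (induction n)
  case 0
  then show ?case using v by (simp add: highest_weight_vector_def)
next
  case (Suc n)
  have "of_nat (Suc n) * (of_nat j - of_nat n) \<noteq> (0::complex)" using Suc.prems by (simp del: of_nat_Suc)
  hence "e i ((f i ^^ Suc n) v) \<noteq> 0"
    using e_f_power[of v \<Lambda> i n] v assms(2) Suc by (auto simp: highest_weight_vector_def scale_eq_0_iff)
  thus ?case by (metis e.zero)
qed

text \<open>Root vectors for \<open>\<delta>\<close> and \<open>- \<delta>\<close>. They generate a Heisenberg algebra in which the central element acts
  by a multiple of the level, so at nonzero level the string below a weight never stops.\<close>

definition raise_delta :: "'v \<Rightarrow> 'v" where
  "raise_delta v = e 0 (e 1 v) - e 1 (e 0 v)"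

definition lower_delta :: "'v \<Rightarrow> 'v" where
  "lower_delta v = f 0 (f 1 v) - f 1 (f 0 v)"

text \<open>The commutator of \<open>[e\<^sub>0, e\<^sub>1]\<close> and \<open>[f\<^sub>0, f\<^sub>1]\<close> is \<open>- 2 (h\<^sub>0 + h\<^sub>1)\<close>, and \<open>h\<^sub>0 + h\<^sub>1\<close> acts on every
  weight space by the level.\<close>

lemma heisenberg_relation:
  assumes v: "v \<in> weight_space \<mu>"
  shows "raise_delta (lower_delta v) = lower_delta (raise_delta v) - scale (2 * level \<mu>) v"
proof -
  have b: "bform (simple_root 0) (simple_root 0) = 2" "bform (simple_root 1) (simple_root 1) = 2"
    "bform (simple_root 0) (simple_root 1) = -2" "bform (simple_root 1) (simple_root 0) = -2"
    by (auto simp: bform_def)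
  have ne: "(0::2) \<noteq> 1" "(1::2) \<noteq> 0" by auto
  have h: "H \<gamma> v = scale (bform \<mu> \<gamma>) v" for \<gamma> by (rule weight_spaceD[OF v])
  have lv: "level \<mu> = bform \<mu> (simple_root 0) + bform \<mu> (simple_root 1)"
    by (simp add: level_def bform_def)
  show ?thesis unfolding raise_delta_def lower_delta_def lv
    by (simp add: e_f_apply H_f_apply H_e_apply f.diff e.diff f.add e.add ne b h f.scale e.scale H.scale
        f.zero e.zero scale_left_distrib algebra_simps)
qed

lemma raise_delta_weight_space:
  assumes "v \<in> weight_space \<mu>" shows "raise_delta v \<in> weight_space (\<mu> + null_root)"
proof -
  have "\<mu> + simple_root 1 + simple_root 0 = \<mu> + null_root"
    "\<mu> + simple_root 0 + simple_root 1 = \<mu> + null_root"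
    by (simp_all add: weight_eq_iff)
  with e_weight_space[OF e_weight_space[OF assms, of 1], of 0]
    e_weight_space[OF e_weight_space[OF assms, of 0], of 1]
  show ?thesis unfolding raise_delta_def by (simp add: subspace_diff[OF subspace_weight_space])
qed

lemma lower_delta_weight_space:
  assumes "v \<in> weight_space \<mu>" shows "lower_delta v \<in> weight_space (\<mu> - null_root)"
proof -
  have "\<mu> - simple_root 1 - simple_root 0 = \<mu> - null_root"
    "\<mu> - simple_root 0 - simple_root 1 = \<mu> - null_root"
    by (simp_all add: weight_eq_iff)
  with f_weight_space[OF f_weight_space[OF assms, of 1], of 0]
    f_weight_space[OF f_weight_space[OF assms, of 0], of 1]
  show ?thesis unfolding lower_delta_def by (simp add: subspace_diff[OF subspace_weight_space])
qed

lemma lower_delta_scale: "lower_delta (scale c v) = scale c (lower_delta v)"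
  by (simp add: lower_delta_def f.scale scale_right_diff_distrib)

lemma lower_delta_power:
  assumes w: "w \<in> weight_space \<mu>" "raise_delta w = 0"
  shows "(lower_delta ^^ r) w \<in> weight_space (\<mu> - of_nat r *s null_root)"
    and "raise_delta ((lower_delta ^^ Suc r) w) =
      scale (- 2 * level \<mu> * of_nat (Suc r)) ((lower_delta ^^ r) w)"
proof -
  have ws: "(lower_delta ^^ r) w \<in> weight_space (\<mu> - of_nat r *s null_root)" for r
  proof (induction r)
    case 0
    then show ?case using w by simp
  next
    case (Suc r)
    have "\<mu> - of_nat (Suc r) *s null_root = \<mu> - of_nat r *s null_root - null_root"
      by (simp add: weight_eq_iff)
    then show ?case using lower_delta_weight_space[OF Suc] by (metis funpow.simps(2) o_apply)
  qed
  show "(lower_delta ^^ r) w \<in> weight_space (\<mu> - of_nat r *s null_root)" by (rule ws)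
  have lev: "level (\<mu> - of_nat r *s null_root) = level \<mu>" for r
    by (simp add: level_def bform_def)
  show "raise_delta ((lower_delta ^^ Suc r) w) =
      scale (- 2 * level \<mu> * of_nat (Suc r)) ((lower_delta ^^ r) w)"
  proof (induction r)
    case 0
    have "lower_delta 0 = 0" by (simp add: lower_delta_def f.zero)
    then show ?case using heisenberg_relation[OF w(1)] w(2) by simp
  next
    case (Suc r)
    have "raise_delta ((lower_delta ^^ Suc (Suc r)) w) =
        lower_delta (raise_delta ((lower_delta ^^ Suc r) w)) - scale (2 * level \<mu>) ((lower_delta ^^ Suc r) w)"
      using heisenberg_relation[OF ws, of "Suc r"] lev[of "Suc r"] by simp
    also have "\<dots> = scale (- 2 * level \<mu> * of_nat (Suc r) - 2 * level \<mu>) ((lower_delta ^^ Suc r) w)"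
      unfolding Suc lower_delta_scale scale_left_diff_distrib by simp
    finally show ?case by (simp add: algebra_simps)
  qed
qed

lemma lower_delta_power_nonzero:
  assumes w: "w \<in> weight_space \<mu>" "raise_delta w = 0" "w \<noteq> 0" and "level \<mu> \<noteq> 0"
  shows "(lower_delta ^^ r) w \<noteq> 0"
proof (induction r)
  case 0
  then show ?case using w by simp
next
  case (Suc r)
  have "- 2 * level \<mu> * of_nat (Suc r) \<noteq> 0" using assms(4) by (simp del: of_nat_Suc)
  hence "raise_delta ((lower_delta ^^ Suc r) w) \<noteq> 0"
    using lower_delta_power(2)[OF w(1,2), of r] Suc by (simp only: scale_eq_0_iff) simp
  moreover have "raise_delta 0 = 0" by (simp add: raise_delta_def e.zero)
  ultimately show ?case by metis
qed

text \<open>The vector \<open>f\<^sub>i\<^sup>n v\<close> is killed by \<open>raise_delta\<close>, since its weight plus \<open>\<delta>\<close> is not below \<open>\<Lambda>\<close>. It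
  is therefore a vacuum vector for the Heisenberg algebra, and all its images under powers of
  \<open>lower_delta\<close> are nonzero.\<close>

lemma weights_below_edge:
  assumes irr: "irreducible_module" and v: "highest_weight_vector \<Lambda> v" and lev: "level \<Lambda> \<noteq> 0"
    and j: "bform \<Lambda> (simple_root i) = of_nat j" "n \<le> j"
  shows "is_weight (\<Lambda> - of_nat n *s simple_root i - of_nat r *s null_root)"
proof -
  let ?\<mu> = "\<Lambda> - of_nat n *s simple_root i"
  let ?w = "(f i ^^ n) v"
  have w: "?w \<in> weight_space ?\<mu>"
    using v by (intro f_power_weight_space) (simp add: highest_weight_vector_def)
  have "\<not> is_weight (?\<mu> + null_root)"
  proof
    assume "is_weight (?\<mu> + null_root)"
    then obtain a b :: nat where ab: "?\<mu> + null_root = \<Lambda> - of_nat a *s alpha1 - of_nat b *s simple_root 0"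
      using weight_in_cone[OF irr v] by blast
    show False
    proof (cases "i = 0")
      case True
      hence "1 - of_nat n = (- of_nat b :: complex)" "of_nat n = (of_nat b - of_nat a :: complex)"
        using arg_cong[OF ab, of "\<lambda>u. u $ 2"] arg_cong[OF ab, of "\<lambda>u. u $ 1"] by simp_all
      hence "of_nat (1 + b) = (of_nat n :: complex)" "of_nat (n + a) = (of_nat b :: complex)"
        by (simp_all add: diff_eq_eq)
      hence "1 + b = n" "n + a = b" by (simp_all only: of_nat_eq_iff)
      thus ?thesis by simp
    next
      case False
      hence i: "i = 1" using two_cases by blast
      hence "1 = (- of_nat b :: complex)" using ab by (auto simp: weight_eq_iff)
      hence "of_nat (1 + b) = (of_nat 0 :: complex)" by (simp add: eq_neg_iff_add_eq_0)
      hence "1 + b = 0" by (simp only: of_nat_eq_iff)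
      thus ?thesis by simp
    qed
  qed
  hence "raise_delta ?w = 0" using raise_delta_weight_space[OF w] by (auto simp: is_weight_def)
  moreover have "level ?\<mu> \<noteq> 0"
    using lev two_cases[of i] by (auto simp: level_def bform_def)
  ultimately have "(lower_delta ^^ r) ?w \<noteq> 0"
    "(lower_delta ^^ r) ?w \<in> weight_space (?\<mu> - of_nat r *s null_root)"
    using lower_delta_power_nonzero lower_delta_power(1) w f_power_nonzero[OF v j] by blast+
  thus ?thesis unfolding is_weight_def by blast
qed

text \<open>A weight below \<open>\<Lambda>\<close> has the form \<open>\<Lambda> - n \<alpha>\<^sub>i - r \<delta>\<close>. Dominance bounds \<open>n\<close>, so that
  \<open>weights_below_edge\<close> applies, and maximality forces \<open>r = 0\<close>.\<close>

lemma maximal_dominant_weight_cases: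
  assumes irr: "irreducible_highest_weight \<Lambda>" and lev: "level \<Lambda> \<noteq> 0"
    and dom: "dominant_integral \<Lambda>" "dominant_integral lam" and max: "maximal_weight lam"
  obtains i and n :: nat where "lam = \<Lambda> - of_nat n *s simple_root i"
proof -
  obtain v where v: "irreducible_module" "highest_weight_vector \<Lambda> v"
    using irr by (auto simp: irreducible_highest_weight_def)
  obtain a b :: nat where ab: "lam = \<Lambda> - of_nat a *s alpha1 - of_nat b *s simple_root 0"
    using weight_in_cone[OF v] max unfolding maximal_weight_def by blast
  \<comment> \<open>If both coefficients were positive, \<open>lam + \<delta>\<close> would still lie below an edge weight.\<close>
  have *: False if "lam = \<Lambda> - of_nat n *s simple_root i - of_nat (Suc r) *s null_root" for n r i
  proof -
    obtain j where j: "bform \<Lambda> (simple_root i) = of_nat j"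
      using dom(1) by (auto simp: dominant_integral_def Nats_def)
    obtain j' where j': "bform lam (simple_root i) = of_nat j'"
      using dom(2) by (auto simp: dominant_integral_def Nats_def)
    have "bform lam (simple_root i) = of_nat j - 2 * of_nat n"
      using j two_cases[of i] unfolding that by (auto simp: bform_def)
    hence "of_nat (j' + 2 * n) = (of_nat j :: complex)" using j' by simp
    hence "n \<le> j" by (simp only: of_nat_eq_iff)
    hence "is_weight (\<Lambda> - of_nat n *s simple_root i - of_nat r *s null_root)"
      by (rule weights_below_edge[OF v lev j])
    moreover have "lam + null_root = \<Lambda> - of_nat n *s simple_root i - of_nat r *s null_root"
      unfolding that by (simp add: weight_eq_iff)
    ultimately show False using max by (simp add: maximal_weight_def)
  qed
  consider "a = 0" | "b = 0" | s n where "a = Suc s + n" "b = Suc s" | s n where "b = Suc s + n" "a = Suc s"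
  proof (cases "a = 0 \<or> b = 0")
    case False
    then obtain a' b' where "a = Suc a'" "b = Suc b'" by (meson not0_implies_Suc)
    then show ?thesis using that(3,4) le_Suc_ex[of a b] le_Suc_ex[of b a] nat_le_linear[of a b] by metis
  qed (use that in blast)
  thus ?thesis
  proof cases
    case 1
    hence "lam = \<Lambda> - of_nat b *s simple_root 0" using ab by (simp add: weight_eq_iff)
    thus ?thesis by (rule that)
  next
    case 2
    hence "lam = \<Lambda> - of_nat a *s simple_root 1" using ab by (simp add: weight_eq_iff)
    thus ?thesis by (rule that)
  next
    case 3
    have "lam = \<Lambda> - of_nat n *s simple_root 1 - of_nat (Suc s) *s null_root"
      unfolding ab 3 by (simp add: weight_eq_iff algebra_simps)
    thus ?thesis using * by blast
  next
    case 4
    have "lam = \<Lambda> - of_nat n *s simple_root 0 - of_nat (Suc s) *s null_root"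
      unfolding ab 4 by (simp add: weight_eq_iff algebra_simps)
    thus ?thesis using * by blast
  qed
qed

end

section \<open>The affine Weyl group\<close>

text \<open>The translation by \<open>k \<alpha>\<^sub>1\<close>, that is
  \<open>u \<mapsto> u + (u | \<delta>) k \<alpha>\<^sub>1 - ((u | k \<alpha>\<^sub>1) + k\<^sup>2 (u | \<delta>)) \<delta>\<close>, preceded by the reflection \<open>r\<^sub>1\<close>
  if \<open>s\<close> holds.\<close>

definition affine_refl :: "bool \<Rightarrow> int \<Rightarrow> weight \<Rightarrow> weight" where
  "affine_refl s k u =
    (let a = (if s then - u $ 1 else u $ 1) in
     (a + of_int k * u $ 3) *s alpha1 + (u $ 2 - 2 * a * of_int k - (of_int k)\<^sup>2 * u $ 3) *s null_root
       + u $ 3 *s Lambda0)"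

lemma affine_refl_coords [simp]:
  "affine_refl s k u $ 1 = (if s then - u $ 1 else u $ 1) + of_int k * u $ 3"
  "affine_refl s k u $ 2 = u $ 2 - 2 * (if s then - u $ 1 else u $ 1) * of_int k - (of_int k)\<^sup>2 * u $ 3"
  "affine_refl s k u $ 3 = u $ 3"
  by (simp_all add: affine_refl_def Let_def)

text \<open>The infinite dihedral group: \<open>r\<^sub>1\<close> and \<open>r\<^sub>0\<close> act on the translation part as \<open>k \<mapsto> - k\<close> and
  \<open>k \<mapsto> 1 - k\<close>.\<close>

lemma reflection_affine_refl:
  "reflection 1 \<circ> affine_refl s k = affine_refl (\<not> s) (- k)"
  "reflection 0 \<circ> affine_refl s k = affine_refl (\<not> s) (1 - k)"
  by (rule ext, auto simp: weight_eq_iff reflection_def bform_def algebra_simps power2_eq_square)+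

lemma affine_refl_id: "affine_refl False 0 = id"
  by (rule ext) (simp add: weight_eq_iff)

lemma word_elem_Cons: "word_elem (i # is) = reflection i \<circ> word_elem is"
  by (simp add: word_elem_def)

lemma word_elem_affine_refl: "\<exists>k. word_elem is = affine_refl (odd (length is)) k"
proof (induction "is")
  case Nil
  show ?case by (rule exI[of _ 0]) (simp add: word_elem_def affine_refl_id)
next
  case (Cons i "is")
  then obtain k where k: "word_elem is = affine_refl (odd (length is)) k" by blast
  have "word_elem (i # is) = affine_refl (odd (length (i # is))) (if i = 0 then 1 - k else - k)"
    using two_cases[of i]
    by (elim disjE) (simp_all only: word_elem_Cons k reflection_affine_refl list.size even_Suc
        add_Suc_right add_0_right if_True if_False zero_neq_one one_neq_zero refl)
  thus ?case by blast
qed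

lemma affine_refl_in_weyl_group: "affine_refl s k \<in> weyl_group"
proof -
  have step: "reflection i \<circ> w \<in> weyl_group" if "w \<in> weyl_group" for i w
    using that word_elem_Cons unfolding weyl_group_def by (metis rangeE rangeI)
  have tr: "affine_refl False k \<in> weyl_group" for k
  proof (induction k rule: int_induct[of _ 0])
    case base
    have "id = word_elem []" by (simp add: word_elem_def)
    then show ?case unfolding affine_refl_id weyl_group_def by blast
  next
    case (step1 k)
    have "affine_refl False (k + 1) = reflection 0 \<circ> (reflection 1 \<circ> affine_refl False k)"
      by (simp add: reflection_affine_refl add.commute)
    then show ?case using step step1 by metis
  next
    case (step2 k)
    have "affine_refl False (k - 1) = reflection 1 \<circ> (reflection 0 \<circ> affine_refl False k)"
      by (simp add: reflection_affine_refl)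
    then show ?case using step step2 by metis
  qed
  have "affine_refl True k = reflection 1 \<circ> affine_refl False (- k)"
    by (simp add: reflection_affine_refl)
  thus ?thesis using tr[of k] step[OF tr[of "- k"], of 1] by (cases s) auto
qed

lemma weyl_group_eq: "weyl_group = range (\<lambda>(s, k). affine_refl s k)"
proof
  show "weyl_group \<subseteq> range (\<lambda>(s, k). affine_refl s k)"
  proof
    fix w assume "w \<in> weyl_group"
    then obtain "is" where "w = word_elem is" by (auto simp: weyl_group_def)
    moreover obtain k where "word_elem is = affine_refl (odd (length is)) k"
      using word_elem_affine_refl by blast
    ultimately have "w = (case (odd (length is), k) of (s, k) \<Rightarrow> affine_refl s k)" by simp
    thus "w \<in> range (\<lambda>(s, k). affine_refl s k)" by blast
  qed
  show "range (\<lambda>(s, k). affine_refl s k) \<subseteq> weyl_group"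
    using affine_refl_in_weyl_group by auto
qed

lemma inj_affine_refl: "inj (\<lambda>(s, k). affine_refl s k)"
proof (rule injI)
  fix p p' :: "bool \<times> int"
  obtain s k where p: "p = (s, k)" by fastforce
  obtain s' k' where p': "p' = (s', k')" by fastforce
  assume "(case p of (s, k) \<Rightarrow> affine_refl s k) = (case p' of (s, k) \<Rightarrow> affine_refl s k)"
  hence eq: "affine_refl s k u = affine_refl s' k' u" for u by (simp add: p p')
  from arg_cong[OF eq[of Lambda0], of "\<lambda>v. v $ 1"] have "k = k'" by (simp split: if_splits)
  moreover from arg_cong[OF eq[of alpha1], of "\<lambda>v. v $ 1"] have "s = s'" by (simp split: if_splits)
  ultimately show "p = p'" by (simp add: p p')
qed

text \<open>Every word for a given element has the same parity, because the flag \<open>s\<close> is determined by the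
  element.\<close>

lemma weyl_sign: "(-1) ^ weyl_length (affine_refl s k) = (if s then -1 else 1 :: complex)"
proof -
  let ?w = "affine_refl s k"
  obtain "is" where "word_elem is = ?w"
    using affine_refl_in_weyl_group[of s k] unfolding weyl_group_def by auto
  hence "\<exists>n. \<exists>is. length is = n \<and> word_elem is = ?w" by blast
  from LeastI_ex[OF this] obtain js where js: "length js = weyl_length ?w" "word_elem js = ?w"
    unfolding weyl_length_def by blast
  obtain k' where "?w = affine_refl (odd (length js)) k'"
    using word_elem_affine_refl[of js] js by metis
  hence "(case (s, k) of (s, k) \<Rightarrow> affine_refl s k) =
      (case (odd (length js), k') of (s, k) \<Rightarrow> affine_refl s k)" by simp
  hence "(s, k) = (odd (length js), k')" by (rule injD[OF inj_affine_refl])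
  thus ?thesis using js by auto
qed

section \<open>Generating functions of multisets\<close>

lemma summable_on_product_nonneg:
  fixes f :: "'a \<Rightarrow> real" and g :: "'b \<Rightarrow> real"
  assumes "f summable_on A" "g summable_on B" "\<And>x. x \<in> A \<Longrightarrow> f x \<ge> 0" "\<And>y. y \<in> B \<Longrightarrow> g y \<ge> 0"
  shows "(\<lambda>(x, y). f x * g y) summable_on A \<times> B"
proof (rule summable_on_SigmaI)
  show "((\<lambda>y. case (x, y) of (x, y) \<Rightarrow> f x * g y) has_sum (f x * infsum g B)) B" for x
    using has_sum_cmult_right[OF has_sum_infsum[OF assms(2)], of "f x"] by simp
  show "(\<lambda>x. f x * infsum g B) summable_on A" by (rule summable_on_cmult_left[OF assms(1)])
qed (use assms in auto)

lemma has_sum_product: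
  fixes f :: "'a \<Rightarrow> 'c::{real_normed_field, banach}" and g :: "'b \<Rightarrow> 'c"
  assumes f: "(f has_sum a) A" "(\<lambda>x. norm (f x)) summable_on A"
    and g: "(g has_sum b) B" "(\<lambda>y. norm (g y)) summable_on B"
  shows "((\<lambda>(x, y). f x * g y) has_sum (a * b)) (A \<times> B)"
proof (rule has_sum_SigmaI)
  show "((\<lambda>y. case (x, y) of (x, y) \<Rightarrow> f x * g y) has_sum (f x * b)) B" for x
    using has_sum_cmult_right[OF g(1), of "f x"] by simp
  show "((\<lambda>x. f x * b) has_sum (a * b)) A" by (rule has_sum_cmult_left[OF f(1)])
  have "(\<lambda>(x, y). norm (f x) * norm (g y)) summable_on A \<times> B"
    by (rule summable_on_product_nonneg[OF f(2) g(2)]) auto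
  hence "(\<lambda>p. norm ((\<lambda>(x, y). f x * g y) p)) summable_on A \<times> B"
    by (simp add: case_prod_unfold norm_mult)
  thus "(\<lambda>(x, y). f x * g y) summable_on A \<times> B" by (rule abs_summable_summable)
qed

definition multisets_over :: "'a set \<Rightarrow> 'a multiset set" where
  "multisets_over R = {M. set_mset M \<subseteq> R}"

lemma norm_prod_mset_image:
  fixes x :: "'a \<Rightarrow> 'b::real_normed_field"
  shows "norm (\<Prod>i\<in>#M. x i) = (\<Prod>i\<in>#M. norm (x i))"
  by (induction M) (simp_all add: norm_mult)

lemma has_sum_geometric:
  fixes x :: "'b::{real_normed_field, banach}"
  assumes "norm x < 1"
  shows "((\<lambda>n. x ^ n) has_sum (1 / (1 - x))) UNIV"
  by (rule norm_summable_imp_has_sum)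
     (use assms in \<open>auto intro!: geometric_sums simp: norm_power summable_geometric\<close>)

text \<open>A multiset over \<open>insert a R\<close> is a multiplicity of \<open>a\<close> together with a multiset over \<open>R\<close>. This reduces the
  product formula to a geometric series for one element at a time.\<close>

lemma has_sum_multisets_over_insert:
  assumes "a \<notin> R"
  shows "(h has_sum s) (multisets_over (insert a R)) \<longleftrightarrow>
    ((\<lambda>(n, M). h (M + replicate_mset n a)) has_sum s) (UNIV \<times> multisets_over R)"
proof (rule sym, rule has_sum_reindex_bij_witness[where
      i = "\<lambda>M. (count M a, filter_mset (\<lambda>x. x \<noteq> a) M)" and j = "\<lambda>(n, M). M + replicate_mset n a"])
  fix p assume "p \<in> (UNIV :: nat set) \<times> multisets_over R"
  then obtain n M where p: "p = (n, M)" "set_mset M \<subseteq> R" by (auto simp: multisets_over_def)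
  have "a \<notin># M" using p assms by auto
  hence "count M a = 0" by (simp add: not_in_iff)
  moreover have "filter_mset (\<lambda>x. x \<noteq> a) M = M"
    using \<open>a \<notin># M\<close> by (auto simp: filter_mset_eq_conv)
  ultimately show "(count ((\<lambda>(n, M). M + replicate_mset n a) p) a,
      filter_mset (\<lambda>x. x \<noteq> a) ((\<lambda>(n, M). M + replicate_mset n a) p)) = p"
    by (simp add: p(1))
next
  fix M assume "M \<in> multisets_over (insert a R)"
  thus "(case (count M a, filter_mset (\<lambda>x. x \<noteq> a) M) of (n, M) \<Rightarrow> M + replicate_mset n a) = M"
    by (auto intro!: multiset_eqI)
qed (auto simp: multisets_over_def split: if_splits)

lemma has_sum_multisets_over_finite:
  fixes x :: "'a \<Rightarrow> 'b::{real_normed_field, banach}"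
  assumes "finite R" "\<And>i. i \<in> R \<Longrightarrow> norm (x i) < 1"
  shows "((\<lambda>M. \<Prod>i\<in>#M. x i) has_sum (\<Prod>i\<in>R. 1 / (1 - x i))) (multisets_over R)"
    and "(\<lambda>M. norm (\<Prod>i\<in>#M. x i)) summable_on multisets_over R"
proof -
  have "((\<lambda>M. \<Prod>i\<in>#M. x i) has_sum (\<Prod>i\<in>R. 1 / (1 - x i))) (multisets_over R) \<and>
      (\<lambda>M. norm (\<Prod>i\<in>#M. x i)) summable_on multisets_over R"
    using assms
  proof (induction R rule: finite_induct)
    case empty
    have "multisets_over {} = {{#} :: 'a multiset}" by (auto simp: multisets_over_def)
    then show ?case by (simp add: has_sum_finite_iff)
  next
    case (insert a R)
    have xa: "norm (x a) < 1" using insert.prems by simp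
    have IH: "((\<lambda>M. \<Prod>i\<in>#M. x i) has_sum (\<Prod>i\<in>R. 1 / (1 - x i))) (multisets_over R)"
      "(\<lambda>M. norm (\<Prod>i\<in>#M. x i)) summable_on multisets_over R"
      using insert.IH insert.prems by auto
    have geo: "(\<lambda>n. norm (x a ^ n)) summable_on UNIV"
      using has_sum_imp_summable[OF has_sum_geometric[of "norm (x a)"]] xa by (simp add: norm_power)
    note total = has_sum_product[OF has_sum_geometric[OF xa] geo IH]
    note norms = summable_on_product_nonneg[OF geo IH(2)]
    have "((\<lambda>M. \<Prod>i\<in>#M. x i) has_sum (\<Prod>i\<in>insert a R. 1 / (1 - x i))) (multisets_over (insert a R))"
      using total insert.hyps by (simp add: has_sum_multisets_over_insert mult.commute)
    moreover have "(\<lambda>M. norm (\<Prod>i\<in>#M. x i)) summable_on multisets_over (insert a R)"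
      using norms insert.hyps
      by (simp add: summable_on_def has_sum_multisets_over_insert norm_mult mult.commute)
    ultimately show ?case by blast
  qed
  thus "((\<lambda>M. \<Prod>i\<in>#M. x i) has_sum (\<Prod>i\<in>R. 1 / (1 - x i))) (multisets_over R)"
    "(\<lambda>M. norm (\<Prod>i\<in>#M. x i)) summable_on multisets_over R" by auto
qed

text \<open>Finitely many multisets involve finitely many elements, so partial sums are bounded by a finite
  product, which is at most \<open>exp (\<Sum> |x\<^sub>i| / (1 - r))\<close> because \<open>1 / (1 - u) \<le> exp (u / (1 - r))\<close> for
  \<open>0 \<le> u \<le> r\<close>.\<close>

lemma multisets_over_abs_summable:
  fixes x :: "'a \<Rightarrow> 'b::real_normed_field"
  assumes sum: "(\<lambda>i. norm (x i)) summable_on R" and r: "r < 1" "\<And>i. i \<in> R \<Longrightarrow> norm (x i) \<le> r"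
  shows "(\<lambda>M. \<Prod>i\<in>#M. x i) abs_summable_on multisets_over R"
proof (rule nonneg_bdd_above_summable_on)
  show "norm (\<Prod>i\<in>#M. x i) \<ge> 0" for M by simp
  show "bdd_above (sum (\<lambda>M. norm (\<Prod>i\<in>#M. x i)) ` {F. F \<subseteq> multisets_over R \<and> finite F})"
  proof (rule bdd_aboveI2)
    fix F assume "F \<in> {F. F \<subseteq> multisets_over R \<and> finite F}"
    hence F: "F \<subseteq> multisets_over R" "finite F" by auto
    define R' where "R' = (\<Union>M\<in>F. set_mset M)"
    have R': "finite R'" "R' \<subseteq> R" "F \<subseteq> multisets_over R'"
      using F by (auto simp: R'_def multisets_over_def)
    have nx: "0 \<le> norm (x i) \<and> norm (x i) < 1" if "i \<in> R'" for i
      using r(2)[of i] r(1) R' that by fastforce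
    have "(\<Sum>M\<in>F. norm (\<Prod>i\<in>#M. x i)) \<le> (\<Prod>i\<in>R'. 1 / (1 - norm (x i)))"
      unfolding norm_prod_mset_image
    proof (rule has_sum_mono2[OF _ has_sum_multisets_over_finite(1)[OF R'(1)] R'(3)])
      show "((\<lambda>M. \<Prod>i\<in>#M. norm (x i)) has_sum (\<Sum>M\<in>F. \<Prod>i\<in>#M. norm (x i))) F"
        using F(2) by (simp add: has_sum_finite_iff)
      show "0 \<le> (\<Prod>i\<in>#M. norm (x i))" for M by (metis norm_ge_zero norm_prod_mset_image)
    qed (use nx in auto)
    also have "\<dots> \<le> (\<Prod>i\<in>R'. exp (norm (x i) / (1 - r)))"
    proof (rule prod_mono, rule conjI)
      fix i assume i: "i \<in> R'"
      have le: "norm (x i) \<le> r" using i R' r(2) by blast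
      have "1 / (1 - norm (x i)) = 1 + norm (x i) / (1 - norm (x i))" using nx[OF i] by (simp add: field_simps)
      also have "\<dots> \<le> 1 + norm (x i) / (1 - r)" using nx[OF i] le r(1) by (intro add_left_mono divide_left_mono) auto
      also have "\<dots> \<le> exp (norm (x i) / (1 - r))" by (rule exp_ge_add_one_self)
      finally show "1 / (1 - norm (x i)) \<le> exp (norm (x i) / (1 - r))" .
    qed (use nx in force)
    also have "\<dots> = exp ((\<Sum>i\<in>R'. norm (x i)) / (1 - r))"
      using R'(1) by (simp add: exp_sum sum_divide_distrib)
    also have "\<dots> \<le> exp ((\<Sum>\<^sub>\<infinity>i\<in>R. norm (x i)) / (1 - r))"
      using r(1) finite_sum_le_infsum[OF sum R'(1,2)] by (simp add: divide_right_mono)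
    finally show "(\<Sum>M\<in>F. norm (\<Prod>i\<in>#M. x i)) \<le> exp ((\<Sum>\<^sub>\<infinity>i\<in>R. norm (x i)) / (1 - r))" .
  qed
qed

lemma infsum_exhaustion_tendsto:
  fixes f :: "'a \<Rightarrow> 'b::{real_normed_vector, banach}"
  assumes f: "f summable_on A" and A: "A = (\<Union>n. D n)" and mono: "incseq D"
  shows "(\<lambda>n. infsum f (D n)) \<longlonglongrightarrow> infsum f A"
proof (rule LIMSEQ_I)
  fix e :: real assume e: "e > 0"
  have "eventually (\<lambda>F. dist (sum f F) (infsum f A) < e / 2) (finite_subsets_at_top A)"
    by (rule tendstoD) (use has_sum_infsum[OF f] e in \<open>simp_all add: has_sum_def\<close>)
  then have "\<exists>F. finite F \<and> F \<subseteq> A \<and>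
      (\<forall>G. finite G \<and> F \<subseteq> G \<and> G \<subseteq> A \<longrightarrow> dist (sum f G) (infsum f A) < e / 2)"
    by (simp only: eventually_finite_subsets_at_top)
  then obtain F where F: "finite F" "F \<subseteq> A"
    "\<forall>G. finite G \<and> F \<subseteq> G \<and> G \<subseteq> A \<longrightarrow> dist (sum f G) (infsum f A) < e / 2"
    by (elim exE conjE)
  have "\<exists>N. F \<subseteq> D N" using F(1,2) unfolding A
  proof (induction F rule: finite_induct)
    case (insert a F)
    then obtain N where N: "F \<subseteq> D N" by auto
    obtain n where n: "a \<in> D n" using insert by auto
    have "D N \<subseteq> D (max n N)" "D n \<subseteq> D (max n N)" using mono by (auto simp: incseq_def)
    thus ?case using N n by blast
  qed simp
  then obtain N where N: "F \<subseteq> D N" by blast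
  show "\<exists>N. \<forall>n\<ge>N. norm (infsum f (D n) - infsum f A) < e"
  proof (intro exI allI impI)
    fix n assume n: "n \<ge> N"
    have sub: "F \<subseteq> D n" "D n \<subseteq> A" using N mono n by (auto simp: incseq_def A)
    have "f summable_on D n" using f sub(2) by (rule summable_on_subset_banach)
    hence "(sum f \<longlongrightarrow> infsum f (D n)) (finite_subsets_at_top (D n))"
      using has_sum_infsum has_sum_def by blast
    hence "((\<lambda>G. dist (sum f G) (infsum f A)) \<longlongrightarrow> dist (infsum f (D n)) (infsum f A))
        (finite_subsets_at_top (D n))"
      by (intro tendsto_dist tendsto_const)
    moreover have "eventually (\<lambda>G. dist (sum f G) (infsum f A) \<le> e / 2) (finite_subsets_at_top (D n))"
      unfolding eventually_finite_subsets_at_top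
    proof (intro exI[of _ F] conjI allI impI)
      fix G assume "finite G \<and> F \<subseteq> G \<and> G \<subseteq> D n"
      hence "finite G \<and> F \<subseteq> G \<and> G \<subseteq> A" using sub(2) by auto
      thus "dist (sum f G) (infsum f A) \<le> e / 2" using F(3) less_imp_le by blast
    qed (use F sub in auto)
    ultimately have "dist (infsum f (D n)) (infsum f A) \<le> e / 2"
      by (intro tendsto_upperbound) auto
    thus "norm (infsum f (D n) - infsum f A) < e" using e by (simp add: dist_norm)
  qed
qed

text \<open>Euler's expansion of \<open>\<Prod> 1 / (1 - x\<^sub>i)\<close> over an infinite index set, stated for an arbitrary
  exhaustion by finite sets because the positive roots come in three interleaved families.\<close>

lemma prod_tendsto_infsum_multisets:
  fixes x :: "'a \<Rightarrow> 'b::{real_normed_field, banach}"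
  assumes sum: "(\<lambda>i. norm (x i)) summable_on R" and r: "r < 1" "\<And>i. i \<in> R \<Longrightarrow> norm (x i) \<le> r"
    and D: "R = (\<Union>n. D n)" "incseq D" "\<And>n. finite (D n)"
  shows "(\<lambda>n. \<Prod>i\<in>D n. 1 / (1 - x i)) \<longlonglongrightarrow> (\<Sum>\<^sub>\<infinity>M\<in>multisets_over R. \<Prod>i\<in>#M. x i)"
proof -
  have "(\<lambda>n. infsum (\<lambda>M. \<Prod>i\<in>#M. x i) (multisets_over (D n))) \<longlonglongrightarrow>
      (\<Sum>\<^sub>\<infinity>M\<in>multisets_over R. \<Prod>i\<in>#M. x i)"
  proof (rule infsum_exhaustion_tendsto)
    show "(\<lambda>M. \<Prod>i\<in>#M. x i) summable_on multisets_over R"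
      by (rule abs_summable_summable, rule multisets_over_abs_summable[OF sum r])
    show "incseq (\<lambda>n. multisets_over (D n))"
      using D(2) by (fastforce simp: incseq_def multisets_over_def)
    show "multisets_over R = (\<Union>n. multisets_over (D n))"
    proof (intro equalityI subsetI)
      fix M assume "M \<in> multisets_over R"
      hence "set_mset M \<subseteq> (\<Union>n. D n)" using D(1) by (simp add: multisets_over_def)
      with finite_set_mset[of M] have "\<exists>n. set_mset M \<subseteq> D n"
      proof (induction "set_mset M" arbitrary: M rule: finite_induct)
        case empty
        then show ?case by auto
      next
        case (insert a F)
        have "set_mset (filter_mset (\<lambda>x. x \<noteq> a) M) = F" using insert.hyps by auto
        then obtain N where N: "F \<subseteq> D N"
          using insert.hyps(3)[of "filter_mset (\<lambda>x. x \<noteq> a) M"] insert.prems by auto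
        obtain n where n: "a \<in> D n" using insert.hyps insert.prems by blast
        have "D N \<subseteq> D (max n N)" "D n \<subseteq> D (max n N)" using D(2) by (auto simp: incseq_def)
        hence "insert a F \<subseteq> D (max n N)" using N n by blast
        thus ?case using insert.hyps(4) by metis
      qed
      thus "M \<in> (\<Union>n. multisets_over (D n))" by (auto simp: multisets_over_def)
    qed (auto simp: multisets_over_def D(1))
  qed
  moreover have "infsum (\<lambda>M. \<Prod>i\<in>#M. x i) (multisets_over (D n)) = (\<Prod>i\<in>D n. 1 / (1 - x i))" for n
    by (intro infsumI has_sum_multisets_over_finite(1) D(3)) (use r D(1) in fastforce)
  ultimately show ?thesis by simp
qed

text \<open>Used below to collect a sum over multisets of roots by one coordinate of their total.\<close>

lemma has_sum_fibres:
  fixes f :: "'a \<Rightarrow> 'b::banach"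
  assumes "(f has_sum S) A"
  shows "((\<lambda>k. \<Sum>\<^sub>\<infinity>x\<in>{x\<in>A. key x = k}. f x) has_sum S) UNIV"
proof -
  have "((\<lambda>(k, x). f x) has_sum S) (Sigma UNIV (\<lambda>k. {x\<in>A. key x = k})) \<longleftrightarrow> (f has_sum S) A"
    by (rule has_sum_reindex_bij_witness[where i = "\<lambda>x. (key x, x)" and j = snd]) auto
  hence s: "((\<lambda>(k, x). f x) has_sum S) (Sigma UNIV (\<lambda>k. {x\<in>A. key x = k}))" using assms by simp
  show ?thesis
  proof (rule has_sum_SigmaD[OF s])
    fix k
    have "f summable_on {x\<in>A. key x = k}"
      by (rule summable_on_subset_banach[OF has_sum_imp_summable[OF assms]]) auto
    thus "((\<lambda>x. case (k, x) of (k, x) \<Rightarrow> f x) has_sum (\<Sum>\<^sub>\<infinity>x\<in>{x\<in>A. key x = k}. f x)) {x\<in>A. key x = k}"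
      by simp
  qed
qed

section \<open>Positive roots and Kostant partitions\<close>

text \<open>The integer coordinates of a root with respect to \<open>\<alpha>\<^sub>1\<close> and \<open>\<delta>\<close>. Rounding moves a complex coordinate
  into the integers and is exact on the roots; the second coordinate of a positive root is nonnegative.\<close>

definition root_ht1 :: "weight \<Rightarrow> int" where "root_ht1 u = \<lfloor>Re (u $ 1)\<rfloor>"
definition root_ht2 :: "weight \<Rightarrow> nat" where "root_ht2 u = nat \<lfloor>Re (u $ 2)\<rfloor>"

definition ht1 :: "weight multiset \<Rightarrow> int" where "ht1 M = (\<Sum>u\<in>#M. root_ht1 u)"
definition ht2 :: "weight multiset \<Rightarrow> nat" where "ht2 M = (\<Sum>u\<in>#M. root_ht2 u)"

definition up_root :: "nat \<Rightarrow> weight" where "up_root n = alpha1 + of_nat n *s null_root"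
definition down_root :: "nat \<Rightarrow> weight" where "down_root n = - alpha1 + of_nat (Suc n) *s null_root"
definition imag_root :: "nat \<Rightarrow> weight" where "imag_root n = of_nat (Suc n) *s null_root"

lemmas root_family_defs = up_root_def down_root_def imag_root_def

lemma positive_roots_eq: "positive_roots = range up_root \<union> range down_root \<union> range imag_root"
proof -
  have "{h n | n::nat. n \<ge> 1} = range (\<lambda>n. h (Suc n))" for h :: "nat \<Rightarrow> weight"
    by (auto simp: image_iff) (metis Suc_le_D One_nat_def)
  thus ?thesis unfolding positive_roots_def root_family_defs by simp
qed

lemma root_ht_simps [simp]:
  "root_ht1 (up_root n) = 1" "root_ht1 (down_root n) = -1" "root_ht1 (imag_root n) = 0"
  "root_ht2 (up_root n) = n" "root_ht2 (down_root n) = Suc n" "root_ht2 (imag_root n) = Suc n"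
  by (simp_all add: root_ht1_def root_ht2_def root_family_defs floor_eq_iff del: of_nat_Suc)

lemma inj_root_families: "inj up_root" "inj down_root" "inj imag_root"
  by (rule injI, metis root_ht_simps Suc_inject)+

lemma positive_root_coords:
  assumes "u \<in> positive_roots"
  shows "u = of_int (root_ht1 u) *s alpha1 + of_nat (root_ht2 u) *s null_root"
  using assms unfolding positive_roots_eq
  by (elim UnE imageE) (simp_all only: root_ht_simps, simp_all add: root_family_defs weight_eq_iff)

lemma sum_mset_positive_roots:
  assumes "M \<in> multisets_over positive_roots"
  shows "\<Sum>\<^sub># M = of_int (ht1 M) *s alpha1 + of_nat (ht2 M) *s null_root"
  using assms
proof (induction M)
  case empty
  then show ?case by (simp add: ht1_def ht2_def)
next
  case (add u M)
  have u: "u \<in> positive_roots" "M \<in> multisets_over positive_roots" using add.prems by (auto simp: multisets_over_def)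
  have "\<Sum>\<^sub># (add_mset u M) = u + \<Sum>\<^sub># M" by simp
  also have "\<dots> = (of_int (root_ht1 u) *s alpha1 + of_nat (root_ht2 u) *s null_root) +
      (of_int (ht1 M) *s alpha1 + of_nat (ht2 M) *s null_root)"
    using add.IH[OF u(2)] positive_root_coords[OF u(1)] by simp
  finally show ?case by (simp add: ht1_def ht2_def weight_eq_iff)
qed

lemma kostant_partitions_eq:
  "kostant_partitions (of_int a *s alpha1 + of_int k *s null_root) =
    {M \<in> multisets_over positive_roots. ht1 M = a \<and> int (ht2 M) = k}"
proof -
  have "of_int (ht1 M) *s alpha1 + of_nat (ht2 M) *s null_root = of_int a *s alpha1 + of_int k *s null_root
      \<longleftrightarrow> ht1 M = a \<and> int (ht2 M) = k" for M
  proof -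
    have "of_nat (ht2 M) = (of_int k :: complex) \<longleftrightarrow> int (ht2 M) = k"
      by (metis of_int_eq_iff of_int_of_nat_eq)
    thus ?thesis by (simp add: weight_eq_iff)
  qed
  thus ?thesis using sum_mset_positive_roots
    by (auto simp: kostant_partitions_def multisets_over_def)
qed

text \<open>The diagram automorphism exchanging \<open>\<alpha>\<^sub>0\<close> and \<open>\<alpha>\<^sub>1\<close> and fixing \<open>\<delta>\<close>. It permutes the positive
  roots.\<close>

definition swap_roots :: "weight \<Rightarrow> weight" where
  "swap_roots u = (- u $ 1) *s alpha1 + (u $ 1 + u $ 2) *s null_root + u $ 3 *s Lambda0"

lemma swap_roots_simps [simp]:
  "swap_roots (up_root n) = down_root n" "swap_roots (down_root n) = up_root n"
  "swap_roots (imag_root n) = imag_root n" "swap_roots (swap_roots u) = u"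
  by (simp_all add: swap_roots_def root_family_defs weight_eq_iff)

lemma swap_roots_positive:
  assumes "u \<in> positive_roots"
  shows "swap_roots u \<in> positive_roots" "root_ht1 (swap_roots u) = - root_ht1 u"
    "int (root_ht2 (swap_roots u)) = int (root_ht2 u) + root_ht1 u"
  using assms by (auto simp: positive_roots_eq)

lemma ht_swap_roots:
  assumes "M \<in> multisets_over positive_roots"
  shows "image_mset swap_roots M \<in> multisets_over positive_roots"
    "ht1 (image_mset swap_roots M) = - ht1 M"
    "int (ht2 (image_mset swap_roots M)) = int (ht2 M) + ht1 M"
proof -
  show "image_mset swap_roots M \<in> multisets_over positive_roots"
    using assms swap_roots_positive(1) by (auto simp: multisets_over_def)
  have "ht1 (image_mset swap_roots M) = - ht1 M \<and>
      int (ht2 (image_mset swap_roots M)) = int (ht2 M) + ht1 M"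
    using assms
  proof (induction M)
    case (add u M)
    then show ?case using swap_roots_positive[of u] by (auto simp: ht1_def ht2_def multisets_over_def)
  qed (simp add: ht1_def ht2_def)
  thus "ht1 (image_mset swap_roots M) = - ht1 M"
    "int (ht2 (image_mset swap_roots M)) = int (ht2 M) + ht1 M" by auto
qed

lemma reflect_roots_simps [simp]:
  "reflection 1 (up_root (Suc n)) = down_root n" "reflection 1 (down_root n) = up_root (Suc n)"
  "reflection 1 (imag_root n) = imag_root n" "reflection 1 (reflection 1 u) = u"
  by (simp_all add: reflection_def bform_def root_family_defs weight_eq_iff)

text \<open>The reflection \<open>r\<^sub>1\<close> permutes the positive roots other than \<open>\<alpha>\<^sub>1\<close>, as this list and
  \<open>reflect_roots_simps\<close> show.\<close>

lemma positive_roots_minus_alpha1: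
  "positive_roots - {alpha1} = range (\<lambda>n. up_root (Suc n)) \<union> range down_root \<union> range imag_root"
proof -
  have a: "alpha1 = up_root 0" by (simp add: up_root_def)
  have "range up_root = insert alpha1 (range (\<lambda>n. up_root (Suc n)))"
    unfolding a by (metis image_insert image_image UNIV_nat_eq)
  moreover have "alpha1 \<notin> range (\<lambda>n. up_root (Suc n)) \<union> range down_root \<union> range imag_root"
    unfolding a by (auto simp: inj_eq[OF inj_root_families(1)] dest: arg_cong[of _ _ root_ht1])
  ultimately show ?thesis unfolding positive_roots_eq by blast
qed

lemma ht_reflection:
  assumes "M \<in> multisets_over (positive_roots - {alpha1})"
  shows "image_mset (reflection 1) M \<in> multisets_over (positive_roots - {alpha1})"
    "ht1 (image_mset (reflection 1) M) = - ht1 M"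
    "ht2 (image_mset (reflection 1) M) = ht2 M"
proof -
  have r: "reflection 1 u \<in> positive_roots - {alpha1} \<and> root_ht1 (reflection 1 u) = - root_ht1 u \<and>
      root_ht2 (reflection 1 u) = root_ht2 u" if "u \<in> positive_roots - {alpha1}" for u
    using that unfolding positive_roots_minus_alpha1 by auto
  show "image_mset (reflection 1) M \<in> multisets_over (positive_roots - {alpha1})"
  proof -
    have "reflection 1 ` set_mset M \<subseteq> positive_roots - {alpha1}"
    proof (rule image_subsetI)
      fix u assume "u \<in> set_mset M"
      hence "u \<in> positive_roots - {alpha1}" using assms by (auto simp: multisets_over_def)
      thus "reflection 1 u \<in> positive_roots - {alpha1}" using r by blast
    qed
    thus ?thesis by (simp add: multisets_over_def)
  qed
  have "ht1 (image_mset (reflection 1) M) = - ht1 M \<and> ht2 (image_mset (reflection 1) M) = ht2 M"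
    using assms
  proof (induction M)
    case (add u M)
    then show ?case using r[of u] by (auto simp: ht1_def ht2_def multisets_over_def)
  qed (simp add: ht1_def ht2_def)
  thus "ht1 (image_mset (reflection 1) M) = - ht1 M" "ht2 (image_mset (reflection 1) M) = ht2 M" by auto
qed

text \<open>In the basis of simple roots \<open>a \<alpha>\<^sub>1 + k \<delta> = k \<alpha>\<^sub>0 + (a + k) \<alpha>\<^sub>1\<close>, and sums of positive roots have
  nonnegative coefficients.\<close>

lemma kostant_eq_0:
  assumes "k < 0 \<or> a + k < 0"
  shows "kostant (of_int a *s alpha1 + of_int k *s null_root) t = 0"
proof -
  have "int (ht2 M) \<ge> 0 \<and> int (ht2 M) + ht1 M \<ge> 0" if "M \<in> multisets_over positive_roots" for M
    using ht_swap_roots(3)[OF that] by simp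
  hence "kostant_partitions (of_int a *s alpha1 + of_int k *s null_root) = {}"
    using assms by (fastforce simp: kostant_partitions_eq)
  thus ?thesis by (simp add: kostant_def)
qed

section \<open>The coefficients of the product over the positive roots\<close>

locale nome =
  fixes t q :: complex
  assumes t_pos: "0 < norm t" and t_less: "norm t < 1" and q_pos: "0 < norm q" and q_less: "norm q < 1"
begin

definition partition_weight :: "weight multiset \<Rightarrow> complex" where
  "partition_weight M = t ^ size M * q ^ ht2 M"

definition string_coeff :: "int \<Rightarrow> complex" where
  "string_coeff a = (\<Sum>\<^sub>\<infinity>M\<in>{M \<in> multisets_over positive_roots. ht1 M = a}. partition_weight M)"

text \<open>The value of \<open>t e(- \<alpha>)\<close> after the substitution \<open>e(- \<alpha>\<^sub>1) = z\<close>, \<open>e(- \<delta>) = q\<close>.\<close>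

definition root_weight :: "complex \<Rightarrow> weight \<Rightarrow> complex" where
  "root_weight z u = t * z powi root_ht1 u * q ^ root_ht2 u"

lemma root_weight_simps [simp]:
  "root_weight z (up_root n) = t * z * q ^ n"
  "root_weight z (down_root n) = t * inverse z * q ^ Suc n"
  "root_weight z (imag_root n) = t * q ^ Suc n"
  by (simp_all add: root_weight_def power_int_minus)

lemma prod_root_weight:
  assumes "z \<noteq> 0"
  shows "(\<Prod>u\<in>#M. root_weight z u) = partition_weight M * z powi ht1 M"
  by (induction M)
     (simp_all add: partition_weight_def ht1_def ht2_def root_weight_def power_int_add assms power_add)

lemma summable_root_weight: "(\<lambda>u. norm (root_weight z u)) summable_on positive_roots"
proof -
  have geo: "(\<lambda>n. norm (c * q ^ n)) summable_on UNIV" for c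
  proof (rule norm_summable_imp_summable_on)
    show "summable (\<lambda>n. norm (norm (c * q ^ n)))"
      using q_less by (simp add: norm_mult norm_power summable_mult summable_geometric)
  qed
  have "(\<lambda>u. norm (root_weight z u)) summable_on range up_root"
    using geo[of "t * z"] by (simp add: summable_on_reindex[OF inj_root_families(1)] o_def)
  moreover have "(\<lambda>u. norm (root_weight z u)) summable_on range down_root"
    using geo[of "t * inverse z * q"] by (simp add: summable_on_reindex[OF inj_root_families(2)] o_def mult.assoc)
  moreover have "(\<lambda>u. norm (root_weight z u)) summable_on range imag_root"
    using geo[of "t * q"] by (simp add: summable_on_reindex[OF inj_root_families(3)] o_def mult.assoc)
  ultimately show ?thesis unfolding positive_roots_eq by (intro summable_on_union)
qed

lemma root_weight_bound:
  assumes z: "z \<noteq> 0" "norm t * norm z < 1" "norm t * norm q < norm z"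
  obtains r where "r < 1" "\<And>u. u \<in> positive_roots \<Longrightarrow> norm (root_weight z u) \<le> r"
proof
  let ?r = "max (norm t * norm z) (max (norm t * norm q / norm z) (norm t * norm q))"
  have "norm t * norm q < 1 * 1" by (rule mult_strict_mono) (use t_less q_less in auto)
  thus "?r < 1" using z by (simp add: divide_less_eq)
  have qn: "norm q ^ n \<le> 1" for n using q_less by (intro power_le_one) auto
  show "norm (root_weight z u) \<le> ?r" if "u \<in> positive_roots" for u
    using that unfolding positive_roots_eq
  proof (elim UnE imageE)
    fix n assume "u = up_root n"
    hence "norm (root_weight z u) = (norm t * norm z) * norm q ^ n" by (simp add: norm_mult norm_power)
    also have "\<dots> \<le> norm t * norm z" by (intro mult_right_le_one_le) (use qn in auto)
    finally show ?thesis by simp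
  next
    fix n assume "u = down_root n"
    hence "norm (root_weight z u) = (norm t * norm q / norm z) * norm q ^ n"
      by (simp add: norm_mult norm_power norm_inverse norm_divide field_simps)
    also have "\<dots> \<le> norm t * norm q / norm z" by (intro mult_right_le_one_le) (use qn in auto)
    finally show ?thesis by simp
  next
    fix n assume "u = imag_root n"
    hence "norm (root_weight z u) = (norm t * norm q) * norm q ^ n" by (simp add: norm_mult norm_power)
    also have "\<dots> \<le> norm t * norm q" by (intro mult_right_le_one_le) (use qn in auto)
    finally show ?thesis by simp
  qed
qed

lemma abs_summable_partitions:
  assumes z: "z \<noteq> 0" "norm t * norm z < 1" "norm t * norm q < norm z"
  shows "(\<lambda>M. norm (partition_weight M * z powi ht1 M)) summable_on multisets_over positive_roots"
proof -
  obtain r where r: "r < 1" "\<And>u. u \<in> positive_roots \<Longrightarrow> norm (root_weight z u) \<le> r"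
    using root_weight_bound[OF z] by blast
  show ?thesis
    using multisets_over_abs_summable[OF summable_root_weight r] unfolding prod_root_weight[OF z(1)] .
qed

lemma abs_summable_partition_weight: "(\<lambda>M. norm (partition_weight M)) summable_on multisets_over positive_roots"
proof -
  have "norm t * norm q < 1 * 1" by (rule mult_strict_mono) (use t_less q_less in auto)
  thus ?thesis using abs_summable_partitions[of 1] t_less by simp
qed

definition coeff_bound :: real where
  "coeff_bound = (\<Sum>\<^sub>\<infinity>M\<in>multisets_over positive_roots. norm (partition_weight M))"

lemma norm_string_coeff_le: "norm (string_coeff a) \<le> coeff_bound"
proof -
  let ?A = "{M \<in> multisets_over positive_roots. ht1 M = a}"
  have s: "(\<lambda>M. norm (partition_weight M)) summable_on ?A"
    by (rule summable_on_subset_banach[OF abs_summable_partition_weight]) auto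
  have "norm (string_coeff a) \<le> (\<Sum>\<^sub>\<infinity>M\<in>?A. norm (partition_weight M))"
    unfolding string_coeff_def by (rule norm_infsum_bound[OF s])
  also have "\<dots> \<le> coeff_bound" unfolding coeff_bound_def
    by (rule infsum_mono2[OF s abs_summable_partition_weight]) auto
  finally show ?thesis .
qed

text \<open>Kostant partitions of \<open>a \<alpha>\<^sub>1 + k \<delta>\<close> for varying \<open>k\<close> are the fibres of the multisets of total first
  coordinate \<open>a\<close>. The bound, uniform in \<open>a\<close>, justifies the exchange of sums in the string function.\<close>

lemma kostant_generating_function:
  defines "K \<equiv> \<lambda>a k. kostant (of_int a *s alpha1 + of_int k *s null_root) t"
  shows "((\<lambda>k. K a k * q powi k) has_sum string_coeff a) UNIV"
    and "(\<lambda>k. norm (K a k * q powi k)) summable_on UNIV"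
    and "(\<Sum>\<^sub>\<infinity>k. norm (K a k * q powi k)) \<le> coeff_bound"
proof -
  let ?A = "{M \<in> multisets_over positive_roots. ht1 M = a}"
  have fib: "{M \<in> ?A. int (ht2 M) = k} = kostant_partitions (of_int a *s alpha1 + of_int k *s null_root)" for k
    by (auto simp: kostant_partitions_eq)
  have s: "(\<lambda>M. norm (partition_weight M)) summable_on ?A"
    by (rule summable_on_subset_banach[OF abs_summable_partition_weight]) auto
  have fibre: "(\<Sum>\<^sub>\<infinity>M\<in>{M\<in>?A. int (ht2 M) = k}. partition_weight M) = K a k * q powi k" for k
    unfolding fib K_def kostant_def
    by (simp add: finite_kostant_partitions sum_distrib_right)
       (rule sum.cong, auto simp: kostant_partitions_eq partition_weight_def)
  have "((\<lambda>k. \<Sum>\<^sub>\<infinity>M\<in>{M\<in>?A. int (ht2 M) = k}. partition_weight M) has_sum string_coeff a) UNIV"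
    by (rule has_sum_fibres) (use abs_summable_summable[OF s] in \<open>auto simp: string_coeff_def\<close>)
  thus "((\<lambda>k. K a k * q powi k) has_sum string_coeff a) UNIV" unfolding fibre .
  have h: "((\<lambda>k. \<Sum>\<^sub>\<infinity>M\<in>{M\<in>?A. int (ht2 M) = k}. norm (partition_weight M)) has_sum
      (\<Sum>\<^sub>\<infinity>M\<in>?A. norm (partition_weight M))) UNIV"
    by (rule has_sum_fibres) (use s in auto)
  have le: "norm (K a k * q powi k) \<le> (\<Sum>\<^sub>\<infinity>M\<in>{M\<in>?A. int (ht2 M) = k}. norm (partition_weight M))" for k
    unfolding fibre[symmetric] fib by (simp add: finite_kostant_partitions norm_sum)
  show sum: "(\<lambda>k. norm (K a k * q powi k)) summable_on UNIV"
    by (rule Infinite_Sum.abs_summable_on_comparison_test'[OF has_sum_imp_summable[OF h]]) (rule le)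
  have "(\<Sum>\<^sub>\<infinity>k. norm (K a k * q powi k)) \<le> (\<Sum>\<^sub>\<infinity>M\<in>?A. norm (partition_weight M))"
    by (rule has_sum_mono[OF has_sum_infsum[OF sum] h le])
  also have "\<dots> \<le> coeff_bound" unfolding coeff_bound_def
    by (rule infsum_mono2[OF s abs_summable_partition_weight]) auto
  finally show "(\<Sum>\<^sub>\<infinity>k. norm (K a k * q powi k)) \<le> coeff_bound" .
qed

lemma q_nonzero [simp]: "q \<noteq> 0" and t_nonzero [simp]: "t \<noteq> 0"
  using q_pos t_pos by auto

text \<open>The diagram automorphism maps \<open>a \<alpha>\<^sub>1 + k \<delta>\<close> to \<open>- a \<alpha>\<^sub>1 + (a + k) \<delta>\<close>; in terms of \<open>\<Psi>\<close>
  this is \<open>\<Psi>(1 / z) = \<Psi>(q z)\<close>.\<close>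

lemma string_coeff_minus: "string_coeff (- a) = q powi a * string_coeff a"
proof -
  have inv: "image_mset swap_roots (image_mset swap_roots M) = M" for M
    by (simp add: multiset.map_comp o_def)
  have "string_coeff (- a) = (\<Sum>\<^sub>\<infinity>M\<in>{M \<in> multisets_over positive_roots. ht1 M = a}. q powi a * partition_weight M)"
    unfolding string_coeff_def
  proof (rule infsum_reindex_bij_witness[where i = "image_mset swap_roots" and j = "image_mset swap_roots"])
    fix M assume "M \<in> {M \<in> multisets_over positive_roots. ht1 M = - a}"
    hence M: "M \<in> multisets_over positive_roots" "ht1 M = - a" by auto
    have "int (ht2 M) = a + int (ht2 (image_mset swap_roots M))" using ht_swap_roots(3)[OF M(1)] M(2) by simp
    hence "q powi (int (ht2 M)) = q powi a * q powi (int (ht2 (image_mset swap_roots M)))"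
      by (simp add: power_int_add del: power_int_of_nat)
    thus "q powi a * partition_weight (image_mset swap_roots M) = partition_weight M"
      by (simp add: partition_weight_def)
  qed (use inv ht_swap_roots in auto)
  thus ?thesis by (simp add: string_coeff_def infsum_cmult_right')
qed

text \<open>The coefficients of \<open>(1 - t z) \<Psi>(z)\<close>, the product with the root \<open>\<alpha>\<^sub>1\<close> left out.\<close>

definition reduced_coeff :: "int \<Rightarrow> complex" where
  "reduced_coeff a =
    (\<Sum>\<^sub>\<infinity>M\<in>{M \<in> multisets_over (positive_roots - {alpha1}). ht1 M = a}. partition_weight M)"

lemma reduced_coeff_minus: "reduced_coeff (- a) = reduced_coeff a"
  unfolding reduced_coeff_def
proof (rule infsum_reindex_bij_witness[where i = "image_mset (reflection 1)" and j = "image_mset (reflection 1)"])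
  show "image_mset (reflection 1) (image_mset (reflection 1) M) = M" for M
    by (simp add: multiset.map_comp o_def)
  thus "image_mset (reflection 1) (image_mset (reflection 1) M) = M" for M .
qed (use ht_reflection in \<open>auto simp: partition_weight_def\<close>)

lemma string_coeff_remove_alpha1: "string_coeff a = reduced_coeff a + t * string_coeff (a - 1)"
proof -
  have a0: "alpha1 = up_root 0" by (simp add: up_root_def)
  let ?P = "multisets_over positive_roots" and ?D = "multisets_over (positive_roots - {alpha1})"
  let ?A = "{M \<in> ?D. ht1 M = a}" and ?B = "{M \<in> ?P. ht1 M = a - 1}"
  have pos: "alpha1 \<in> positive_roots" unfolding a0 positive_roots_eq by blast
  have ht: "ht1 (add_mset alpha1 M) = ht1 M + 1" "partition_weight (add_mset alpha1 M) = t * partition_weight M" for M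
    unfolding a0 by (simp_all add: ht1_def ht2_def partition_weight_def)
  have split: "{M \<in> ?P. ht1 M = a} = ?A \<union> add_mset alpha1 ` ?B"
  proof (intro equalityI subsetI)
    fix M assume M: "M \<in> {M \<in> ?P. ht1 M = a}"
    show "M \<in> ?A \<union> add_mset alpha1 ` ?B"
    proof (cases "alpha1 \<in># M")
      case True
      then obtain M' where M': "M = add_mset alpha1 M'" by (metis mset_add)
      hence "M' \<in> ?B" using M ht(1)[of M'] by (auto simp: multisets_over_def)
      thus ?thesis using M' by blast
    next
      case False
      thus ?thesis using M by (auto simp: multisets_over_def)
    qed
  next
    fix M assume "M \<in> ?A \<union> add_mset alpha1 ` ?B"
    thus "M \<in> {M \<in> ?P. ht1 M = a}" using pos by (auto simp: multisets_over_def ht)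
  qed
  have s: "partition_weight summable_on S" if "S \<subseteq> ?P" for S
    by (rule summable_on_subset_banach[OF abs_summable_summable[OF abs_summable_partition_weight] that])
  have sub: "?A \<subseteq> ?P" "add_mset alpha1 ` ?B \<subseteq> ?P" using split by blast+
  have "string_coeff a = reduced_coeff a + infsum partition_weight (add_mset alpha1 ` ?B)"
    unfolding string_coeff_def split reduced_coeff_def
    by (rule infsum_Un_disjoint[OF s[OF sub(1)] s[OF sub(2)]]) (auto simp: multisets_over_def)
  also have "infsum partition_weight (add_mset alpha1 ` ?B) = (\<Sum>\<^sub>\<infinity>M\<in>?B. t * partition_weight M)"
    by (subst infsum_reindex) (auto simp: ht o_def inj_on_def)
  also have "\<dots> = t * string_coeff (a - 1)" by (simp add: string_coeff_def infsum_cmult_right')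
  finally show ?thesis .
qed

text \<open>The coefficients of \<open>\<Psi>(z) + (t / z) \<Psi>(1 / z)\<close>, see \<open>has_sum_poisson_coeff\<close>.\<close>

definition poisson_coeff :: "int \<Rightarrow> complex" where
  "poisson_coeff a = string_coeff a + t * string_coeff (- a - 1)"

text \<open>Rearranged, the claim says that the coefficients of \<open>(1 - t z) \<Psi>(z)\<close> at \<open>a\<close> and \<open>- a\<close> agree.\<close>

lemma poisson_coeff_minus: "poisson_coeff (- a) = poisson_coeff a"
proof -
  have "string_coeff a - t * string_coeff (a - 1) = string_coeff (- a) - t * string_coeff (- a - 1)"
    using string_coeff_remove_alpha1[of a] string_coeff_remove_alpha1[of "- a"] reduced_coeff_minus[of a] by simp
  thus ?thesis by (simp add: poisson_coeff_def algebra_simps)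
qed

lemma poisson_coeff_eq: "poisson_coeff a = string_coeff a + t * q powi (a + 1) * string_coeff (a + 1)"
  using string_coeff_minus[of "a + 1"] by (simp add: poisson_coeff_def mult.assoc)

definition eta_factor :: "complex \<Rightarrow> nat \<Rightarrow> complex" where
  "eta_factor z n = 1 / ((1 - t * q ^ Suc n) * (1 - t * z * q ^ Suc n) * (1 - t * inverse z * q ^ Suc n))"

lemma eta_factor_inverse: "eta_factor (inverse z) n = eta_factor z n"
  by (simp add: eta_factor_def mult_ac)

lemma convergent_eta_factor: "convergent_prod (eta_factor z)"
proof -
  have c: "convergent_prod (\<lambda>n. 1 - c * q ^ Suc n)" for c
  proof (rule abs_convergent_prod_imp_convergent_prod)
    have "summable (\<lambda>n. norm (c * q) * norm q ^ n)"
      using q_less by (intro summable_mult summable_geometric) simp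
    thus "abs_convergent_prod (\<lambda>n. 1 - c * q ^ Suc n)"
      by (simp add: abs_convergent_prod_conv_summable norm_mult norm_power mult.assoc)
  qed
  have "convergent_prod (\<lambda>n. inverse ((1 - t * q ^ Suc n) * (1 - t * z * q ^ Suc n) * (1 - t * inverse z * q ^ Suc n)))"
    by (intro convergent_prod_inverse convergent_prod_mult c)
  thus ?thesis unfolding eta_factor_def[abs_def] by (simp only: inverse_eq_divide)
qed

text \<open>The product over the positive roots is \<open>\<Phi>(z) / (1 - t z)\<close>: compared with \<open>\<Phi>\<close>, the factors of the roots
  \<open>\<alpha>\<^sub>1 + n \<delta>\<close> are shifted by one step, which leaves the factor of \<open>\<alpha>\<^sub>1\<close> and, in a finite product, a
  boundary factor tending to \<open>1\<close>.\<close>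

lemma has_sum_string_coeff:
  assumes z: "z \<noteq> 0" "norm t * norm z < 1" "norm t * norm q < norm z"
  shows "((\<lambda>a. string_coeff a * z powi a) has_sum (prodinf (eta_factor z) / (1 - t * z))) UNIV"
proof -
  let ?P = "multisets_over positive_roots"
  let ?\<Psi> = "\<Sum>\<^sub>\<infinity>M\<in>?P. partition_weight M * z powi ht1 M"
  have "((\<lambda>M. partition_weight M * z powi ht1 M) has_sum ?\<Psi>) ?P"
    using abs_summable_summable[OF abs_summable_partitions[OF z]] by simp
  from has_sum_fibres[OF this, of ht1]
  have "((\<lambda>a. \<Sum>\<^sub>\<infinity>M\<in>{M\<in>?P. ht1 M = a}. partition_weight M * z powi ht1 M) has_sum ?\<Psi>) UNIV" .
  moreover have "(\<Sum>\<^sub>\<infinity>M\<in>{M\<in>?P. ht1 M = a}. partition_weight M * z powi ht1 M) = string_coeff a * z powi a" for a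
    unfolding string_coeff_def infsum_cmult_left'[symmetric] by (rule infsum_cong) auto
  ultimately have *: "((\<lambda>a. string_coeff a * z powi a) has_sum ?\<Psi>) UNIV" by simp

  obtain r where r: "r < 1" "\<And>u. u \<in> positive_roots \<Longrightarrow> norm (root_weight z u) \<le> r"
    using root_weight_bound[OF z] by blast
  define D where "D N = up_root ` {..<N} \<union> down_root ` {..<N} \<union> imag_root ` {..<N}" for N :: nat
  have un: "(\<Union>N. h ` {..<N}) = range h" for h :: "nat \<Rightarrow> weight" by auto
  have D: "positive_roots = (\<Union>N. D N)" "incseq D" "\<And>N. finite (D N)"
    unfolding positive_roots_eq D_def by (simp_all add: UN_Un_distrib un) (force simp: incseq_def)
  have lim: "(\<lambda>N. \<Prod>u\<in>D N. 1 / (1 - root_weight z u)) \<longlonglongrightarrow> ?\<Psi>"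
    using prod_tendsto_infsum_multisets[OF summable_root_weight r D] by (simp only: prod_root_weight[OF z(1)])
  have nz: "1 - t * z * q ^ n \<noteq> 0" for n
    using r(2)[of "up_root n"] r(1) by (auto simp: positive_roots_eq)
  have disj: "down_root i \<noteq> up_root j" "up_root i \<noteq> down_root j"
    "imag_root i \<noteq> up_root j" "up_root i \<noteq> imag_root j"
    "imag_root i \<noteq> down_root j" "down_root i \<noteq> imag_root j" for i j
    by (auto dest: arg_cong[of _ _ root_ht1])
  have fin: "(\<Prod>u\<in>D N. 1 / (1 - root_weight z u)) * (1 - t * z) = (\<Prod>n<N. eta_factor z n) * (1 - t * z * q ^ N)" for N
  proof -
    let ?w = "\<lambda>u. 1 / (1 - root_weight z u)"
    have "prod ?w (D N) = prod ?w (up_root ` {..<N}) * prod ?w (down_root ` {..<N}) * prod ?w (imag_root ` {..<N})"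
    proof -
      have "prod ?w (D N) = prod ?w (up_root ` {..<N} \<union> down_root ` {..<N}) * prod ?w (imag_root ` {..<N})"
        unfolding D_def by (rule prod.union_disjoint) (use disj in force)+
      also have "prod ?w (up_root ` {..<N} \<union> down_root ` {..<N}) = prod ?w (up_root ` {..<N}) * prod ?w (down_root ` {..<N})"
        by (rule prod.union_disjoint) (use disj in force)+
      finally show ?thesis .
    qed
    also have "\<dots> = (\<Prod>n<N. 1 / (1 - t * z * q ^ n)) * (\<Prod>n<N. 1 / (1 - t * inverse z * q ^ Suc n)) *
        (\<Prod>n<N. 1 / (1 - t * q ^ Suc n))"
      using inj_root_families
      by (simp add: prod.reindex inj_on_subset[OF _ subset_UNIV] del: power_Suc)
    finally have 1: "prod ?w (D N) = (\<Prod>n<N. 1 / (1 - t * z * q ^ n)) *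
        (\<Prod>n<N. 1 / (1 - t * inverse z * q ^ Suc n)) * (\<Prod>n<N. 1 / (1 - t * q ^ Suc n))" .
    have 2: "(\<Prod>n<N. 1 / (1 - t * z * q ^ n)) * (1 - t * z) = (\<Prod>n<N. 1 / (1 - t * z * q ^ Suc n)) * (1 - t * z * q ^ N)"
    proof (induction N)
      case (Suc N)
      have "(\<Prod>n<Suc N. 1 / (1 - t * z * q ^ n)) * (1 - t * z) =
          ((\<Prod>n<N. 1 / (1 - t * z * q ^ n)) * (1 - t * z)) / (1 - t * z * q ^ N)" by simp
      also have "\<dots> = (\<Prod>n<N. 1 / (1 - t * z * q ^ Suc n))" unfolding Suc using nz[of N] by simp
      also have "\<dots> = (\<Prod>n<Suc N. 1 / (1 - t * z * q ^ Suc n)) * (1 - t * z * q ^ Suc N)"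
        using nz[of "Suc N"] by (simp del: power_Suc)
      finally show ?case .
    qed simp
    have 3: "(\<Prod>n<N. eta_factor z n) = (\<Prod>n<N. 1 / (1 - t * z * q ^ Suc n)) *
        (\<Prod>n<N. 1 / (1 - t * inverse z * q ^ Suc n)) * (\<Prod>n<N. 1 / (1 - t * q ^ Suc n))"
      unfolding prod.distrib[symmetric] by (rule prod.cong) (simp_all add: eta_factor_def mult_ac)
    have "prod ?w (D N) * (1 - t * z) = ((\<Prod>n<N. 1 / (1 - t * z * q ^ n)) * (1 - t * z)) *
        (\<Prod>n<N. 1 / (1 - t * inverse z * q ^ Suc n)) * (\<Prod>n<N. 1 / (1 - t * q ^ Suc n))"
      unfolding 1 by (simp only: mult_ac)
    thus ?thesis unfolding 2 3 by (simp only: mult_ac)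
  qed
  have "(\<lambda>N. q ^ N) \<longlonglongrightarrow> 0" using q_less by (rule LIMSEQ_power_zero)
  hence "(\<lambda>N. 1 - t * z * q ^ N) \<longlonglongrightarrow> 1 - t * z * 0"
    by (intro tendsto_diff tendsto_mult tendsto_const)
  moreover have "(\<lambda>N. \<Prod>n<N. eta_factor z n) \<longlonglongrightarrow> prodinf (eta_factor z)"
    using convergent_prod_LIMSEQ[OF convergent_eta_factor[of z]]
    by (simp add: LIMSEQ_lessThan_iff_atMost[symmetric])
  ultimately have "(\<lambda>N. (\<Prod>n<N. eta_factor z n) * (1 - t * z * q ^ N)) \<longlonglongrightarrow> prodinf (eta_factor z) * (1 - t * z * 0)"
    by (intro tendsto_mult)
  moreover have "(\<lambda>N. (\<Prod>n<N. eta_factor z n) * (1 - t * z * q ^ N)) \<longlonglongrightarrow> ?\<Psi> * (1 - t * z)"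
    unfolding fin[symmetric] by (intro tendsto_mult lim tendsto_const)
  ultimately have "?\<Psi> * (1 - t * z) = prodinf (eta_factor z)" using LIMSEQ_unique by fastforce
  hence "?\<Psi> = prodinf (eta_factor z) / (1 - t * z)" using nz[of 0] by (simp add: field_simps)
  thus ?thesis using * by simp
qed

text \<open>Since \<open>\<Phi>(1 / z) = \<Phi>(z)\<close>, the sum \<open>\<Psi>(z) + (t / z) \<Psi>(1 / z)\<close> equals
  \<open>\<Phi>(z) (1 / (1 - t z) + (t / z) / (1 - t / z))\<close>, and the bracket is the Poisson kernel. Both expansions
  converge on the annulus of the theorem.\<close>

lemma has_sum_poisson_coeff:
  assumes z: "norm t < norm z" "norm z < 1 / norm t"
  shows "((\<lambda>a. poisson_coeff a * z powi a) has_sum (prodinf (eta_factor z) * poisson_kernel t z)) UNIV"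
proof -
  let ?F = "prodinf (eta_factor z)"
  have z0: "z \<noteq> 0" using z(1) t_pos by auto
  have tz: "norm t * norm z < 1" using z(2) t_pos by (simp add: field_simps)
  have tq: "norm t * norm q < norm z" using t_pos q_less z(1) by (auto intro: le_less_trans[of _ "norm t"])
  have "norm t * norm q * norm z = (norm t * norm z) * norm q" by simp
  also have "\<dots> < 1 * 1" by (rule mult_strict_mono) (use tz q_less in auto)
  finally have tqz: "norm t * norm q * norm z < 1" by simp
  have "((\<lambda>a. string_coeff a * z powi a) has_sum (?F / (1 - t * z))) UNIV"
    by (rule has_sum_string_coeff) (use z0 tz tq z in auto)
  moreover have "((\<lambda>a. t * string_coeff (- a - 1) * z powi a) has_sum (t / z * (?F / (1 - t * inverse z)))) UNIV"
  proof -
    have "((\<lambda>a. string_coeff a * inverse z powi a) has_sum (prodinf (eta_factor (inverse z)) / (1 - t * inverse z))) UNIV"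
      by (rule has_sum_string_coeff) (use z0 z tqz in \<open>auto simp: norm_inverse norm_divide field_simps\<close>)
    hence "((\<lambda>a. string_coeff a * inverse z powi a) has_sum (?F / (1 - t * inverse z))) UNIV"
      by (simp add: eta_factor_inverse[abs_def] cong: prodinf_cong)
    from has_sum_cmult_right[OF this, of "t / z"]
    have "((\<lambda>a. t / z * (string_coeff a * inverse z powi a)) has_sum (t / z * (?F / (1 - t * inverse z)))) UNIV" .
    also have "?this \<longleftrightarrow> ((\<lambda>a. t * string_coeff (- a - 1) * z powi a) has_sum (t / z * (?F / (1 - t * inverse z)))) UNIV"
    proof (rule has_sum_reindex_bij_witness[where i = "\<lambda>a. - a - 1" and j = "\<lambda>a. - a - 1"])
      fix a :: int
      have "z powi (- a - 1) = inverse z powi a / z"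
        using z0 by (simp add: power_int_diff power_int_minus power_int_inverse)
      thus "t * string_coeff (- (- a - 1) - 1) * z powi (- a - 1) = t / z * (string_coeff a * inverse z powi a)"
        by simp
    qed auto
    finally show ?thesis .
  qed
  ultimately have "((\<lambda>a. string_coeff a * z powi a + t * string_coeff (- a - 1) * z powi a) has_sum
      (?F / (1 - t * z) + t / z * (?F / (1 - t * inverse z)))) UNIV"
    by (rule has_sum_add)
  moreover have "?F / (1 - t * z) + t / z * (?F / (1 - t * inverse z)) = ?F * poisson_kernel t z"
  proof -
    have "t \<noteq> z" using z(1) by auto
    have "t * z \<noteq> 1" using tz by (metis norm_mult norm_one less_irrefl)
    thus ?thesis using z0 \<open>t \<noteq> z\<close> unfolding poisson_kernel_def
      by (simp add: divide_simps power2_eq_square) (simp add: algebra_simps)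
  qed
  ultimately show ?thesis by (simp add: poisson_coeff_def algebra_simps)
qed

end

section \<open>Boosts and the group of the quadratic form\<close>

lemma vec2_eq_iff: "(v::real^2) = w \<longleftrightarrow> v $ 1 = w $ 1 \<and> v $ 2 = w $ 2"
  by (simp add: vec_eq_iff forall_2)

lemma mat2_apply: "((g::real^2^2) *v v) $ i = g $ i $ 1 * v $ 1 + g $ i $ 2 * v $ 2"
  by (simp add: matrix_vector_mult_def sum_2)

lemma mat2_eqI:
  fixes g h :: "real^2^2"
  assumes "\<And>v. g *v v = h *v v"
  shows "g = h"
  using assms by (simp add: matrix_eq)

lemma zeta_apply [simp]: "(zeta *v v) $ 1 = - v $ 1" "(zeta *v v) $ 2 = v $ 2"
  by (simp_all add: zeta_def mat2_apply)

lemma zeta_zeta [simp]: "zeta *v (zeta *v v) = v"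
  by (simp add: vec2_eq_iff)

lemma mem_lattice_M: "v \<in> lattice_M \<longleftrightarrow> v $ 1 \<in> \<int> \<and> v $ 2 \<in> \<int>"
  by (simp add: lattice_M_def forall_2)

lemma mem_lattice_L: "v \<in> lattice_L c \<longleftrightarrow> v $ 1 - c $ 1 \<in> \<int> \<and> v $ 2 - c $ 2 \<in> \<int>"
proof -
  have "v \<in> lattice_L c \<longleftrightarrow> v - c \<in> lattice_M"
    by (force simp: lattice_L_def image_iff)
  thus ?thesis by (simp add: mem_lattice_M)
qed

text \<open>With \<open>\<kappa> = sqrt (m / (m + 2))\<close> the form is \<open>2 (m + 2) (x\<^sup>2 - \<kappa>\<^sup>2 y\<^sup>2)\<close>, and the identity component of its
  orthogonal group consists of the hyperbolic rotations \<open>boost s\<close>.\<close>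

locale hecke_plane =
  fixes m :: nat
  assumes m_pos: "m \<ge> 1"
begin

definition \<kappa> :: real where "\<kappa> = sqrt (real m / (real m + 2))"

lemma \<kappa>_pos: "0 < \<kappa>" and \<kappa>_less: "\<kappa> < 1" and \<kappa>_sq: "\<kappa>\<^sup>2 = real m / (real m + 2)"
  using m_pos by (auto simp: \<kappa>_def)

lemma \<kappa>_nz [simp]: "\<kappa> \<noteq> 0" using \<kappa>_pos by simp

definition boost :: "real \<Rightarrow> real^2^2" where
  "boost s = (\<chi> i j. if i = 1 then (if j = 1 then cosh s else \<kappa> * sinh s)
     else (if j = 1 then sinh s / \<kappa> else cosh s))"

lemma boost_apply [simp]:
  "(boost s *v v) $ 1 = cosh s * v $ 1 + \<kappa> * sinh s * v $ 2"
  "(boost s *v v) $ 2 = sinh s / \<kappa> * v $ 1 + cosh s * v $ 2"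
  by (simp_all add: mat2_apply boost_def)

lemma boost_boost: "boost s *v (boost r *v v) = boost (s + r) *v v"
  by (simp add: vec2_eq_iff cosh_add sinh_add field_simps)

lemma boost_0 [simp]: "boost 0 = mat 1"
  by (rule mat2_eqI) (simp add: vec2_eq_iff)

lemma boost_zeta: "boost s *v (zeta *v v) = zeta *v (boost (- s) *v v)"
  by (simp add: vec2_eq_iff)

lemma qform_eq: "qform m v = 2 * (real m + 2) * ((v $ 1)\<^sup>2 - \<kappa>\<^sup>2 * (v $ 2)\<^sup>2)"
  unfolding \<kappa>_sq qform_def by (simp add: field_simps)

lemma qform_boost [simp]: "qform m (boost s *v v) = qform m v"
proof -
  have "(cosh s * v $ 1 + \<kappa> * sinh s * v $ 2)\<^sup>2 - \<kappa>\<^sup>2 * (sinh s / \<kappa> * v $ 1 + cosh s * v $ 2)\<^sup>2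
      = ((cosh s)\<^sup>2 - (sinh s)\<^sup>2) * ((v $ 1)\<^sup>2 - \<kappa>\<^sup>2 * (v $ 2)\<^sup>2)"
    by (simp add: power2_eq_square field_simps)
  also have "(cosh s)\<^sup>2 - (sinh s)\<^sup>2 = 1" by (simp add: cosh_square_eq)
  finally show ?thesis by (simp add: qform_eq)
qed

lemma qform_zeta [simp]: "qform m (zeta *v v) = qform m v"
  by (simp add: qform_def)

lemma boost_in_orth_group: "boost s \<in> orth_group m"
proof -
  have "boost s ** boost (- s) = mat 1" "boost (- s) ** boost s = mat 1"
    by (rule mat2_eqI, simp flip: matrix_vector_mul_assoc add: boost_boost)+
  hence "invertible (boost s)" unfolding invertible_def by blast
  thus ?thesis by (simp add: orth_group_def)
qed

lemma connected_range_boost: "connected (range boost)"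
proof (rule connected_continuous_image)
  show "continuous_on UNIV boost" unfolding boost_def[abs_def]
  proof (intro continuous_on_vec_lambda)
    fix i j :: 2
    show "continuous_on UNIV (\<lambda>s. if i = 1 then (if j = 1 then cosh s else \<kappa> * sinh s)
        else (if j = 1 then sinh s / \<kappa> else cosh s))"
      by (cases "i = 1"; cases "j = 1") (auto intro!: continuous_intros)
  qed
qed simp

lemma orth_group_entries:
  assumes "g \<in> orth_group m"
  shows "(real m + 2) * (g $ 1 $ 1)\<^sup>2 - real m * (g $ 2 $ 1)\<^sup>2 = real m + 2"
    "(real m + 2) * (g $ 1 $ 2)\<^sup>2 - real m * (g $ 2 $ 2)\<^sup>2 = - real m"
    "(real m + 2) * (g $ 1 $ 1 * g $ 1 $ 2) = real m * (g $ 2 $ 1 * g $ 2 $ 2)"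
    "\<bar>g $ 1 $ 1\<bar> \<ge> 1" "\<bar>g $ 2 $ 2\<bar> \<ge> 1"
proof -
  have q: "qform m (g *v v) = qform m v" for v using assms by (simp add: orth_group_def)
  show 1: "(real m + 2) * (g $ 1 $ 1)\<^sup>2 - real m * (g $ 2 $ 1)\<^sup>2 = real m + 2"
    using q[of "vector [1, 0]"] by (simp add: qform_def mat2_apply algebra_simps; argo)
  show 2: "(real m + 2) * (g $ 1 $ 2)\<^sup>2 - real m * (g $ 2 $ 2)\<^sup>2 = - real m"
    using q[of "vector [0, 1]"] by (simp add: qform_def mat2_apply algebra_simps; argo)
  show "(real m + 2) * (g $ 1 $ 1 * g $ 1 $ 2) = real m * (g $ 2 $ 1 * g $ 2 $ 2)"
    using q[of "vector [1, 1]"] 1 2 by (simp add: qform_def mat2_apply power2_eq_square algebra_simps)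
  have "(real m + 2) * 1 \<le> (real m + 2) * (g $ 1 $ 1)\<^sup>2"
    using 1 by (smt (verit) mult_nonneg_nonneg of_nat_0_le_iff zero_le_power2)
  hence "1 \<le> (g $ 1 $ 1)\<^sup>2" by (subst (asm) mult_le_cancel_left_pos) auto
  thus "\<bar>g $ 1 $ 1\<bar> \<ge> 1" by (simp add: abs_le_square_iff[of 1, simplified])
  have "real m * 1 \<le> real m * (g $ 2 $ 2)\<^sup>2"
    using 2 by (smt (verit) mult_nonneg_nonneg of_nat_0_le_iff zero_le_power2)
  hence "1 \<le> (g $ 2 $ 2)\<^sup>2" using m_pos by (subst (asm) mult_le_cancel_left_pos) auto
  thus "\<bar>g $ 2 $ 2\<bar> \<ge> 1" by (simp add: abs_le_square_iff[of 1, simplified])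
qed

text \<open>The boosts are a connected set containing the identity. Conversely, the diagonal entries of an
  isometry have absolute value at least \<open>1\<close>, so they keep their sign on a connected set; an isometry with
  positive diagonal entries is a boost.\<close>

lemma SO0_eq: "SO0 m = range boost"
proof
  show "range boost \<subseteq> SO0 m"
  proof
    fix g assume "g \<in> range boost"
    moreover have "mat 1 \<in> range boost" by (rule range_eqI[of _ _ 0]) simp
    ultimately show "g \<in> SO0 m"
      unfolding SO0_def connected_component_def mem_Collect_eq
      by (intro exI[of _ "range boost"]) (use connected_range_boost boost_in_orth_group in auto)
  qed
  show "SO0 m \<subseteq> range boost"
  proof
    fix g assume "g \<in> SO0 m"
    then obtain T where T: "connected T" "T \<subseteq> orth_group m" "mat 1 \<in> T" "g \<in> T"
      unfolding SO0_def connected_component_def by auto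
    have pos: "g $ i $ i > 0" if i: "\<And>h. h \<in> T \<Longrightarrow> h $ i $ i \<noteq> 0" for i
    proof (rule ccontr)
      assume neg: "\<not> g $ i $ i > 0"
      have "connected ((\<lambda>h. h $ i $ i) ` T)"
        by (intro connected_continuous_image T continuous_intros)
      moreover have "g $ i $ i \<in> (\<lambda>h. h $ i $ i) ` T" using T by blast
      moreover have "1 \<in> (\<lambda>h. h $ i $ i) ` T" using T(3) by (force simp: mat_def image_iff)
      ultimately have "{g $ i $ i..1} \<subseteq> (\<lambda>h. h $ i $ i) ` T" by (rule connected_contains_Icc)
      hence "0 \<in> (\<lambda>h. h $ i $ i) ` T" using neg by (force simp: subset_iff)
      thus False using i by auto
    qed
    have p: "g $ 1 $ 1 > 0" "g $ 2 $ 2 > 0"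
      using orth_group_entries(4,5) T(2) by (intro pos; fastforce)+
    have g: "g \<in> orth_group m" using T by blast
    note e = orth_group_entries(1-3)[OF g]
    have m0: "real m > 0" using m_pos by simp
    have sq: "(g $ 2 $ 2)\<^sup>2 = (g $ 1 $ 1)\<^sup>2"
    proof -
      have "(real m + 2)\<^sup>2 * ((g $ 1 $ 1)\<^sup>2 * (g $ 1 $ 2)\<^sup>2) = (real m)\<^sup>2 * ((g $ 2 $ 1)\<^sup>2 * (g $ 2 $ 2)\<^sup>2)"
        using arg_cong[OF e(3), of "\<lambda>x. x\<^sup>2"] by (simp add: power_mult_distrib)
      moreover have "(real m + 2) * (g $ 1 $ 2)\<^sup>2 = real m * (g $ 2 $ 2)\<^sup>2 - real m"
        "real m * (g $ 2 $ 1)\<^sup>2 = (real m + 2) * (g $ 1 $ 1)\<^sup>2 - (real m + 2)" using e by auto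
      ultimately have "(real m + 2) * real m * ((g $ 2 $ 2)\<^sup>2 - (g $ 1 $ 1)\<^sup>2) = 0" by algebra
      thus ?thesis using m0 by simp
    qed
    hence g22: "g $ 2 $ 2 = g $ 1 $ 1" using p by (simp add: power2_eq_iff_nonneg)
    have g12: "(real m + 2) * g $ 1 $ 2 = real m * g $ 2 $ 1"
      using e(3) p unfolding g22 by simp
    let ?s = "arsinh (\<kappa> * g $ 2 $ 1)"
    have sinh: "sinh ?s = \<kappa> * g $ 2 $ 1" by simp
    have "(real m + 2) * ((g $ 1 $ 1)\<^sup>2) = (real m + 2) * ((\<kappa> * g $ 2 $ 1)\<^sup>2 + 1)"
      using e(1) by (simp add: power_mult_distrib \<kappa>_sq field_simps)
    hence "(g $ 1 $ 1)\<^sup>2 = (\<kappa> * g $ 2 $ 1)\<^sup>2 + 1" by (subst (asm) mult_cancel_left) auto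
    hence cosh: "cosh ?s = g $ 1 $ 1"
      using p by (simp add: cosh_arsinh_real real_sqrt_unique)
    have "\<kappa> * (\<kappa> * g $ 2 $ 1) = \<kappa>\<^sup>2 * g $ 2 $ 1" by (simp add: power2_eq_square)
    also have "\<dots> = g $ 1 $ 2" unfolding \<kappa>_sq using g12 by (simp add: field_simps)
    finally have "boost ?s = g"
      by (simp add: vec_eq_iff forall_2 boost_def sinh cosh g22)
    thus "g \<in> range boost" by (metis rangeI)
  qed
qed

text \<open>The parameter for which the boost has matrix \<open>(m + 1, m; m + 2, m + 1)\<close>. It maps the ray \<open>y = - x\<close> to the
  ray \<open>y = x\<close>, and its powers preserve the lattice.\<close>

definition step :: real where "step = 2 * arsinh (sqrt (real m / 2))"

lemma cosh_step: "cosh step = real m + 1" and sinh_step: "sinh step = sqrt (real m * (real m + 2))"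
proof -
  let ?a = "arsinh (sqrt (real m / 2))"
  have "cosh step = 2 * (sinh ?a)\<^sup>2 + 1"
    unfolding step_def cosh_double cosh_square_eq by simp
  thus "cosh step = real m + 1" by simp
  have s: "sinh step = 2 * (sqrt (real m / 2) * sqrt (real m / 2 + 1))"
    unfolding step_def sinh_double by (simp add: cosh_arsinh_real)
  have "(sinh step)\<^sup>2 = real m * (real m + 2)"
    unfolding s power_mult_distrib by (simp add: field_simps)
  moreover have "sinh step \<ge> 0" unfolding s by simp
  ultimately show "sinh step = sqrt (real m * (real m + 2))" by (simp add: real_sqrt_unique)
qed

lemma \<kappa>_sinh_step: "\<kappa> * sinh step = real m" "sinh step / \<kappa> = real m + 2"
proof -
  have "\<kappa> * sinh step = sqrt ((real m / (real m + 2)) * (real m * (real m + 2)))"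
    unfolding sinh_step \<kappa>_def by (simp only: real_sqrt_mult)
  also have "(real m / (real m + 2)) * (real m * (real m + 2)) = (real m)\<^sup>2"
    by (simp add: power2_eq_square)
  finally show 1: "\<kappa> * sinh step = real m" by simp
  have "sinh step / \<kappa> = \<kappa> * sinh step / \<kappa>\<^sup>2" by (simp add: power2_eq_square)
  also have "\<dots> = real m + 2" unfolding 1 \<kappa>_sq using m_pos by simp
  finally show "sinh step / \<kappa> = real m + 2" .
qed

lemma boost_step_apply [simp]:
  "(boost step *v v) $ 1 = (real m + 1) * v $ 1 + real m * v $ 2"
  "(boost step *v v) $ 2 = (real m + 2) * v $ 1 + (real m + 1) * v $ 2"
  "(boost (- step) *v v) $ 1 = (real m + 1) * v $ 1 - real m * v $ 2"
  "(boost (- step) *v v) $ 2 = - (real m + 2) * v $ 1 + (real m + 1) * v $ 2"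
  using \<kappa>_sinh_step by (simp_all add: cosh_step)

lemma step_pos: "step > 0" using m_pos by (simp add: step_def)

lemma boost_lattice:
  assumes "v \<in> lattice_M"
  shows "boost (of_int k * step) *v v \<in> lattice_M"
proof (induction k rule: int_induct[of _ 0])
  case base
  then show ?case using assms by simp
next
  case (step1 k)
  have "boost (of_int (k + 1) * step) *v v = boost step *v (boost (of_int k * step) *v v)"
    unfolding boost_boost by (simp add: algebra_simps)
  moreover have "boost step *v w \<in> lattice_M" if "w \<in> lattice_M" for w
    using that unfolding mem_lattice_M boost_step_apply by (auto intro!: Ints_add Ints_mult)
  ultimately show ?case using step1 by metis
next
  case (step2 k)
  have "boost (of_int (k - 1) * step) *v v = boost (- step) *v (boost (of_int k * step) *v v)"
    unfolding boost_boost by (simp add: algebra_simps)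
  moreover have "boost (- step) *v w \<in> lattice_M" if "w \<in> lattice_M" for w
    using that unfolding mem_lattice_M boost_step_apply
    by (auto intro!: Ints_add Ints_mult Ints_diff Ints_minus)
  ultimately show ?case using step2 by metis
qed

lemma boost_in_group_G: "boost (of_int k * step) \<in> group_G m"
proof -
  have "v \<in> (*v) (boost (of_int k * step)) ` lattice_M" if "v \<in> lattice_M" for v
  proof
    show "v = boost (of_int k * step) *v (boost (of_int (- k) * step) *v v)"
      unfolding boost_boost by simp
    show "boost (of_int (- k) * step) *v v \<in> lattice_M" by (rule boost_lattice[OF that])
  qed
  thus ?thesis unfolding group_G_def SO0_eq using boost_lattice by auto
qed

lemma mem_dual_M: "v \<in> dual_M m \<longleftrightarrow> 2 * (real m + 2) * v $ 1 \<in> \<int> \<and> 2 * real m * v $ 2 \<in> \<int>"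
proof
  assume v: "v \<in> dual_M m"
  have "vector [1, 0] \<in> lattice_M" "vector [0, 1] \<in> lattice_M" by (simp_all add: mem_lattice_M)
  hence "qbil m v (vector [1, 0]) \<in> \<int>" "qbil m v (vector [0, 1]) \<in> \<int>" using v unfolding dual_M_def by blast+
  thus "2 * (real m + 2) * v $ 1 \<in> \<int> \<and> 2 * real m * v $ 2 \<in> \<int>"
    using Ints_minus[of "- (2 * real m * v $ 2)"] by (simp add: qbil_def)
next
  assume "2 * (real m + 2) * v $ 1 \<in> \<int> \<and> 2 * real m * v $ 2 \<in> \<int>"
  thus "v \<in> dual_M m" unfolding dual_M_def qbil_def mem_Collect_eq
    by (auto simp: mem_lattice_M intro!: Ints_diff Ints_mult)
qed

lemma lattice_M_add: "v \<in> lattice_M \<Longrightarrow> w \<in> lattice_M \<Longrightarrow> v + w \<in> lattice_M"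
  by (simp add: mem_lattice_M)

lemma lattice_M_diff: "v \<in> lattice_M \<Longrightarrow> w \<in> lattice_M \<Longrightarrow> v - w \<in> lattice_M"
  by (simp add: mem_lattice_M)

text \<open>The square of the generator, and its inverse, act trivially on the dual lattice modulo the lattice.\<close>

lemma boost_double_step:
  assumes v: "v \<in> dual_M m"
  shows "boost (2 * step) *v v - v \<in> lattice_M" "boost (- 2 * step) *v v - v \<in> lattice_M"
proof -
  define X Y where "X = 2 * (real m + 2) * v $ 1" and "Y = 2 * real m * v $ 2"
  have XY: "X \<in> \<int>" "Y \<in> \<int>" using v by (auto simp: mem_dual_M X_def Y_def)
  have b: "boost (2 * step) *v v = boost step *v (boost step *v v)"
    "boost (- 2 * step) *v v = boost (- step) *v (boost (- step) *v v)"
    unfolding boost_boost by simp_all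
  have "(boost (2 * step) *v v - v) $ 1 = real m * X + (real m + 1) * Y"
    "(boost (2 * step) *v v - v) $ 2 = (real m + 1) * X + (real m + 2) * Y"
    "(boost (- 2 * step) *v v - v) $ 1 = real m * X - (real m + 1) * Y"
    "(boost (- 2 * step) *v v - v) $ 2 = - (real m + 1) * X + (real m + 2) * Y"
    unfolding b vector_minus_component boost_step_apply X_def Y_def by (simp_all add: algebra_simps)
  thus "boost (2 * step) *v v - v \<in> lattice_M" "boost (- 2 * step) *v v - v \<in> lattice_M"
    unfolding mem_lattice_M using XY by (auto intro!: Ints_add Ints_mult Ints_diff Ints_minus)
qed

lemma boost_even_dual:
  assumes v: "v \<in> dual_M m"
  shows "boost (of_int (2 * k) * step) *v v - v \<in> lattice_M"
proof (induction k rule: int_induct[of _ 0])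
  case base
  then show ?case by (simp add: mem_lattice_M)
next
  case (step1 k)
  let ?g = "boost (of_int (2 * k) * step)"
  have "boost (of_int (2 * (k + 1)) * step) *v v - v = ?g *v (boost (2 * step) *v v - v) + (?g *v v - v)"
    unfolding matrix_vector_mult_diff_distrib boost_boost by (simp add: algebra_simps)
  thus ?case using boost_lattice[OF boost_double_step(1)[OF v], of "2 * k"] step1 by (metis lattice_M_add)
next
  case (step2 k)
  let ?g = "boost (of_int (2 * k) * step)"
  have "boost (of_int (2 * (k - 1)) * step) *v v - v = ?g *v (boost (- 2 * step) *v v - v) + (?g *v v - v)"
    unfolding matrix_vector_mult_diff_distrib boost_boost by (simp add: algebra_simps)
  thus ?case using boost_lattice[OF boost_double_step(2)[OF v], of "2 * k"] step2 by (metis lattice_M_add)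
qed

lemma boost_in_group_G0: "boost (of_int (2 * k) * step) \<in> group_G0 m"
  unfolding group_G0_def using boost_in_group_G boost_even_dual by blast

text \<open>A fundamental domain for the powers of the generator on the half of \<open>U\<^sup>+\<close> with positive first
  coordinate, bounded by the rays \<open>y = - x\<close> and \<open>y = x\<close>.\<close>

definition wedge :: "(real^2) set" where
  "wedge = {v. v $ 1 > 0 \<and> - v $ 1 < v $ 2 \<and> v $ 2 \<le> v $ 1}"

lemma group_G_boostE:
  assumes "g \<in> group_G m" obtains s where "g = boost s" "boost s \<in> group_G m"
  using assms by (auto simp: group_G_def SO0_eq)

text \<open>A boost preserving the lattice has integer entries \<open>p, b; r, p\<close> with \<open>(m + 2) b = m r\<close>. For \<open>d = r - b\<close>
  this gives \<open>(2 p)\<^sup>2 = 4 + d\<^sup>2 ((m + 1)\<^sup>2 - 1)\<close>, which excludes \<open>|d| = 1\<close>; for \<open>|d| \<ge> 2\<close> one gets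
  \<open>|r + b| \<ge> 2 p\<close>, and then the wedge is mapped off itself.\<close>

lemma wedge_unique:
  assumes g: "boost s \<in> group_G m" and v: "v \<in> wedge" "boost s *v v \<in> wedge"
  shows "s = 0"
proof (rule ccontr)
  assume s: "s \<noteq> 0"
  have M: "boost s *v w \<in> lattice_M" if "w \<in> lattice_M" for w
    using g that unfolding group_G_def by blast
  have "boost s *v (vector [1, 0]) \<in> lattice_M" "boost s *v (vector [0, 1]) \<in> lattice_M"
    by (rule M, simp add: mem_lattice_M)+
  hence "cosh s \<in> \<int>" "sinh s / \<kappa> \<in> \<int>" "\<kappa> * sinh s \<in> \<int>" by (auto simp: mem_lattice_M)
  then obtain p r b :: int where p: "cosh s = of_int p" and r: "sinh s / \<kappa> = of_int r" and b: "\<kappa> * sinh s = of_int b"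
    by (auto elim!: Ints_cases)
  have sr: "sinh s = \<kappa> * of_int r" using r by (simp add: field_simps)
  have mb: "(int m + 2) * b = int m * r"
  proof -
    have "of_int b = \<kappa>\<^sup>2 * of_int r" using b sr by (simp add: power2_eq_square)
    hence "(real m + 2) * of_int b = real m * of_int r" unfolding \<kappa>_sq by (simp add: field_simps)
    hence "real_of_int ((int m + 2) * b) = of_int (int m * r)" by simp
    thus ?thesis by (simp only: of_int_eq_iff)
  qed
  have det: "p\<^sup>2 = 1 + b * r"
  proof -
    have "(cosh s)\<^sup>2 = 1 + (\<kappa> * sinh s) * (sinh s / \<kappa>)"
      using cosh_square_eq[of s] by (simp add: power2_eq_square)
    hence "real_of_int (p\<^sup>2) = of_int (1 + b * r)" unfolding p r b by simp
    thus ?thesis by (simp only: of_int_eq_iff)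
  qed
  have p1: "p \<ge> 1" using cosh_real_ge_1[of s] p by simp
  define d where "d = r - b"
  have d: "int m * d = 2 * b" "(int m + 2) * d = 2 * r" using mb by (simp_all add: d_def algebra_simps)
  have four: "4 * p\<^sup>2 = 4 + d\<^sup>2 * ((int m + 1)\<^sup>2 - 1)"
  proof -
    have "4 * p\<^sup>2 = 4 + (2 * b) * (2 * r)" using det by simp
    also have "\<dots> = 4 + d\<^sup>2 * ((int m + 1)\<^sup>2 - 1)" unfolding d[symmetric] by (simp add: power2_eq_square algebra_simps)
    finally show ?thesis .
  qed
  have "r \<noteq> 0" using s sr by auto
  hence d0: "d \<noteq> 0" using d(2) by auto
  have d1: "\<bar>d\<bar> \<noteq> 1"
  proof
    assume "\<bar>d\<bar> = 1"
    hence "d\<^sup>2 = 1" by (metis power2_abs one_power2)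
    hence e: "(2 * p)\<^sup>2 = (int m + 1)\<^sup>2 + 3" using four by (simp add: power_mult_distrib)
    hence "(int m + 1)\<^sup>2 < (2 * p)\<^sup>2" by simp
    hence "int m + 1 < 2 * p" using p1 by (meson power2_less_imp_less zero_le_mult_iff zero_le_numeral order_trans zero_le_one)
    hence "(int m + 2)\<^sup>2 \<le> (2 * p)\<^sup>2" by (intro power_mono) auto
    hence "2 * int m \<le> 0" unfolding e by (simp add: power2_eq_square algebra_simps)
    thus False using m_pos by simp
  qed
  hence d2: "\<bar>d\<bar> \<ge> 2" using d0 by linarith
  have rb: "r + b = (int m + 1) * d" using d by (simp add: algebra_simps)
  have "4 \<le> d\<^sup>2" using power_mono[OF d2, of 2] by simp
  hence "(2 * p)\<^sup>2 \<le> (r + b)\<^sup>2" using four unfolding rb power_mult_distrib by (simp add: algebra_simps)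
  hence big: "2 * p \<le> \<bar>r + b\<bar>" by (rule power2_le_imp_le[of "2 * p" "\<bar>r + b\<bar>", unfolded power2_abs]) simp
  have "b * b \<le> b * r"
  proof -
    have "2 * (b * (r - b)) = (2 * b) * d" by (simp add: d_def)
    also have "\<dots> = int m * d\<^sup>2" unfolding d(1)[symmetric] by (simp add: power2_eq_square)
    also have "\<dots> \<ge> 0" by simp
    finally have "b * (r - b) \<ge> 0" by simp
    thus ?thesis by (simp add: algebra_simps)
  qed
  hence "b\<^sup>2 < p\<^sup>2" unfolding det by (simp add: power2_eq_square)
  hence pb: "\<bar>b\<bar> < p" using p1 power2_less_imp_less[of "\<bar>b\<bar>" p] by simp
  let ?x = "v $ 1" and ?y = "v $ 2"
  have w: "(boost s *v v) $ 1 = p * ?x + b * ?y" "(boost s *v v) $ 2 = r * ?x + p * ?y"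
    by (simp_all add: p r b)
  have xy: "?x > 0" "- ?x < ?y" "?y \<le> ?x" using v(1) by (auto simp: wedge_def)
  show False
  proof (cases "r + b \<ge> 0")
    case True
    hence "2 * p \<le> r + b" using big by simp
    hence "0 \<le> (real_of_int r + b - 2 * p) * ?x" using xy(1) by (intro mult_nonneg_nonneg) auto
    moreover have "(real_of_int p - b) * (- ?x) < (real_of_int p - b) * ?y"
      using pb xy by (intro mult_strict_left_mono) auto
    ultimately have "p * ?x + b * ?y < r * ?x + p * ?y" by (simp add: algebra_simps)
    thus False using v(2) unfolding wedge_def mem_Collect_eq w by linarith
  next
    case False
    hence "2 * p \<le> - (r + b)" using big by simp
    hence "0 \<le> (- real_of_int r - b - 2 * p) * ?x" using xy(1) by (intro mult_nonneg_nonneg) auto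
    moreover have "(real_of_int p + b) * ?y \<le> (real_of_int p + b) * ?x"
      using pb xy by (intro mult_left_mono) auto
    ultimately have "r * ?x + p * ?y \<le> - (p * ?x + b * ?y)" by (simp add: algebra_simps)
    thus False using v(2) unfolding wedge_def mem_Collect_eq w by linarith
  qed
qed

lemma tanh_half_step: "tanh (step / 2) = \<kappa>"
proof -
  have "sqrt (real m / 2) / sqrt (real m / 2 + 1) = sqrt ((real m / 2) / (real m / 2 + 1))"
    by (simp only: real_sqrt_divide)
  also have "(real m / 2) / (real m / 2 + 1) = real m / (real m + 2)" by (simp add: field_simps)
  finally show ?thesis by (simp add: step_def tanh_def cosh_arsinh_real \<kappa>_def)
qed

text \<open>In the hyperbolic angle \<open>\<phi>\<close> with \<open>tanh \<phi> = \<kappa> y / x\<close> a boost is a translation, and the wedge is an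
  interval of length \<open>step\<close>.\<close>

lemma wedge_exists:
  assumes v: "v \<in> U_plus m" "v $ 1 > 0"
  obtains k :: int where "boost (of_int k * step) *v v \<in> wedge"
proof -
  let ?x = "v $ 1" and ?y = "v $ 2"
  have N: "?x\<^sup>2 - \<kappa>\<^sup>2 * ?y\<^sup>2 > 0" using v(1) by (simp add: U_plus_def qform_eq zero_less_mult_iff)
  define R where "R = sqrt (?x\<^sup>2 - \<kappa>\<^sup>2 * ?y\<^sup>2)"
  have R: "R > 0" "R\<^sup>2 = ?x\<^sup>2 - \<kappa>\<^sup>2 * ?y\<^sup>2" using N by (auto simp: R_def)
  define \<phi> where "\<phi> = arsinh (\<kappa> * ?y / R)"
  have y: "?y = R * sinh \<phi> / \<kappa>" using R by (simp add: \<phi>_def)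
  have x: "?x = R * cosh \<phi>"
  proof -
    have "(\<kappa> * ?y / R)\<^sup>2 + 1 = (?x / R)\<^sup>2" using R by (simp add: power_divide power_mult_distrib field_simps)
    hence "cosh \<phi> = ?x / R" unfolding \<phi>_def cosh_arsinh_real using v(2) R(1) by simp
    thus ?thesis using R by simp
  qed
  have bv: "(boost s *v v) $ 1 = R * cosh (s + \<phi>)" "(boost s *v v) $ 2 = R * sinh (s + \<phi>) / \<kappa>" for s
    by (simp_all add: x y cosh_add sinh_add field_simps)
  have in_wedge: "boost s *v v \<in> wedge" if "- (step / 2) < s + \<phi>" "s + \<phi> \<le> step / 2" for s
  proof -
    let ?a = "s + \<phi>"
    have c: "cosh ?a > 0" by simp
    have "tanh ?a \<le> \<kappa>" "- \<kappa> < tanh ?a"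
      using that tanh_half_step by (metis tanh_real_le_iff, metis tanh_minus tanh_real_less_iff)
    hence "sinh ?a \<le> \<kappa> * cosh ?a" "- \<kappa> * cosh ?a < sinh ?a"
      using c by (auto simp: tanh_def divide_le_eq less_divide_eq)
    hence "sinh ?a / \<kappa> \<le> cosh ?a" "- cosh ?a < sinh ?a / \<kappa>"
      using \<kappa>_pos by (auto simp: divide_le_eq less_divide_eq mult.commute)
    hence "R * (sinh ?a / \<kappa>) \<le> R * cosh ?a" "R * (- cosh ?a) < R * (sinh ?a / \<kappa>)"
      using R(1) by (simp_all only: mult_le_cancel_left_pos mult_less_cancel_left_pos)
    thus ?thesis unfolding wedge_def mem_Collect_eq bv using R(1) c by simp
  qed
  \<comment> \<open>This \<open>k\<close> moves the angle \<open>\<phi>\<close> into the half-open interval \<open>(- step / 2, step / 2]\<close>.\<close>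
  define k where "k = \<lfloor>1 / 2 - \<phi> / step\<rfloor>"
  have "of_int k \<le> 1 / 2 - \<phi> / step" "1 / 2 - \<phi> / step < of_int k + 1" unfolding k_def by linarith+
  hence "of_int k * step \<le> (1 / 2 - \<phi> / step) * step" "(1 / 2 - \<phi> / step) * step < (of_int k + 1) * step"
    using step_pos by (auto intro: mult_right_mono mult_strict_right_mono)
  hence "- (step / 2) < of_int k * step + \<phi>" "of_int k * step + \<phi> \<le> step / 2"
    using step_pos by (simp_all add: algebra_simps)
  from that[OF in_wedge[OF this]] show ?thesis .
qed

lemma group_G_boost_diff:
  assumes "boost s \<in> group_G m" "boost r \<in> group_G m"
  shows "boost (s - r) \<in> group_G m"
proof -
  have s: "(*v) (boost s) ` lattice_M = lattice_M" and r: "(*v) (boost r) ` lattice_M = lattice_M"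
    using assms by (auto simp: group_G_def)
  have "(*v) (boost (s - r)) ` lattice_M = (*v) (boost (s - r)) ` ((*v) (boost r) ` lattice_M)" by (simp add: r)
  also have "\<dots> = (*v) (boost s) ` lattice_M" by (simp add: image_image boost_boost)
  finally show ?thesis by (simp add: group_G_def SO0_eq s)
qed

lemma group_G_boost_minus: "boost s \<in> group_G m \<Longrightarrow> boost (- s) \<in> group_G m"
  using group_G_boost_diff[of 0 s] boost_in_group_G[of 0] by simp

section \<open>The fundamental domain of the extended group\<close>

lemma boost_fst_pos:
  assumes "v \<in> U_plus m" "v $ 1 > 0"
  shows "(boost s *v v) $ 1 > 0"
proof -
  have "(\<kappa> * v $ 2)\<^sup>2 < (v $ 1)\<^sup>2"
    using assms(1) by (simp add: U_plus_def qform_eq zero_less_mult_iff power_mult_distrib)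
  hence lt: "\<bar>\<kappa> * v $ 2\<bar> < v $ 1" using assms(2) by (metis abs_of_pos abs_square_less_1 power2_abs power2_less_imp_less less_imp_le)
  have "\<bar>sinh s\<bar> < cosh s" by (simp add: abs_less_iff sinh_less_cosh_real[of "- s", simplified] sinh_less_cosh_real)
  hence "\<bar>sinh s\<bar> * \<bar>\<kappa> * v $ 2\<bar> \<le> cosh s * \<bar>\<kappa> * v $ 2\<bar>" by (intro mult_right_mono) auto
  also have "\<dots> < cosh s * v $ 1" using lt by (intro mult_strict_left_mono) auto
  finally have "\<bar>sinh s * (\<kappa> * v $ 2)\<bar> < cosh s * v $ 1" by (simp add: abs_mult)
  thus ?thesis by (simp add: mult_ac; linarith)
qed

lemma U_plus_boost [simp]: "boost s *v v \<in> U_plus m \<longleftrightarrow> v \<in> U_plus m"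
  by (simp add: U_plus_def)

lemma U_plus_zeta [simp]: "zeta *v v \<in> U_plus m \<longleftrightarrow> v \<in> U_plus m"
  by (simp add: U_plus_def)

lemma U_plus_fst_nonzero: "v \<in> U_plus m \<Longrightarrow> v $ 1 \<noteq> 0"
  by (auto simp: U_plus_def qform_def mult_less_0_iff not_less)

lemma boost_fst_neg:
  assumes "v \<in> U_plus m" "v $ 1 < 0"
  shows "(boost s *v v) $ 1 < 0"
  using boost_fst_pos[of "zeta *v v" "- s"] assms unfolding boost_zeta by simp

lemma sign_boost:
  assumes "v \<in> U_plus m" shows "sign (boost s *v v) = sign v"
  using boost_fst_pos[OF assms, of s] boost_fst_neg[OF assms, of s] U_plus_fst_nonzero[OF assms]
  unfolding sign_def by (smt (verit))

lemma fund_domain_U_plus: "u \<in> fund_domain \<Longrightarrow> u \<in> U_plus m"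
proof -
  assume u: "u \<in> fund_domain"
  hence le: "\<bar>u $ 2\<bar> \<le> \<bar>u $ 1\<bar>" "u $ 1 \<noteq> 0" by (auto simp: fund_domain_def)
  have "\<kappa>\<^sup>2 * (u $ 2)\<^sup>2 \<le> \<kappa>\<^sup>2 * (u $ 1)\<^sup>2" using le(1) by (simp add: abs_le_square_iff mult_left_mono)
  also have "\<dots> < 1 * (u $ 1)\<^sup>2"
    using le(2) \<kappa>_pos \<kappa>_less by (intro mult_strict_right_mono) (auto simp: power_less_one_iff)
  finally show ?thesis by (simp add: U_plus_def qform_eq)
qed

definition flips :: "(real^2^2) set" where "flips = {mat 1, zeta}"

lemma flips_flips [simp]: "h \<in> flips \<Longrightarrow> h *v (h *v v) = v"
  by (auto simp: flips_def)

text \<open>The fundamental domain has one piece on either side of the line \<open>x = 0\<close>; reflecting the left piece to the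
  right turns it into the wedge. The sign of \<open>y\<close> tells the pieces apart.\<close>

definition unfold_wedge :: "real^2 \<Rightarrow> real^2" where
  "unfold_wedge w = (if w $ 2 \<ge> 0 then w else zeta *v w)"

lemma fund_domain_wedge:
  assumes "u \<in> fund_domain" "h \<in> flips"
  shows "(h *v u) $ 1 > 0 \<Longrightarrow> h *v u \<in> wedge \<and> u = unfold_wedge (h *v u)"
    and "(h *v u) $ 1 < 0 \<Longrightarrow> zeta *v (h *v u) \<in> wedge \<and> u = unfold_wedge (zeta *v (h *v u))"
  using assms by (auto simp: fund_domain_def flips_def wedge_def unfold_wedge_def vec2_eq_iff)

lemma wedge_unfold:
  assumes "w \<in> wedge"
  obtains h where "h \<in> flips" "h *v w \<in> fund_domain"
proof (cases "w $ 2 \<ge> 0")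
  case True
  thus ?thesis using assms by (intro that[of "mat 1"]) (auto simp: flips_def wedge_def fund_domain_def)
next
  case False
  thus ?thesis using assms by (intro that[of zeta]) (auto simp: flips_def wedge_def fund_domain_def)
qed

lemma fund_domain_unique:
  assumes u: "u \<in> fund_domain" "u' \<in> fund_domain" and h: "h \<in> flips" "h' \<in> flips"
    and r: "boost r \<in> group_G m" and eq: "h' *v u' = boost r *v (h *v u)"
  shows "u' = u"
proof -
  have U: "h *v u \<in> U_plus m" using fund_domain_U_plus[OF u(1)] h(1) by (auto simp: flips_def)
  consider "(h *v u) $ 1 > 0" | "(h *v u) $ 1 < 0" using U_plus_fst_nonzero[OF U] by linarith
  thus ?thesis
  proof cases
    case 1
    note w = fund_domain_wedge(1)[OF u(1) h(1) 1]
    have "(h' *v u') $ 1 > 0" unfolding eq by (rule boost_fst_pos[OF U 1])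
    note w' = fund_domain_wedge(1)[OF u(2) h(2) this]
    have "r = 0" using wedge_unique[OF r] w w' eq by metis
    thus ?thesis using w w' eq by (metis boost_0 matrix_vector_mul_lid)
  next
    case 2
    note w = fund_domain_wedge(2)[OF u(1) h(1) 2]
    have "(h' *v u') $ 1 < 0" unfolding eq by (rule boost_fst_neg[OF U 2])
    note w' = fund_domain_wedge(2)[OF u(2) h(2) this]
    have eq': "zeta *v (h' *v u') = boost (- r) *v (zeta *v (h *v u))"
      unfolding boost_zeta eq by simp
    have "- r = 0" using wedge_unique[OF group_G_boost_minus[OF r]] w w' eq' by metis
    hence "zeta *v (h' *v u') = zeta *v (h *v u)" using eq' by simp
    thus ?thesis using w w' by metis
  qed
qed

lemma dagger_eqI:
  assumes u: "u \<in> fund_domain" "u = h *v (boost s *v v)" and h: "h \<in> flips" and s: "boost s \<in> group_G m"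
  shows "dagger m v = u"
  unfolding dagger_def
proof (rule the_equality)
  show "u \<in> fund_domain \<and> (\<exists>g\<in>group_Gt m. u = g *v v)"
  proof (intro conjI bexI)
    show "u = (h ** boost s) *v v" by (simp add: u(2) flip: matrix_vector_mul_assoc)
    show "h ** boost s \<in> group_Gt m" unfolding group_Gt_def using h s by (auto simp: flips_def)
  qed (rule u)
  fix u' assume "u' \<in> fund_domain \<and> (\<exists>g\<in>group_Gt m. u' = g *v v)"
  then obtain h' g' where u': "u' \<in> fund_domain" and h': "h' \<in> flips" and g': "g' \<in> group_G m" "u' = (h' ** g') *v v"
    by (auto simp: group_Gt_def flips_def)
  obtain s' where s': "g' = boost s'" "boost s' \<in> group_G m" using g'(1) by (rule group_G_boostE)
  have "h' *v u' = boost s' *v v" using h' by (simp add: g'(2) s'(1) flip: matrix_vector_mul_assoc)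
  also have "\<dots> = boost (s' - s) *v (h *v u)" using h by (simp add: u(2) boost_boost)
  finally show "u' = u" by (rule fund_domain_unique[OF u(1) u' h h' group_G_boost_diff[OF s'(2) s]])
qed

end

section \<open>Orbits in the lattice translate\<close>

text \<open>The point \<open>(A, B)\<close> for \<open>A = J / (2 (m + 2))\<close> and \<open>B = j / (2 m)\<close>. The hypothesis \<open>order\<close> says \<open>B \<le> A\<close>;
  \<open>parity\<close> holds because \<open>\<Lambda> - \<lambda>\<close> lies in the root lattice.\<close>

locale hecke_coset = hecke_plane +
  fixes J j :: int
  assumes J_bounds: "0 < J" "J < int m + 2" and j_nonneg: "0 \<le> j"
    and order: "j * (int m + 2) \<le> J * int m" and parity: "odd (J - j)"
begin

definition A :: real where "A = of_int J / (2 * (real m + 2))"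
definition B :: real where "B = of_int j / (2 * real m)"

lemma A_J: "2 * (real m + 2) * A = of_int J" by (simp add: A_def)
lemma B_j: "2 * real m * B = of_int j" using m_pos by (simp add: B_def)

lemma AB_bounds: "0 < A" "A < 1 / 2" "0 \<le> B" "B \<le> A"
proof -
  have "real_of_int J < of_int (int m + 2)" using J_bounds(2) by (simp only: of_int_less_iff)
  thus "0 < A" "A < 1 / 2" using J_bounds by (auto simp: A_def divide_less_eq)
  show "0 \<le> B" using j_nonneg by (simp add: B_def)
  have "real_of_int (j * (int m + 2)) \<le> of_int (J * int m)" using order by (simp only: of_int_le_iff)
  thus "B \<le> A" using m_pos by (simp add: A_def B_def field_simps)
qed

definition corner :: "real^2" where "corner = vector [A, B]"

lemma corner_simps [simp]: "corner $ 1 = A" "corner $ 2 = B" by (simp_all add: corner_def)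

text \<open>The points of the four cosets \<open>L\<close>, \<open>\<zeta>L\<close> and their translates by \<open>(1/2, 1/2)\<close>; the flag \<open>s\<close> selects
  the sign of \<open>A\<close>, and the parity of \<open>n\<close> tells whether the point is translated.\<close>

definition pt :: "bool \<Rightarrow> int \<Rightarrow> int \<Rightarrow> real^2" where
  "pt s k n = vector [(if s then - A else A) + of_int k + of_int n / 2, B + of_int n / 2]"

lemma pt_simps [simp]:
  "pt s k n $ 1 = (if s then - A else A) + of_int k + of_int n / 2" "pt s k n $ 2 = B + of_int n / 2"
  by (simp_all add: pt_def)

definition cone_indices :: "(bool \<times> int \<times> int) set" where
  "cone_indices = {(s, k, n). if n \<ge> 0 then k \<ge> (if s then 1 else 0) else k < (if s then 1 else 0)}"

lemma pt_in_fund_domain: "pt s k n \<in> fund_domain \<longleftrightarrow> (s, k, n) \<in> cone_indices"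
proof -
  have k1: "real_of_int k \<ge> 1 \<longleftrightarrow> k \<ge> 1" "real_of_int k \<ge> 0 \<longleftrightarrow> k \<ge> 0"
    "k < 1 \<longrightarrow> real_of_int k \<le> 0" "k < 0 \<longrightarrow> real_of_int k \<le> -1"
    by linarith+
  have le: "B \<le> (if s then - A else A) + of_int k \<longleftrightarrow> k \<ge> (if s then 1 else 0)"
    using k1 AB_bounds by (cases s; cases "k \<ge> (if s then 1 else 0)") auto
  show ?thesis
  proof (cases "n \<ge> 0")
    case True
    hence n: "real_of_int n \<ge> 0" by simp
    have "(if s then - A else A) + of_int k > 0" if "B \<le> (if s then - A else A) + of_int k"
      using that unfolding le using k1 AB_bounds by (cases s) auto
    thus ?thesis using n True le AB_bounds by (auto simp: fund_domain_def cone_indices_def)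
  next
    case False
    hence n: "real_of_int n \<le> -1" by linarith
    show ?thesis using n False le AB_bounds by (auto simp: fund_domain_def cone_indices_def)
  qed
qed

lemma pt_inj: "pt s k n = pt s' k' n' \<Longrightarrow> s = s' \<and> k = k' \<and> n = n'"
proof -
  assume "pt s k n = pt s' k' n'"
  hence e: "(if s then - A else A) + of_int k + of_int n / 2 = (if s' then - A else A) + of_int k' + real_of_int n' / 2"
    "B + of_int n / 2 = B + real_of_int n' / 2" by (auto simp: vec2_eq_iff)
  have n: "n = n'" using e(2) by simp
  have "2 * A \<noteq> of_int i" for i :: int
  proof
    assume "2 * A = of_int i"
    hence "0 < real_of_int i" "real_of_int i < 1" using AB_bounds by auto
    thus False by simp
  qed
  from this[of "k - k'"] this[of "k' - k"] have "s = s'" using e(1) n by (cases s; cases s') auto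
  thus ?thesis using e(1) n by auto
qed

text \<open>For the boost \<open>g\<close> with parameter \<open>step\<close>, the involution \<open>g\<zeta>\<close> exchanges \<open>L\<close> with
  \<open>L + (1/2, 1/2)\<close>, so points with odd \<open>n\<close> are brought into \<open>L\<close> by \<open>g\<close>, after \<open>\<zeta>\<close> unless
  their sign of \<open>A\<close> is already reversed.\<close>

definition orbit_rep :: "bool \<Rightarrow> int \<Rightarrow> int \<Rightarrow> real^2" where
  "orbit_rep s k n = boost (of_bool (odd n) * step) *v ((if s = odd n then mat 1 else zeta) *v pt s k n)"

lemma orbit_rep_dagger:
  assumes i: "(s, k, n) \<in> cone_indices" and g: "g \<in> group_G0 m"
  shows "dagger m (g *v orbit_rep s k n) = pt s k n"
    "sign (g *v orbit_rep s k n) = sign (pt s k n) * (if s = odd n then 1 else - 1)"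
    "qform m (g *v orbit_rep s k n) = qform m (pt s k n)"
proof -
  let ?h = "if s = odd n then mat 1 else zeta :: real^2^2"
  have h: "?h \<in> flips" by (simp add: flips_def)
  have "g \<in> group_G m" using g by (simp add: group_G0_def)
  then obtain r where r: "g = boost r" "boost r \<in> group_G m" by (rule group_G_boostE)
  have u: "pt s k n \<in> fund_domain" using i by (simp add: pt_in_fund_domain)
  let ?s0 = "of_bool (odd n) * step"
  have v: "g *v orbit_rep s k n = boost (r + ?s0) *v (?h *v pt s k n)"
    by (simp add: orbit_rep_def r(1) boost_boost)
  have s0: "boost (- ?s0) \<in> group_G m"
    using boost_in_group_G[of "- of_bool (odd n)"] by simp
  have s: "boost (- ?s0 - r) \<in> group_G m" by (rule group_G_boost_diff[OF s0 r(2)])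
  show "dagger m (g *v orbit_rep s k n) = pt s k n"
    by (rule dagger_eqI[OF u _ h s]) (simp add: v boost_boost)
  have U: "?h *v pt s k n \<in> U_plus m" using fund_domain_U_plus[OF u] by (cases "s = odd n") simp_all
  have "pt s k n $ 1 \<noteq> 0" by (rule U_plus_fst_nonzero[OF fund_domain_U_plus[OF u]])
  thus "sign (g *v orbit_rep s k n) = sign (pt s k n) * (if s = odd n then 1 else - 1)"
    unfolding v sign_boost[OF U] by (auto simp: sign_def)
  show "qform m (g *v orbit_rep s k n) = qform m (pt s k n)"
    unfolding v qform_boost by simp
qed

lemma orbit_rep_mem:
  assumes i: "(s, k, n) \<in> cone_indices"
  shows "orbit_rep s k n \<in> lattice_L corner \<inter> U_plus m"
proof
  have U: "pt s k n \<in> U_plus m" using i by (simp add: pt_in_fund_domain fund_domain_U_plus)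
  thus "orbit_rep s k n \<in> U_plus m" by (cases "s = odd n") (simp_all add: orbit_rep_def)
  show "orbit_rep s k n \<in> lattice_L corner"
  proof (cases "even n")
    case True
    then obtain i where n: "n = 2 * i" by blast
    show ?thesis using True by (cases s) (simp_all add: orbit_rep_def mem_lattice_L n)
  next
    case False
    then obtain i where n: "n = 2 * i + 1" by (elim oddE)
    obtain d where d: "J - j = 2 * d + 1" using parity by (elim oddE)
    have J: "real_of_int J = of_int j + 2 * of_int d + 1"
    proof -
      have "real_of_int (J - j) = of_int (2 * d + 1)" using d by (simp only:)
      thus ?thesis by simp
    qed
    have mB: "real m * B = of_int j / 2" using B_j by simp
    have mA: "real m * A = of_int J / 2 - 2 * A" using A_J by (simp add: algebra_simps)
    show ?thesis
    proof (cases s)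
      case True
      have o: "orbit_rep s k n = boost step *v pt s k n"
        using True False by (simp add: orbit_rep_def)
      have 1: "orbit_rep s k n $ 1 - A = of_int ((int m + 1) * k + (2 * int m + 1) * i + int m - d)"
        "orbit_rep s k n $ 2 - B = of_int ((int m + 2) * k + (2 * int m + 3) * i + int m + 1 - d)"
        using True mB mA J unfolding o boost_step_apply pt_simps unfolding n
        by (simp_all add: algebra_simps) (simp_all add: field_simps)
      show ?thesis unfolding mem_lattice_L corner_simps 1 by simp
    next
      case s: False
      have o: "orbit_rep s k n = boost step *v (zeta *v pt s k n)"
        using s False by (simp add: orbit_rep_def)
      have 1: "orbit_rep s k n $ 1 - A = of_int (- (int m + 1) * k - i - d - 1)"
        "orbit_rep s k n $ 2 - B = of_int (- (int m + 2) * k - i - d - 1)"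
        using s mB mA J unfolding o boost_step_apply zeta_apply pt_simps unfolding n
        by (simp_all add: algebra_simps) (simp_all add: field_simps)
      show ?thesis unfolding mem_lattice_L corner_simps 1 by simp
    qed
  qed
qed

lemma lattice_L_dual: "v \<in> lattice_L corner \<Longrightarrow> v \<in> dual_M m"
proof -
  assume "v \<in> lattice_L corner"
  then obtain a b :: int where "v $ 1 = A + of_int a" "v $ 2 = B + of_int b"
    unfolding mem_lattice_L corner_simps by (metis Ints_cases add_diff_cancel_left' add_diff_eq diff_add_cancel add.commute)
  hence "2 * (real m + 2) * v $ 1 = of_int (J + 2 * (int m + 2) * a)" "2 * real m * v $ 2 = of_int (j + 2 * int m * b)"
    using A_J B_j by (simp_all add: algebra_simps)
  thus ?thesis unfolding mem_dual_M by (metis Ints_of_int)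
qed

lemma dual_M_boost_step: "v \<in> dual_M m \<Longrightarrow> boost step *v v \<in> dual_M m"
proof -
  assume v: "v \<in> dual_M m"
  define X Y where "X = 2 * (real m + 2) * v $ 1" and "Y = 2 * real m * v $ 2"
  have XY: "X \<in> \<int>" "Y \<in> \<int>" using v by (auto simp: mem_dual_M X_def Y_def)
  have "2 * (real m + 2) * (boost step *v v) $ 1 = (real m + 1) * X + (real m + 2) * Y"
    "2 * real m * (boost step *v v) $ 2 = real m * X + (real m + 1) * Y"
    unfolding boost_step_apply X_def Y_def by (simp_all add: algebra_simps)
  thus ?thesis unfolding mem_dual_M using XY by (auto intro!: Ints_add Ints_mult)
qed

text \<open>Move the vector into the fundamental domain by a power of the generator and a flip. Even powers lie
  in \<open>G\<^sub>0\<close> and do not change cosets of the lattice, so the coset of the image depends only on the flip and on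
  the parity of the exponent.\<close>

lemma orbit_rep_exists:
  assumes v: "v \<in> lattice_L corner" "v \<in> U_plus m"
  obtains s k n g where "(s, k, n) \<in> cone_indices" "g \<in> group_G0 m" "v = g *v orbit_rep s k n"
proof -
  have mB: "real m * B = of_int j / 2" using B_j by simp
  have mA: "real m * A = of_int J / 2 - 2 * A" using A_J by (simp add: algebra_simps)
  obtain d where d: "J - j = 2 * d + 1" using parity by (elim oddE)
  have J: "real_of_int J = of_int j + 2 * of_int d + 1"
  proof -
    have "real_of_int (J - j) = of_int (2 * d + 1)" using d by (simp only:)
    thus ?thesis by simp
  qed
  obtain u h k where u: "u \<in> fund_domain" and h: "h \<in> flips" and uk: "h *v u = boost (of_int k * step) *v v"
  proof (cases "v $ 1 > 0")
    case True
    obtain k where k: "boost (of_int k * step) *v v \<in> wedge" using wedge_exists[OF v(2) True] .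
    obtain h where h: "h \<in> flips" "h *v (boost (of_int k * step) *v v) \<in> fund_domain"
      using wedge_unfold[OF k] .
    thus ?thesis by (intro that[of _ h k]) auto
  next
    case False
    hence "(zeta *v v) $ 1 > 0" using U_plus_fst_nonzero[OF v(2)] by simp
    then obtain k where k: "boost (of_int k * step) *v (zeta *v v) \<in> wedge"
      using wedge_exists[of "zeta *v v"] v(2) by auto
    obtain h where h: "h \<in> flips" "h *v (boost (of_int k * step) *v (zeta *v v)) \<in> fund_domain"
      using wedge_unfold[OF k] .
    have e: "boost (of_int k * step) *v (zeta *v v) = zeta *v (boost (of_int (- k) * step) *v v)"
      by (simp add: boost_zeta)
    show ?thesis
    proof (cases "h = mat 1")
      case True
      thus ?thesis using h(2) unfolding e by (intro that[of _ zeta "- k"]) (auto simp: flips_def)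
    next
      case False
      hence "h = zeta" using h(1) by (simp add: flips_def)
      thus ?thesis using h(2) unfolding e by (intro that[of _ "mat 1" "- k"]) (auto simp: flips_def)
    qed
  qed
  define l where "l = k div 2"
  define e :: int where "e = of_bool (odd k)"
  have k: "k = 2 * l + e" by (simp add: l_def e_def)
  define w where "w = boost (of_int e * step) *v v"
  have w_dual: "w \<in> dual_M m"
    using lattice_L_dual[OF v(1)] dual_M_boost_step by (simp add: w_def e_def)
  have "h *v u = boost (of_int (2 * l) * step) *v w"
    unfolding uk w_def boost_boost k by (simp add: algebra_simps)
  hence "h *v u - w \<in> lattice_M" using boost_even_dual[OF w_dual, of l] by simp
  then obtain a b :: int where ab: "(h *v u) $ 1 = w $ 1 + of_int a" "(h *v u) $ 2 = w $ 2 + of_int b"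
    unfolding mem_lattice_M vector_minus_component by (metis Ints_cases diff_add_cancel add.commute)
  obtain a0 b0 :: int where v0: "v $ 1 = A + of_int a0" "v $ 2 = B + of_int b0"
    using v(1) unfolding mem_lattice_L corner_simps by (metis Ints_cases diff_add_cancel add.commute)
  obtain s k' n where pt: "u = pt s k' n" and par: "odd n = odd k" "h = (if s = odd n then mat 1 else zeta)"
  proof (cases "even k")
    case True
    hence wv: "w = v" by (simp add: w_def e_def)
    show ?thesis
    proof (cases "h = mat 1")
      case h1: True
      have ue: "u = pt False (a0 + a - b0 - b) (2 * (b0 + b))"
        using ab v0 by (simp add: vec2_eq_iff wv h1 field_simps)
      show ?thesis by (rule that[OF ue]) (use True h1 in auto)
    next
      case False
      hence hz: "h = zeta" using h by (simp add: flips_def)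
      have ue: "u = pt True (- a0 - a - b0 - b) (2 * (b0 + b))"
        using ab v0 by (simp add: vec2_eq_iff wv hz field_simps)
      show ?thesis by (rule that[OF ue]) (use True hz in auto)
    qed
  next
    case False
    hence we: "w = boost step *v v" by (simp add: w_def e_def)
    define a1 where "a1 = (int m + 1) * a0 + int m * b0 + j + d"
    define b1 where "b1 = (int m + 2) * a0 + (int m + 1) * b0 + j + d"
    have w1: "w $ 1 = - A + 1 / 2 + of_int a1" "w $ 2 = B + 1 / 2 + of_int b1"
      using mA mB J unfolding we boost_step_apply v0 a1_def b1_def
      by (simp_all add: algebra_simps)
    show ?thesis
    proof (cases "h = mat 1")
      case h1: True
      have ue: "u = pt True (a1 + a - b1 - b) (2 * (b1 + b) + 1)"
        using ab w1 by (simp add: vec2_eq_iff h1 field_simps)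
      show ?thesis by (rule that[OF ue]) (use False h1 in auto)
    next
      case hn: False
      hence hz: "h = zeta" using h by (simp add: flips_def)
      have ue: "u = pt False (- 1 - a1 - a - b1 - b) (2 * (b1 + b) + 1)"
        using ab w1 by (simp add: vec2_eq_iff hz field_simps)
      show ?thesis by (rule that[OF ue]) (use False hz in auto)
    qed
  qed
  have rep: "orbit_rep s k' n = boost (of_int e * step) *v (h *v u)"
    unfolding orbit_rep_def pt[symmetric] par(2)[symmetric] by (simp add: par(1) e_def)
  have "v = boost (of_int (2 * (- l - e)) * step) *v orbit_rep s k' n"
    unfolding rep uk boost_boost k by (simp add: algebra_simps)
  moreover have "(s, k', n) \<in> cone_indices" using u pt pt_in_fund_domain by metis
  ultimately show ?thesis using that boost_in_group_G0 by blast
qed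

text \<open>Closure under differences of boost parameters makes the orbits of \<open>G\<^sub>0\<close> disjoint or equal.\<close>

lemma group_G0_boost_diff:
  assumes "boost s \<in> group_G0 m" "boost r \<in> group_G0 m"
  shows "boost (s - r) \<in> group_G0 m"
proof -
  have G: "boost s \<in> group_G m" "boost r \<in> group_G m" using assms by (auto simp: group_G0_def)
  have "boost (s - r) *v v - v \<in> lattice_M" if v: "v \<in> dual_M m" for v
  proof -
    have "boost s *v v - v \<in> lattice_M" "boost r *v v - v \<in> lattice_M"
      using assms v by (auto simp: group_G0_def)
    hence "(boost s *v v - v) - (boost r *v v - v) \<in> lattice_M" by (rule lattice_M_diff)
    hence "boost (- r) *v ((boost s *v v - v) - (boost r *v v - v)) \<in> lattice_M"
      using group_G_boost_minus[OF G(2)] unfolding group_G_def by blast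
    thus ?thesis by (simp add: matrix_vector_mult_diff_distrib boost_boost)
  qed
  thus ?thesis using group_G_boost_diff[OF G] by (simp add: group_G0_def)
qed

definition orbit :: "real^2 \<Rightarrow> (real^2) set" where
  "orbit v = (\<lambda>g. g *v v) ` group_G0 m"

lemma orbit_self: "v \<in> orbit v"
  using boost_in_group_G0[of 0] unfolding orbit_def by (auto simp: image_iff intro!: bexI[of _ "mat 1"])

lemma group_G0_boostE:
  assumes "g \<in> group_G0 m" obtains r where "g = boost r" "boost r \<in> group_G0 m"
proof -
  have "g \<in> group_G m" using assms by (simp add: group_G0_def)
  then obtain r where "g = boost r" by (rule group_G_boostE)
  thus ?thesis using that assms by simp
qed

lemma orbit_shift:
  assumes "g \<in> group_G0 m" shows "orbit (g *v v) = orbit v"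
proof -
  obtain r where r: "g = boost r" "boost r \<in> group_G0 m" using assms by (rule group_G0_boostE)
  have "boost 0 \<in> group_G0 m" using boost_in_group_G0[of 0] by simp
  hence r': "boost (- r) \<in> group_G0 m" using group_G0_boost_diff[of 0 r] r(2) by simp
  have sub: "orbit (boost r *v v) \<subseteq> orbit v" if r: "boost (- r) \<in> group_G0 m" for r v
  proof
    fix x assume "x \<in> orbit (boost r *v v)"
    then obtain g where g: "g \<in> group_G0 m" "x = g *v (boost r *v v)" unfolding orbit_def by (elim imageE)
    obtain s where s: "g = boost s" "boost s \<in> group_G0 m" using g(1) by (rule group_G0_boostE)
    have "boost (s - (- r)) \<in> group_G0 m" by (rule group_G0_boost_diff[OF s(2) r])
    moreover have "x = boost (s - (- r)) *v v" unfolding g(2) s(1) boost_boost by simp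
    ultimately show "x \<in> orbit v" unfolding orbit_def by (intro image_eqI)
  qed
  have "boost (- (- r)) \<in> group_G0 m" using r(2) by simp
  from sub[OF this, of "boost r *v v"] have "orbit v \<subseteq> orbit (boost r *v v)" by (simp add: boost_boost)
  from equalityI[OF sub[OF r', of v] this] show ?thesis unfolding r(1) .
qed

lemma bij_betw_cone_orbits:
  "bij_betw (\<lambda>(s, k, n). orbit (orbit_rep s k n)) cone_indices (G0_orbits m (lattice_L corner \<inter> U_plus m))"
  unfolding bij_betw_def
proof
  show "inj_on (\<lambda>(s, k, n). orbit (orbit_rep s k n)) cone_indices"
  proof (rule inj_onI)
    fix p p' :: "bool \<times> int \<times> int"
    obtain s k n where p: "p = (s, k, n)" by (rule prod_cases3)
    obtain s' k' n' where p': "p' = (s', k', n')" by (rule prod_cases3)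
    assume "p \<in> cone_indices" "p' \<in> cone_indices"
      "(case p of (s, k, n) \<Rightarrow> orbit (orbit_rep s k n)) = (case p' of (s, k, n) \<Rightarrow> orbit (orbit_rep s k n))"
    hence i: "(s, k, n) \<in> cone_indices" "(s', k', n') \<in> cone_indices"
      and "orbit (orbit_rep s k n) = orbit (orbit_rep s' k' n')" by (simp_all add: p p')
    then obtain g where g: "g \<in> group_G0 m" "orbit_rep s k n = g *v orbit_rep s' k' n'"
      using orbit_self[of "orbit_rep s k n"] by (auto simp: orbit_def)
    have "mat 1 \<in> group_G0 m" using boost_in_group_G0[of 0] by simp
    from orbit_rep_dagger(1)[OF i(1) this] orbit_rep_dagger(1)[OF i(2) g(1)] g(2)
    have "pt s k n = pt s' k' n'" by simp
    thus "p = p'" using pt_inj p p' by blast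
  qed
  show "(\<lambda>(s, k, n). orbit (orbit_rep s k n)) ` cone_indices = G0_orbits m (lattice_L corner \<inter> U_plus m)"
  proof (intro equalityI subsetI)
    fix X assume "X \<in> (\<lambda>(s, k, n). orbit (orbit_rep s k n)) ` cone_indices"
    then obtain s k n where i: "(s, k, n) \<in> cone_indices" "X = orbit (orbit_rep s k n)" by auto
    show "X \<in> G0_orbits m (lattice_L corner \<inter> U_plus m)"
      unfolding G0_orbits_def i(2) orbit_def by (rule imageI) (rule orbit_rep_mem[OF i(1)])
  next
    fix X assume "X \<in> G0_orbits m (lattice_L corner \<inter> U_plus m)"
    then obtain v where v: "v \<in> lattice_L corner" "v \<in> U_plus m" "X = orbit v"
      unfolding G0_orbits_def orbit_def by (elim imageE IntE)
    obtain s k n g where i: "(s, k, n) \<in> cone_indices" "g \<in> group_G0 m" "v = g *v orbit_rep s k n"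
      using orbit_rep_exists[OF v(1,2)] .
    have "X = orbit (orbit_rep s k n)" unfolding v(3) i(3) by (rule orbit_shift[OF i(2)])
    thus "X \<in> (\<lambda>(s, k, n). orbit (orbit_rep s k n)) ` cone_indices"
      using i(1) by (intro image_eqI[of _ _ "(s, k, n)"]) simp_all
  qed
qed

text \<open>The exponent \<open>(m + 2) x - m y - 1/2\<close> of \<open>z\<close> at the point with \<open>n = 0\<close>; it grows by one with \<open>n\<close>. The
  division is exact because \<open>J - j\<close> is odd.\<close>

definition coeff_index :: "bool \<Rightarrow> int \<Rightarrow> int" where
  "coeff_index s k = ((if s then - J else J) - j - 1) div 2 + (int m + 2) * k"

lemma coeff_index: "of_int (coeff_index s k) = (real m + 2) * ((if s then - A else A) + of_int k) - real m * B - 1 / 2"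
proof -
  have "even ((if s then - J else J) - j - 1)" using parity by auto
  then obtain i where i: "(if s then - J else J) - j - 1 = 2 * i" by blast
  have "real_of_int ((if s then - J else J) - j - 1) = of_int (2 * i)" using i by (simp only:)
  hence "(if s then - real_of_int J else of_int J) - of_int j - 1 = 2 * of_int i" by (cases s) simp_all
  moreover have "(real m + 2) * A = of_int J / 2" "real m * B = of_int j / 2" using A_J B_j by (simp_all add: field_simps)
  ultimately show ?thesis unfolding coeff_index_def i by (cases s) (simp_all add: field_simps)
qed

definition cone_term :: "complex \<Rightarrow> complex \<Rightarrow> bool \<Rightarrow> int \<Rightarrow> int \<Rightarrow> complex" where
  "cone_term \<tau> t s k n = (if n \<ge> 0 then 1 else - 1) * (if s then - 1 else 1) * (- t) powi n *
     exp (of_real pi * \<i> * \<tau> * of_real (qform m (pt s k n)))"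

text \<open>The sign of the lattice point combines the sign of the first coordinate of \<open>pt s k n\<close> with the sign
  \<open>\<plusminus>(- 1)\<^sup>n\<close> coming from the flip.\<close>

lemma theta_term_orbit_rep:
  assumes i: "(s, k, n) \<in> cone_indices" and g: "g \<in> group_G0 m" and "t \<noteq> 0" "z \<noteq> 0"
  shows "theta_term m corner \<tau> t z (g *v orbit_rep s k n) = cone_term \<tau> t s k n * z powi (coeff_index s k + n)"
proof -
  have u: "pt s k n \<in> fund_domain" using i by (simp add: pt_in_fund_domain)
  have sg: "sign (pt s k n) = (if n \<ge> 0 then 1 else - 1)"
  proof (cases "n \<ge> 0")
    case True
    hence "pt s k n $ 2 \<ge> 0" using AB_bounds by simp
    thus ?thesis using u True unfolding fund_domain_def sign_def by auto
  next
    case False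
    hence "real_of_int n \<le> -1" by linarith
    hence "pt s k n $ 2 < 0" using AB_bounds by simp
    thus ?thesis using u False unfolding fund_domain_def sign_def by auto
  qed
  have tn: "2 * (pt s k n $ 2 - B) = of_int n" by simp
  have zn: "(real m + 2) * pt s k n $ 1 - real m * pt s k n $ 2 - 1 / 2 = of_int (coeff_index s k + n)"
    by (simp add: coeff_index algebra_simps)
  have eps: "of_int (if s = odd n then 1 else - 1) * t powi n = (if s then - 1 else 1) * (- t) powi n"
    by (cases s; cases "even n") (simp_all add: power_int_minus_left)
  have powr: "t powr of_int n = t powi n" "z powr of_int (coeff_index s k + n) = z powi (coeff_index s k + n)"
    using assms(3,4) by (simp_all only: complex_powr_of_int simp_thms)
  show ?thesis
    unfolding theta_term_def orbit_rep_dagger[OF i g] corner_simps tn zn cone_term_def sg of_real_of_int_eq powr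
    using eps by (simp add: mult_ac)
qed

lemma Theta_L_eq:
  assumes "t \<noteq> 0" "z \<noteq> 0"
  shows "Theta_L m corner \<tau> t z = (\<Sum>\<^sub>\<infinity>(s, k, n)\<in>cone_indices. cone_term \<tau> t s k n * z powi (coeff_index s k + n))"
proof -
  have "Theta_L m corner \<tau> t z = (\<Sum>\<^sub>\<infinity>p\<in>cone_indices.
      theta_term m corner \<tau> t z (SOME v. v \<in> (case p of (s, k, n) \<Rightarrow> orbit (orbit_rep s k n))))"
    unfolding Theta_L_def by (rule infsum_reindex_bij_betw[OF bij_betw_cone_orbits, symmetric])
  also have "\<dots> = (\<Sum>\<^sub>\<infinity>(s, k, n)\<in>cone_indices. cone_term \<tau> t s k n * z powi (coeff_index s k + n))"
  proof (rule infsum_cong, clarify)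
    fix s k n assume i: "(s, k, n) \<in> cone_indices"
    have "(SOME v. v \<in> orbit (orbit_rep s k n)) \<in> orbit (orbit_rep s k n)" using orbit_self by (rule someI)
    then obtain g where "g \<in> group_G0 m" "(SOME v. v \<in> orbit (orbit_rep s k n)) = g *v orbit_rep s k n"
      by (auto simp: orbit_def)
    thus "theta_term m corner \<tau> t z (SOME v. v \<in> orbit (orbit_rep s k n)) =
        cone_term \<tau> t s k n * z powi (coeff_index s k + n)"
      using theta_term_orbit_rep[OF i _ assms] by simp
  qed
  finally show ?thesis .
qed

end

section \<open>Expansion of the coefficients\<close>

lemma minus_square_plus_abs_le:
  fixes x :: real
  assumes "\<alpha> > 0" shows "- \<alpha> * x\<^sup>2 + b * \<bar>x\<bar> \<le> b\<^sup>2 / (4 * \<alpha>)"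
proof -
  have "0 \<le> (2 * \<alpha> * \<bar>x\<bar> - b)\<^sup>2" by simp
  hence "4 * \<alpha> * (b * \<bar>x\<bar>) \<le> 4 * \<alpha> * (\<alpha> * x\<^sup>2) + b\<^sup>2" by (simp add: power2_eq_square algebra_simps)
  hence "(- \<alpha> * x\<^sup>2 + b * \<bar>x\<bar>) * (4 * \<alpha>) \<le> b\<^sup>2" by (simp add: algebra_simps)
  thus ?thesis using assms by (simp only: pos_le_divide_eq zero_less_mult_iff zero_less_numeral simp_thms)
qed

lemma summable_exp_minus_abs: "(\<lambda>k::int. exp (- \<bar>real_of_int k\<bar>)) summable_on UNIV"
proof -
  have geo: "(\<lambda>n::nat. exp (- real n)) summable_on UNIV"
  proof (rule norm_summable_imp_summable_on)
    have "summable (\<lambda>n. exp (- 1 :: real) ^ n)" by (rule summable_geometric) simp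
    thus "summable (\<lambda>n. norm (exp (- real n)))" by (simp add: exp_of_nat_mult[symmetric])
  qed
  have "(\<lambda>k. exp (- \<bar>real_of_int k\<bar>)) summable_on range int"
    by (subst summable_on_reindex) (use geo in \<open>auto simp: o_def inj_def\<close>)
  moreover have "(\<lambda>k. exp (- \<bar>real_of_int k\<bar>)) summable_on range (\<lambda>n. - int n)"
    by (subst summable_on_reindex) (use geo in \<open>auto simp: o_def inj_def\<close>)
  ultimately have "(\<lambda>k. exp (- \<bar>real_of_int k\<bar>)) summable_on (range int \<union> range (\<lambda>n. - int n))"
    by (rule summable_on_union)
  moreover have "range int \<union> range (\<lambda>n. - int n) = UNIV"
  proof (intro equalityI subsetI)
    fix k :: int show "k \<in> range int \<union> range (\<lambda>n. - int n)" by (cases k rule: int_cases2) auto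
  qed simp
  ultimately show ?thesis by simp
qed

lemma summable_gaussian:
  assumes "\<alpha> > 0"
  shows "(\<lambda>k::int. exp (- \<alpha> * (of_int k)\<^sup>2 + b * \<bar>real_of_int k\<bar>)) summable_on UNIV"
proof (rule summable_on_comparison_test[OF summable_on_cmult_right[OF summable_exp_minus_abs]])
  show "exp (- \<alpha> * (of_int k)\<^sup>2 + b * \<bar>real_of_int k\<bar>) \<le> exp ((b + 1)\<^sup>2 / (4 * \<alpha>)) * exp (- \<bar>real_of_int k\<bar>)" for k :: int
    using minus_square_plus_abs_le[OF assms, of "of_int k" "b + 1"]
    by (simp add: algebra_simps flip: exp_add)
qed auto

lemma norm_power_int_exp: "x \<noteq> 0 \<Longrightarrow> norm (x powi k) = exp (of_int k * ln (norm x))"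
  for x :: complex
  by (simp add: norm_power_int flip: exp_power_int)

text \<open>\<open>E r\<close> stands for \<open>q\<^sup>r\<close>, with the branch fixed by \<open>\<tau>\<close> for fractional \<open>r\<close>.\<close>

locale modular_nome = nome +
  fixes \<tau> :: complex
  assumes q_eq: "q = exp (2 * of_real pi * \<i> * \<tau>)"
begin

definition E :: "real \<Rightarrow> complex" where "E r = exp (2 * of_real pi * \<i> * \<tau> * of_real r)"

lemma E_add: "E (r + s) = E r * E s"
  by (simp add: E_def algebra_simps flip: exp_add)

lemma E_of_int: "E (of_int k) = q powi k"
  by (simp add: E_def q_eq exp_power_int mult.commute)

definition decay :: real where "decay = pi * Im \<tau>"

lemma norm_E: "norm (E r) = exp (- 2 * decay * r)"
  by (simp add: E_def decay_def)

lemma decay_pos: "decay > 0"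
proof -
  have "norm q = exp (- 2 * decay)" using norm_E[of 1] E_of_int[of 1] by simp
  thus ?thesis using q_less by simp
qed

lemma eta_deformed_eq: "eta_deformed \<tau> t z = E (- 1 / 8) * prodinf (eta_factor z)"
proof -
  have "exp (2 * of_real pi * \<i> * of_nat (Suc k) * \<tau>) = q ^ Suc k" for k
    unfolding q_eq exp_of_nat_mult[symmetric] by (simp add: mult_ac)
  thus ?thesis unfolding eta_deformed_def eta_factor_def[abs_def] Let_def E_def by (simp add: mult_ac)
qed

definition expansion_coeff :: "int \<Rightarrow> int \<Rightarrow> complex" where
  "expansion_coeff a n = (- t) powi n * E (of_int n * of_int a + of_int n * (of_int n + 1) / 2)"

lemma expansion_coeff_step: "expansion_coeff a (n + 1) = - t * q powi (a + n + 1) * expansion_coeff a n"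
proof -
  have "real_of_int (n + 1) * of_int a + of_int (n + 1) * (of_int (n + 1) + 1) / 2 =
      (of_int n * of_int a + of_int n * (of_int n + 1) / 2) + of_int (a + n + 1)"
    by (simp add: field_simps)
  thus ?thesis unfolding expansion_coeff_def
    by (simp only: E_add E_of_int) (simp add: power_int_add)
qed

lemma expansion_telescope:
  "expansion_coeff a n * poisson_coeff (a + n) =
    expansion_coeff a n * string_coeff (a + n) - expansion_coeff a (n + 1) * string_coeff (a + (n + 1))"
  unfolding expansion_coeff_step poisson_coeff_eq by (simp add: algebra_simps)

lemma expansion_coeff_bound:
  "norm (expansion_coeff a n) \<le> exp (- decay * (of_int n)\<^sup>2 + \<bar>- ln (norm t) + 2 * decay * a + decay\<bar> * \<bar>real_of_int n\<bar>)"
proof -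
  let ?b = "- ln (norm t) + 2 * decay * a + decay"
  have "norm ((- t) powi n) = exp (of_int n * ln (norm t))"
    using norm_power_int_exp[of "- t" n] by simp
  hence "norm (expansion_coeff a n) = exp (- decay * (of_int n)\<^sup>2 - of_int n * ?b)"
    unfolding expansion_coeff_def norm_mult norm_E
    by (simp add: power2_eq_square field_simps flip: exp_add)
  also have "\<dots> \<le> exp (- decay * (of_int n)\<^sup>2 + \<bar>?b\<bar> * \<bar>real_of_int n\<bar>)"
    using abs_ge_minus_self[of "of_int n * ?b"] by (simp add: abs_mult mult.commute)
  finally show ?thesis .
qed

lemma norm_poisson_coeff_le: "norm (poisson_coeff a) \<le> 2 * coeff_bound"
proof -
  have "norm (poisson_coeff a) \<le> norm (string_coeff a) + norm t * norm (string_coeff (- a - 1))"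
    unfolding poisson_coeff_def norm_mult[symmetric] by (rule norm_triangle_ineq)
  also have "\<dots> \<le> coeff_bound + 1 * coeff_bound"
    by (intro add_mono mult_mono norm_string_coeff_le) (use t_less in auto)
  finally show ?thesis by simp
qed

lemma summable_expansion:
  assumes "\<And>k. norm (c k) \<le> C"
  shows "(\<lambda>n. norm (expansion_coeff a n * c n)) summable_on UNIV"
proof (rule Infinite_Sum.abs_summable_on_comparison_test')
  let ?b = "\<bar>- ln (norm t) + 2 * decay * a + decay\<bar>"
  show "(\<lambda>n::int. exp (- decay * (of_int n)\<^sup>2 + ?b * \<bar>real_of_int n\<bar>) * C) summable_on UNIV"
    by (intro summable_on_cmult_left summable_gaussian decay_pos)
  show "norm (expansion_coeff a n * c n) \<le> exp (- decay * (of_int n)\<^sup>2 + ?b * \<bar>real_of_int n\<bar>) * C" for n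
    unfolding norm_mult by (intro mult_mono expansion_coeff_bound assms) auto
qed

text \<open>The terms telescope (\<open>expansion_telescope\<close>), and the boundary terms vanish in both directions, since the
  coefficients are bounded and \<open>expansion_coeff\<close> decays like a Gaussian in \<open>n\<close>.\<close>

lemma string_coeff_expansion:
  shows "((\<lambda>n. expansion_coeff a n * poisson_coeff (a + n)) has_sum string_coeff a) {0..}"
    and "((\<lambda>n. expansion_coeff a n * poisson_coeff (a + n)) has_sum - string_coeff a) {..<0}"
proof -
  define f where "f n = expansion_coeff a n * string_coeff (a + n)" for n
  define h where "h n = expansion_coeff a n * poisson_coeff (a + n)" for n
  have tele: "h n = f n - f (n + 1)" for n unfolding h_def f_def by (rule expansion_telescope)
  have f0: "f 0 = string_coeff a" using E_of_int[of 0] by (simp add: f_def expansion_coeff_def)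
  have sf: "(\<lambda>n. norm (f n)) summable_on UNIV" unfolding f_def by (rule summable_expansion[OF norm_string_coeff_le])
  have sh: "(\<lambda>n. norm (h n)) summable_on UNIV" unfolding h_def by (rule summable_expansion[OF norm_poisson_coeff_le])
  have nat: "summable (\<lambda>n::nat. norm (c (i n)))"
    if "inj i" "(\<lambda>n. norm (c n)) summable_on UNIV" for c :: "int \<Rightarrow> complex" and i :: "nat \<Rightarrow> int"
  proof -
    have "(\<lambda>n. norm (c n)) summable_on range i" by (rule summable_on_subset_banach[OF that(2)]) auto
    thus ?thesis by (subst (asm) summable_on_reindex[OF that(1)]) (auto simp: o_def intro: summable_on_imp_summable)
  qed
  have inj: "inj int" "inj (\<lambda>n. - int n)" "inj (\<lambda>n. - 1 - int n)" by (auto simp: inj_def)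
  have lim: "(\<lambda>n. f (int n)) \<longlonglongrightarrow> 0" "(\<lambda>n. f (- int n)) \<longlonglongrightarrow> 0"
    using summable_LIMSEQ_zero[OF nat[OF inj(1) sf]] summable_LIMSEQ_zero[OF nat[OF inj(2) sf]]
    by (auto intro: tendsto_norm_zero_cancel)
  have "(\<lambda>n. h (int n)) sums (f (int 0) - 0)"
    using telescope_sums'[OF lim(1)] by (simp add: tele add.commute)
  hence "((\<lambda>n. h (int n)) has_sum string_coeff a) UNIV"
    by (intro norm_summable_imp_has_sum nat[OF inj(1) sh]) (simp add: f0)
  also have "?this \<longleftrightarrow> (h has_sum string_coeff a) {0..}"
    by (rule has_sum_reindex_bij_witness[where i = nat and j = int]) auto
  finally show "((\<lambda>n. expansion_coeff a n * poisson_coeff (a + n)) has_sum string_coeff a) {0..}"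
    by (simp add: h_def[abs_def])
  have "(\<lambda>n. h (- 1 - int n)) sums (0 - f (- int 0))"
    using telescope_sums[OF lim(2)] by (simp add: tele)
  hence "((\<lambda>n. h (- 1 - int n)) has_sum - string_coeff a) UNIV"
    by (intro norm_summable_imp_has_sum nat[OF inj(3) sh]) (simp add: f0)
  also have "?this \<longleftrightarrow> (h has_sum - string_coeff a) {..<0}"
    by (rule has_sum_reindex_bij_witness[where i = "\<lambda>k. nat (- k - 1)" and j = "\<lambda>n. - 1 - int n"]) auto
  finally show "((\<lambda>n. expansion_coeff a n * poisson_coeff (a + n)) has_sum - string_coeff a) {..<0}"
    by (simp add: h_def[abs_def])
qed

text \<open>The contribution of one element of the Weyl group to the string function. The parameters are
  arbitrary because both \<open>(J, j)\<close> and its mirror image \<open>(m + 2 - J, m - j)\<close> occur.\<close>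

definition string_term :: "nat \<Rightarrow> int \<Rightarrow> int \<Rightarrow> bool \<times> int \<Rightarrow> complex" where
  "string_term m J j = (\<lambda>(s, k). (if s then - 1 else 1) *
     E ((real m + 2) * ((if s then - of_int J else of_int J) / (2 * (real m + 2)) + of_int k)\<^sup>2
        - real m * (of_int j / (2 * real m))\<^sup>2 - 1 / 8) *
     string_coeff (((if s then - J else J) - j - 1) div 2 + (int m + 2) * k))"

end

section \<open>The constant term of the product\<close>

locale theta_data = hecke_coset m J j + modular_nome t q \<tau>
  for m :: nat and J j :: int and t q \<tau> :: complex
begin

lemma quad_pt:
  "qform m (pt s k n) / 2 = qform m (pt s k 0) / 2 + (of_int n * of_int (coeff_index s k) + of_int n * (of_int n + 1) / 2)"
  by (simp add: qform_def coeff_index power2_eq_square field_simps)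

lemma exp_qform: "exp (of_real pi * \<i> * \<tau> * of_real (qform m v)) = E (qform m v / 2)"
  by (simp add: E_def mult_ac)

lemma cone_term_eq: "cone_term \<tau> t s k n =
    (if n \<ge> 0 then 1 else - 1) * (if s then - 1 else 1) * E (qform m (pt s k 0) / 2) * expansion_coeff (coeff_index s k) n"
  unfolding cone_term_def exp_qform quad_pt[of s k n] E_add expansion_coeff_def by simp

lemma string_term_eq: "string_term m J j (s, k) =
    (if s then - 1 else 1) * E (qform m (pt s k 0) / 2 - 1 / 8) * string_coeff (coeff_index s k)"
proof -
  have e: "(if s then - real_of_int J else of_int J) / (2 * (real m + 2)) = (if s then - A else A)"
    by (simp add: A_def)
  have q: "qform m (pt s k 0) / 2 = (real m + 2) * ((if s then - A else A) + of_int k)\<^sup>2 - real m * B\<^sup>2"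
    by (simp add: qform_def)
  show ?thesis unfolding string_term_def prod.case e q coeff_index_def B_def by (rule refl)
qed

text \<open>On the cone \<open>|y| \<le> |x|\<close> the form satisfies \<open>N(x, y) / 2 \<ge> x\<^sup>2 + y\<^sup>2\<close>, and this Gaussian decay
  dominates the powers of \<open>t\<close> and \<open>z\<close>, whose exponents are linear in \<open>x\<close> and \<open>y\<close>.\<close>

lemma cone_term_bound:
  assumes z: "z \<noteq> 0"
  obtains C where "\<And>s k n. (s, k, n) \<in> cone_indices \<Longrightarrow>
    norm (cone_term \<tau> t s k n * z powi (coeff_index s k + n)) \<le> C * (exp (- \<bar>real_of_int k\<bar>) * exp (- \<bar>real_of_int n\<bar>))"
proof -
  define u where "u = ln (norm t)"
  define \<zeta> where "\<zeta> = ln (norm z)"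
  define b1 where "b1 = \<bar>\<zeta>\<bar> * (real m + 2)"
  define b2 where "b2 = 2 * \<bar>u\<bar> + \<bar>\<zeta>\<bar> * real m"
  \<comment> \<open>The summands \<open>1\<close>, \<open>3\<close> and \<open>4\<close> make room for \<open>|k| + |n| \<le> |x| + 3 |y| + 4\<close>.\<close>
  define C where "C = exp ((b1 + 1)\<^sup>2 / (8 * decay) + (b2 + 3)\<^sup>2 / (8 * decay) + (2 * \<bar>u\<bar> + \<bar>\<zeta>\<bar> + 4))"
  show ?thesis
  proof (rule that[of C])
    fix s k n assume i: "(s, k, n) \<in> cone_indices"
    define x y where "x = pt s k n $ 1" and "y = pt s k n $ 2"
    have xy: "\<bar>y\<bar> \<le> \<bar>x\<bar>" using i unfolding pt_in_fund_domain[symmetric] by (auto simp: fund_domain_def x_def y_def)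
    have n: "of_int n = 2 * (y - B)" by (simp add: y_def)
    have k: "of_int k = x - y + B - (if s then - A else A)" by (simp add: x_def y_def)
    have p: "real_of_int (coeff_index s k + n) = (real m + 2) * x - real m * y - 1 / 2"
      by (simp add: coeff_index x_def y_def algebra_simps)
    have "y\<^sup>2 \<le> x\<^sup>2" using xy by (simp add: abs_le_square_iff)
    hence "real m * y\<^sup>2 \<le> real m * x\<^sup>2" by (intro mult_left_mono) auto
    hence quad: "x\<^sup>2 + y\<^sup>2 \<le> qform m (pt s k n) / 2"
      using \<open>y\<^sup>2 \<le> x\<^sup>2\<close> unfolding qform_def x_def[symmetric] y_def[symmetric] by (simp add: algebra_simps)
    have nt: "norm ((- t) powi n) = exp (of_int n * u)"
      using norm_power_int_exp[of "- t" n] by (simp add: u_def)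
    have nz: "norm (z powi (coeff_index s k + n)) = exp (of_int (coeff_index s k + n) * \<zeta>)"
      unfolding \<zeta>_def by (rule norm_power_int_exp[OF z])
    have "norm (cone_term \<tau> t s k n * z powi (coeff_index s k + n)) =
        exp (of_int n * u) * exp (- 2 * decay * (qform m (pt s k n) / 2)) * exp (of_int (coeff_index s k + n) * \<zeta>)"
      unfolding cone_term_def exp_qform norm_mult nt nz norm_E by simp
    also have "\<dots> = exp (of_int n * u - 2 * decay * (qform m (pt s k n) / 2) + of_int (coeff_index s k + n) * \<zeta>)"
      unfolding exp_add[symmetric] by (rule arg_cong[of _ _ exp]) simp
    also have "\<dots> \<le> C * (exp (- \<bar>real_of_int k\<bar>) * exp (- \<bar>real_of_int n\<bar>))"
    proof -
      have 1: "of_int n * u \<le> 2 * \<bar>u\<bar> * \<bar>y\<bar> + 2 * \<bar>u\<bar>"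
      proof -
        have "of_int n * u \<le> \<bar>of_int n\<bar> * \<bar>u\<bar>" by (metis abs_ge_self abs_mult)
        also have "\<dots> \<le> (2 * \<bar>y\<bar> + 2) * \<bar>u\<bar>" unfolding n using AB_bounds by (intro mult_right_mono) auto
        finally show ?thesis by (simp add: algebra_simps)
      qed
      have 2: "of_int (coeff_index s k + n) * \<zeta> \<le> b1 * \<bar>x\<bar> + \<bar>\<zeta>\<bar> * real m * \<bar>y\<bar> + \<bar>\<zeta>\<bar>"
      proof -
        have "of_int (coeff_index s k + n) * \<zeta> \<le> \<bar>of_int (coeff_index s k + n)\<bar> * \<bar>\<zeta>\<bar>" by (metis abs_ge_self abs_mult)
        also have "\<dots> \<le> ((real m + 2) * \<bar>x\<bar> + real m * \<bar>y\<bar> + 1) * \<bar>\<zeta>\<bar>"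
        proof (rule mult_right_mono)
          have "\<bar>(real m + 2) * x\<bar> = (real m + 2) * \<bar>x\<bar>" "\<bar>real m * y\<bar> = real m * \<bar>y\<bar>" by (simp_all add: abs_mult)
          thus "\<bar>of_int (coeff_index s k + n)\<bar> \<le> (real m + 2) * \<bar>x\<bar> + real m * \<bar>y\<bar> + 1" unfolding p by linarith
        qed simp
        finally show ?thesis by (simp add: b1_def algebra_simps)
      qed
      have 3: "- 2 * decay * (qform m (pt s k n) / 2) \<le> - (2 * decay) * x\<^sup>2 + - (2 * decay) * y\<^sup>2"
        using mult_left_mono[OF quad, of "2 * decay"] decay_pos by (simp add: algebra_simps)
      have 4: "- (2 * decay) * x\<^sup>2 + (b1 + 1) * \<bar>x\<bar> \<le> (b1 + 1)\<^sup>2 / (8 * decay)"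
        "- (2 * decay) * y\<^sup>2 + (b2 + 3) * \<bar>y\<bar> \<le> (b2 + 3)\<^sup>2 / (8 * decay)"
        using minus_square_plus_abs_le[of "2 * decay"] decay_pos by (auto simp: mult.assoc)
      have 5: "\<bar>real_of_int k\<bar> + \<bar>real_of_int n\<bar> \<le> \<bar>x\<bar> + 3 * \<bar>y\<bar> + 4"
        unfolding k n using AB_bounds by (cases s) auto
      have "of_int n * u - 2 * decay * (qform m (pt s k n) / 2) + of_int (coeff_index s k + n) * \<zeta> \<le>
          ((b1 + 1)\<^sup>2 / (8 * decay) + (b2 + 3)\<^sup>2 / (8 * decay) + (2 * \<bar>u\<bar> + \<bar>\<zeta>\<bar> + 4)) + (- \<bar>real_of_int k\<bar> + - \<bar>real_of_int n\<bar>)"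
        using 1 2 3 4 5 by (simp add: b2_def algebra_simps)
      thus ?thesis unfolding C_def exp_add[symmetric] by simp
    qed
    finally show "norm (cone_term \<tau> t s k n * z powi (coeff_index s k + n)) \<le>
        C * (exp (- \<bar>real_of_int k\<bar>) * exp (- \<bar>real_of_int n\<bar>))" .
  qed
qed

definition zexp :: "bool \<times> int \<times> int \<Rightarrow> int" where "zexp = (\<lambda>(s, k, n). coeff_index s k + n)"
definition cterm :: "bool \<times> int \<times> int \<Rightarrow> complex" where "cterm = (\<lambda>(s, k, n). cone_term \<tau> t s k n)"

lemma summable_cterm:
  assumes "z \<noteq> 0"
  shows "(\<lambda>p. norm (cterm p * z powi zexp p)) summable_on cone_indices"
proof -
  obtain C where C: "\<And>s k n. (s, k, n) \<in> cone_indices \<Longrightarrow>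
    norm (cone_term \<tau> t s k n * z powi (coeff_index s k + n)) \<le> C * (exp (- \<bar>real_of_int k\<bar>) * exp (- \<bar>real_of_int n\<bar>))"
    using cone_term_bound[OF assms] by blast
  let ?e = "\<lambda>k::int. exp (- \<bar>real_of_int k\<bar>)"
  have two: "(\<lambda>(k, n). ?e k * ?e n) summable_on UNIV \<times> UNIV"
    by (rule summable_on_product_nonneg[OF summable_exp_minus_abs summable_exp_minus_abs]) auto
  have "(\<lambda>(s::bool, p). 1 * (\<lambda>(k, n). ?e k * ?e n) p) summable_on UNIV \<times> (UNIV \<times> UNIV)"
    by (rule summable_on_product_nonneg[OF summable_on_finite two]) auto
  hence "(\<lambda>(s::bool, k, n). ?e k * ?e n) summable_on UNIV"
    by (simp add: case_prod_unfold)
  hence "(\<lambda>p. C * (\<lambda>(s::bool, k, n). ?e k * ?e n) p) summable_on UNIV" by (rule summable_on_cmult_right)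
  hence "(\<lambda>p. C * (\<lambda>(s::bool, k, n). ?e k * ?e n) p) summable_on cone_indices"
    by (rule summable_on_subset_banach) auto
  thus ?thesis
    by (rule Infinite_Sum.abs_summable_on_comparison_test') (use C in \<open>auto simp: cterm_def zexp_def\<close>)
qed

lemma summable_cterm_poisson: "(\<lambda>p. cterm p * E (- 1 / 8) * poisson_coeff (h p)) summable_on cone_indices"
proof (rule abs_summable_summable, rule Infinite_Sum.abs_summable_on_comparison_test')
  show "(\<lambda>p. norm (cterm p * 1 powi zexp p) * (norm (E (- 1 / 8)) * (2 * coeff_bound))) summable_on cone_indices"
    by (rule summable_on_cmult_left[OF summable_cterm]) simp
  show "norm (cterm p * E (- 1 / 8) * poisson_coeff (h p)) \<le>
      norm (cterm p * 1 powi zexp p) * (norm (E (- 1 / 8)) * (2 * coeff_bound))" for p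
    by (simp add: norm_mult mult.assoc mult_left_mono norm_poisson_coeff_le)
qed

definition laurent_coeff :: "int \<Rightarrow> complex" where
  "laurent_coeff N = (\<Sum>\<^sub>\<infinity>p\<in>cone_indices. cterm p * E (- 1 / 8) * poisson_coeff (N - zexp p))"

lemma laurent_series:
  "laurent_series_on_annulus (\<lambda>z. Theta_L m corner \<tau> t z * eta_deformed \<tau> t z * poisson_kernel t z)
     (norm t) (1 / norm t) laurent_coeff"
  unfolding laurent_series_on_annulus_def
proof (intro allI impI)
  fix z :: complex assume z: "norm t < norm z \<and> norm z < 1 / norm t"
  hence z0: "z \<noteq> 0" using t_pos by auto
  have "((\<lambda>p. cterm p * z powi zexp p) has_sum Theta_L m corner \<tau> t z) cone_indices"
    using abs_summable_summable[OF summable_cterm[OF z0]]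
    by (simp add: Theta_L_eq[OF t_nonzero z0] has_sum_iff cterm_def zexp_def case_prod_unfold)
  moreover have "((\<lambda>l. E (- 1 / 8) * (poisson_coeff l * z powi l)) has_sum
      (E (- 1 / 8) * (prodinf (eta_factor z) * poisson_kernel t z))) UNIV"
    by (rule has_sum_cmult_right[OF has_sum_poisson_coeff]) (use z in auto)
  moreover from this have "(\<lambda>l. norm (E (- 1 / 8) * (poisson_coeff l * z powi l))) summable_on UNIV"
    by (simp only: has_sum_imp_summable flip: summable_on_iff_abs_summable_on_complex)
  ultimately have "((\<lambda>(p, l). cterm p * z powi zexp p * (E (- 1 / 8) * (poisson_coeff l * z powi l))) has_sum
      (Theta_L m corner \<tau> t z * (E (- 1 / 8) * (prodinf (eta_factor z) * poisson_kernel t z)))) (cone_indices \<times> UNIV)"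
    by (intro has_sum_product summable_cterm[OF z0])
  also have "?this \<longleftrightarrow> ((\<lambda>(N, p). cterm p * E (- 1 / 8) * poisson_coeff (N - zexp p) * z powi N) has_sum
      (Theta_L m corner \<tau> t z * eta_deformed \<tau> t z * poisson_kernel t z)) (UNIV \<times> cone_indices)"
  proof (rule has_sum_reindex_bij_witness[where i = "\<lambda>(N, p). (p, N - zexp p)" and j = "\<lambda>(p, l). (l + zexp p, p)"])
    fix x :: "(bool \<times> int \<times> int) \<times> int"
    obtain p l where x: "x = (p, l)" by fastforce
    show "(case case x of (p, l) \<Rightarrow> (l + zexp p, p) of (N, p) \<Rightarrow> cterm p * E (- 1 / 8) * poisson_coeff (N - zexp p) * z powi N) =
        (case x of (p, l) \<Rightarrow> cterm p * z powi zexp p * (E (- 1 / 8) * (poisson_coeff l * z powi l)))"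
      using z0 by (simp add: x power_int_add)
  qed (auto simp: eta_deformed_eq mult_ac)
  finally have tot: "((\<lambda>(N, p). cterm p * E (- 1 / 8) * poisson_coeff (N - zexp p) * z powi N) has_sum
      (Theta_L m corner \<tau> t z * eta_deformed \<tau> t z * poisson_kernel t z)) (UNIV \<times> cone_indices)" .
  show "((\<lambda>N. laurent_coeff N * z powi N) has_sum
      (Theta_L m corner \<tau> t z * eta_deformed \<tau> t z * poisson_kernel t z)) UNIV"
  proof (rule has_sum_SigmaD[OF tot])
    fix N
    show "((\<lambda>p. case (N, p) of (N, p) \<Rightarrow> cterm p * E (- 1 / 8) * poisson_coeff (N - zexp p) * z powi N) has_sum
        laurent_coeff N * z powi N) cone_indices"
      using has_sum_cmult_left[OF has_sum_infsum[OF summable_cterm_poisson[of "\<lambda>p. N - zexp p"]], of "z powi N"]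
      by (simp add: laurent_coeff_def)
  qed
qed

text \<open>For fixed \<open>(s, k)\<close> the cone contains all \<open>n \<ge> 0\<close> or all \<open>n < 0\<close>; in either case the sum over \<open>n\<close> is the
  corresponding expansion of \<open>string_coeff\<close>, whose sign matches the sign of the cone.\<close>

lemma string_terms_sum: "(string_term m J j has_sum laurent_coeff 0) UNIV"
proof -
  define side :: "bool \<times> int \<Rightarrow> int set" where
    "side = (\<lambda>(s, k). if k \<ge> (if s then 1 else 0) then {0..} else {..<0})"
  define h where "h p = cterm p * E (- 1 / 8) * poisson_coeff (zexp p)" for p
  have "poisson_coeff (0 - zexp p) = poisson_coeff (zexp p)" for p using poisson_coeff_minus by simp
  hence "(h has_sum laurent_coeff 0) cone_indices"
    using has_sum_infsum[OF summable_cterm_poisson[of "\<lambda>p. 0 - zexp p"]]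
    by (simp add: h_def[abs_def] laurent_coeff_def)
  also have "?this \<longleftrightarrow> ((\<lambda>((s, k), n). h (s, k, n)) has_sum laurent_coeff 0) (Sigma UNIV side)"
    by (rule has_sum_reindex_bij_witness[where i = "\<lambda>((s, k), n). (s, k, n)" and j = "\<lambda>(s, k, n). ((s, k), n)"])
       (auto simp: cone_indices_def side_def split: if_splits)
  finally have tot: "((\<lambda>((s, k), n). h (s, k, n)) has_sum laurent_coeff 0) (Sigma UNIV side)" .
  show ?thesis
  proof (rule has_sum_SigmaD[OF tot])
    fix x :: "bool \<times> int"
    obtain s k where x: "x = (s, k)" by fastforce
    let ?c = "(if s then - 1 else 1) * E (qform m (pt s k 0) / 2 - 1 / 8)"
    have split: "E (qform m (pt s k 0) / 2 - 1 / 8) = E (qform m (pt s k 0) / 2) * E (- 1 / 8)"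
      using E_add[of "qform m (pt s k 0) / 2" "- 1 / 8"] by simp
    have h: "h (s, k, n) = ?c * (if n \<ge> 0 then 1 else - 1) * (expansion_coeff (coeff_index s k) n * poisson_coeff (coeff_index s k + n))" for n
      unfolding h_def cterm_def zexp_def prod.case cone_term_eq split by (simp add: mult_ac)
    show "((\<lambda>n. case (x, n) of (x, n) \<Rightarrow> (case x of (s, k) \<Rightarrow> \<lambda>n. h (s, k, n)) n) has_sum string_term m J j x) (side x)"
    proof (cases "k \<ge> (if s then 1 else 0)")
      case True
      hence sd: "side x = {0..}" by (simp add: side_def x)
      have "((\<lambda>n. ?c * (expansion_coeff (coeff_index s k) n * poisson_coeff (coeff_index s k + n))) has_sum
          (?c * string_coeff (coeff_index s k))) {0..}"
        by (rule has_sum_cmult_right[OF string_coeff_expansion(1)])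
      also have "?this \<longleftrightarrow> ((\<lambda>n. h (s, k, n)) has_sum (?c * string_coeff (coeff_index s k))) {0..}"
        by (rule has_sum_cong) (simp add: h)
      finally show ?thesis unfolding sd by (simp add: x string_term_eq)
    next
      case False
      hence sd: "side x = {..<0}" by (simp add: side_def x)
      have "((\<lambda>n. - ?c * (expansion_coeff (coeff_index s k) n * poisson_coeff (coeff_index s k + n))) has_sum
          (- ?c * - string_coeff (coeff_index s k))) {..<0}"
        by (rule has_sum_cmult_right[OF string_coeff_expansion(2)])
      also have "?this \<longleftrightarrow> ((\<lambda>n. h (s, k, n)) has_sum (- ?c * - string_coeff (coeff_index s k))) {..<0}"
        by (rule has_sum_cong) (simp add: h)
      finally show ?thesis unfolding sd by (simp add: x string_term_eq)
    qed
  qed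
qed

end

context modular_nome
begin

text \<open>Replacing \<open>(x, y)\<close> by \<open>(1/2 - x, 1/2 - y)\<close> changes the index from \<open>a\<close> to \<open>- a\<close> and the exponent
  of \<open>q\<close> by \<open>a\<close>, which is what \<open>string_coeff_minus\<close> compensates.\<close>

lemma string_term_flip:
  assumes m: "m \<ge> 1" and par: "odd (J - j)"
  shows "string_term m (int m + 2 - J) (int m - j) (s, if s then 1 - k else - k) = string_term m J j (s, k)"
proof -
  define e :: int where "e = (if s then - 1 else 1)"
  define a where "a = (e * J - j - 1) div 2 + (int m + 2) * k"
  have "even (e * J - j - 1)" using par by (auto simp: e_def)
  then obtain i where i: "e * J - j - 1 = 2 * i" by blast
  have eJ: "(if s then - J else J) = e * J" "(if s then - real_of_int J else of_int J) = of_int e * of_int J" for J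
    by (auto simp: e_def)
  let ?k = "if s then 1 - k else - k"
  have a': "(e * (int m + 2 - J) - (int m - j) - 1) div 2 + (int m + 2) * ?k = - a"
  proof -
    have "e * (int m + 2 - J) - (int m - j) - 1 = 2 * (if s then - i - int m - 2 else - i)"
      using i by (auto simp: e_def algebra_simps)
    thus ?thesis unfolding a_def i by (auto simp: algebra_simps)
  qed
  let ?Q = "(real m + 2) * (of_int e * of_int J / (2 * (real m + 2)) + of_int k)\<^sup>2 - real m * (of_int j / (2 * real m))\<^sup>2 - 1 / 8"
  let ?Q' = "(real m + 2) * (of_int e * of_int (int m + 2 - J) / (2 * (real m + 2)) + of_int ?k)\<^sup>2 - real m * (of_int (int m - j) / (2 * real m))\<^sup>2 - 1 / 8"
  have Q: "?Q = ?Q' + of_int a"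
  proof -
    have ra: "real_of_int a = of_int i + (real m + 2) * of_int k" unfolding a_def i by simp
    have ri: "2 * real_of_int i = of_int e * of_int J - of_int j - 1"
      using arg_cong[OF i, of real_of_int] by simp
    define X where "X = of_int e * of_int J / (2 * (real m + 2)) + of_int k"
    define Y where "Y = of_int j / (2 * real m)"
    have X': "of_int e * of_int (int m + 2 - J) / (2 * (real m + 2)) + of_int ?k = 1 / 2 - X"
      by (cases s) (simp_all add: X_def e_def field_simps)
    have Y': "of_int (int m - j) / (2 * real m) = 1 / 2 - Y" using m by (simp add: Y_def field_simps)
    have mX: "(real m + 2) * X = of_int e * of_int J / 2 + (real m + 2) * of_int k" by (simp add: X_def field_simps)
    have mY: "real m * Y = of_int j / 2" using m by (simp add: Y_def)
    have "(real m + 2) * X\<^sup>2 - real m * Y\<^sup>2 - 1 / 8 = (real m + 2) * (1 / 2 - X)\<^sup>2 - real m * (1 / 2 - Y)\<^sup>2 - 1 / 8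
        + ((real m + 2) * X - real m * Y - 1 / 2)"
      by (simp add: power2_eq_square algebra_simps)
    also have "(real m + 2) * X - real m * Y - 1 / 2 = of_int a" unfolding ra mX mY using ri by (simp add: field_simps)
    finally show ?thesis unfolding X' Y' unfolding X_def Y_def .
  qed
  have "E ?Q' * string_coeff (- a) = E ?Q * string_coeff a"
    unfolding string_coeff_minus Q E_add E_of_int by simp
  thus ?thesis unfolding string_term_def prod.case eJ a' a_def[symmetric] by (simp only: mult.assoc)
qed

lemma string_terms_flip:
  assumes "m \<ge> 1" "odd (J - j)" "(string_term m (int m + 2 - J) (int m - j) has_sum S) UNIV"
  shows "(string_term m J j has_sum S) UNIV"
proof -
  have "(string_term m J j has_sum S) UNIV \<longleftrightarrow> (string_term m (int m + 2 - J) (int m - j) has_sum S) UNIV"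
    by (rule has_sum_reindex_bij_witness[where i = "\<lambda>(s, k). (s, if s then 1 - k else - k)"
          and j = "\<lambda>(s, k). (s, if s then 1 - k else - k)"])
       (auto simp: string_term_flip[OF assms(1,2)])
  thus ?thesis using assms(3) by simp
qed

section \<open>The string function as a sum over the Weyl group\<close>

text \<open>The absolute convergence of the sum over the Weyl group and all \<open>i\<close> allows summing over \<open>i\<close> first, which
  turns Kostant partition functions into \<open>string_coeff\<close>. The terms with \<open>i < 0\<close> vanish by \<open>edge\<close>, which
  encodes that \<open>\<lambda>\<close> is \<open>\<Lambda> - n \<alpha>\<^sub>1\<close> (with \<open>\<Delta> = 0\<close>) or \<open>\<Lambda> - n \<alpha>\<^sub>0\<close> (with \<open>\<Delta> = n\<close>).\<close>

lemma t_string_function_eq: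
  fixes m :: nat and \<Lambda> lam :: weight and J j \<Delta> :: int
  assumes m: "m \<ge> 1" and J: "0 < J" "J < int m + 2" and par: "odd (J - j)"
    and c1: "\<Lambda> $ 1 = (of_int J - 1) / 2" "lam $ 1 = of_int j / 2"
    and c3: "\<Lambda> $ 3 = of_nat m" "lam $ 3 = of_nat m" and c2: "\<Lambda> $ 2 = lam $ 2 + of_int \<Delta>"
    and edge: "\<Delta> = 0 \<or> j = J - 1 + 2 * \<Delta>"
    and S: "(string_term m J j has_sum S) UNIV"
  shows "t_string_function m \<Lambda> lam t \<tau> = S"
proof -
  define \<epsilon> :: "bool \<Rightarrow> int" where "\<epsilon> s = (if s then - 1 else 1)" for s
  define a where "a s k = (\<epsilon> s * J - j - 1) div 2 + (int m + 2) * k" for s k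
  \<comment> \<open>Chosen so that \<open>w(\<Lambda> + \<rho>) - (\<lambda> - i \<delta> + \<rho>) = a s k \<alpha>\<^sub>1 + (i + e s k) \<delta>\<close> for \<open>w = affine_refl s k\<close>.\<close>
  define e where "e s k = \<Delta> - (\<epsilon> s * J * k + k\<^sup>2 * (int m + 2))" for s k
  have norm_\<epsilon>: "\<bar>real_of_int (\<epsilon> s)\<bar> = 1" for s by (simp add: \<epsilon>_def)
  have two_a: "2 * a s k = \<epsilon> s * J - j - 1 + 2 * ((int m + 2) * k)" for s k
  proof -
    have "even (\<epsilon> s * J - j - 1)" using par by (auto simp: \<epsilon>_def)
    thus ?thesis unfolding a_def by (metis distrib_left dvd_mult_div_cancel)
  qed
  have two_a_complex: "2 * complex_of_int (a s k) = of_int (\<epsilon> s) * of_int J - of_int j - 1 + 2 * ((of_nat m + 2) * of_int k)" for s k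
    using arg_cong[OF two_a[of s k], of complex_of_int] by simp
  define K where "K s k i = kostant (of_int (a s k) *s alpha1 + of_int (i + e s k) *s null_root) t" for s k i

  have diff: "affine_refl s k (\<Lambda> + rho) - (lam - of_nat i *s null_root + rho) =
      of_int (a s k) *s alpha1 + of_int (int i + e s k) *s null_root" for s k i
  proof -
    have h: "(\<Lambda> + rho) $ 1 = of_int J / 2" "(\<Lambda> + rho) $ 2 = lam $ 2 + of_int \<Delta>" "(\<Lambda> + rho) $ 3 = of_nat m + 2"
      using c1 c2 c3 by (simp_all add: field_simps)
    have "(if s then - (\<Lambda> + rho) $ 1 else (\<Lambda> + rho) $ 1) = of_int (\<epsilon> s) * of_int J / 2"
      unfolding h by (simp add: \<epsilon>_def)
    note refl = affine_refl_coords[of s k "\<Lambda> + rho", unfolded this, unfolded h]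
    have "complex_of_int (a s k) = (of_int (\<epsilon> s) * of_int J - of_int j - 1 + 2 * ((of_nat m + 2) * of_int k)) / 2"
      using two_a_complex[of s k] by (simp add: eq_divide_eq mult.commute)
    hence "of_int (\<epsilon> s) * of_int J / 2 + of_int k * (of_nat m + 2) - (of_int j / 2 + 1 / 2) = complex_of_int (a s k)"
      by (simp add: add_divide_distrib diff_divide_distrib mult.commute)
    thus ?thesis unfolding weight_eq_iff vector_minus_component vector_add_component refl c1(2)
      using c3(2) by (simp add: e_def)
  qed

  \<comment> \<open>Either \<open>i + e\<close> or \<open>a + i + e\<close> is negative; the relevant quadratic in \<open>k\<close> has no integer strictly between its roots.\<close>
  have vanish: "K s k i = 0" if "i < 0" for s k i
    unfolding K_def
  proof (rule kostant_eq_0)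
    have m2: "0 \<le> int m + 2" by simp
    from edge show "i + e s k < 0 \<or> a s k + (i + e s k) < 0"
    proof
      assume \<Delta>: "\<Delta> = 0"
      have "0 \<le> k * (k * (int m + 2) + \<epsilon> s * J)"
      proof (cases "k = 0")
        case False
        then consider "k \<ge> 1" | "k \<le> -1" by linarith
        thus ?thesis
        proof cases
          case 1
          have "J \<le> k * (int m + 2)" using order_trans[OF _ mult_right_mono[OF 1 m2], of J] J by simp
          thus ?thesis using 1 J by (intro mult_nonneg_nonneg) (use J in \<open>auto simp: \<epsilon>_def\<close>)
        next
          case 2
          have "k * (int m + 2) \<le> - J" using order_trans[OF mult_right_mono[OF 2 m2], of "- J"] J by simp
          thus ?thesis using 2 J by (intro mult_nonpos_nonpos) (auto simp: \<epsilon>_def)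
        qed
      qed simp
      thus ?thesis using that \<Delta> by (simp add: e_def power2_eq_square algebra_simps)
    next
      assume jJ: "j = J - 1 + 2 * \<Delta>"
      have "a s k + e s k \<le> 0"
      proof (cases s)
        case True
        have "0 \<le> (k - 1) * (k * (int m + 2) - J)"
        proof (cases "k \<ge> 1")
          case True
          have "int m + 2 \<le> k * (int m + 2)" using mult_right_mono[OF True m2] by (simp only: mult_1)
          thus ?thesis using True J by (intro mult_nonneg_nonneg) linarith+
        next
          case False
          have "k * (int m + 2) \<le> 0" using False by (intro mult_nonpos_nonneg) auto
          thus ?thesis using False J by (intro mult_nonpos_nonpos) linarith+
        qed
        moreover have "2 * (a s k + e s k) = - 2 * ((k - 1) * (k * (int m + 2) - J))"
          using two_a[of s k] True jJ by (simp add: e_def \<epsilon>_def power2_eq_square algebra_simps)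
        ultimately show ?thesis by simp
      next
        case False
        have "k * (int m + 2 - J - k * (int m + 2)) \<le> 0"
        proof (cases "k \<ge> 1")
          case True
          have "int m + 2 \<le> k * (int m + 2)" using mult_right_mono[OF True m2] by (simp only: mult_1)
          thus ?thesis using True J by (intro mult_nonneg_nonpos) linarith+
        next
          case False
          have "k * (int m + 2) \<le> 0" using False by (intro mult_nonpos_nonneg) auto
          thus ?thesis using False J by (intro mult_nonpos_nonneg) linarith+
        qed
        moreover have "2 * (a s k + e s k) = 2 * (k * (int m + 2 - J - k * (int m + 2)))"
          using two_a[of s k] False jJ by (simp add: e_def \<epsilon>_def power2_eq_square algebra_simps)
        ultimately show ?thesis by simp
      qed
      thus ?thesis using that by simp
    qed
  qed

  define F where "F = (\<lambda>((s, k), i). of_int (\<epsilon> s) * K s k i * q powi i)"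
  have shift: "K s k i * q powi i = q powi (- e s k) * (K s k i * q powi (i + e s k))" for s k i
    by (simp add: power_int_add power_int_minus)
  have reidx: "((\<lambda>i. h (i + c)) has_sum x) UNIV \<longleftrightarrow> (h has_sum x) UNIV"
    for h :: "int \<Rightarrow> 'b::{topological_comm_monoid_add, t2_space}" and c :: int and x
    by (rule has_sum_reindex_bij_witness[where i = "\<lambda>i. i - c" and j = "\<lambda>i. i + c"]) auto
  have inner: "((\<lambda>i. F ((s, k), i)) has_sum (of_int (\<epsilon> s) * (q powi (- e s k) * string_coeff (a s k)))) UNIV" for s k
  proof -
    have "((\<lambda>i. K s k i * q powi (i + e s k)) has_sum string_coeff (a s k)) UNIV"
      using kostant_generating_function(1)[of "a s k"]
        reidx[where h1 = "\<lambda>i. kostant (of_int (a s k) *s alpha1 + of_int i *s null_root) t * q powi i" and c1 = "e s k"]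
      by (simp add: K_def)
    from has_sum_cmult_right[OF has_sum_cmult_right[OF this, of "q powi (- e s k)"], of "of_int (\<epsilon> s)"]
    show ?thesis unfolding shift[symmetric] by (simp add: F_def mult.assoc)
  qed
  have inner_norm: "(\<lambda>i. norm (F ((s, k), i))) summable_on UNIV \<and>
      (\<Sum>\<^sub>\<infinity>i. norm (F ((s, k), i))) \<le> norm (q powi (- e s k)) * coeff_bound" for s k
  proof -
    let ?h = "\<lambda>i. norm (kostant (of_int (a s k) *s alpha1 + of_int i *s null_root) t * q powi i)"
    have "(?h has_sum infsum ?h UNIV) UNIV" using kostant_generating_function(2) by simp
    hence "((\<lambda>i. norm (K s k i * q powi (i + e s k))) has_sum infsum ?h UNIV) UNIV"
      using reidx[where h1 = ?h and c1 = "e s k"] by (simp add: K_def)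
    from has_sum_cmult_right[OF this, of "norm (q powi (- e s k))"]
    have "((\<lambda>i. norm (F ((s, k), i))) has_sum norm (q powi (- e s k)) * infsum ?h UNIV) UNIV"
      unfolding norm_mult[symmetric] shift[symmetric] by (simp add: F_def norm_mult norm_\<epsilon>)
    moreover have "norm (q powi (- e s k)) * infsum ?h UNIV \<le> norm (q powi (- e s k)) * coeff_bound"
      by (intro mult_left_mono kostant_generating_function(3)) auto
    ultimately show ?thesis by (auto simp: has_sum_iff)
  qed
  \<comment> \<open>The bound of the inner sums is a Gaussian in \<open>k\<close>, which makes the double sum absolutely convergent.\<close>
  have norm_q: "norm (q powi (- e s k)) \<le> exp (- 2 * decay * of_int (- \<Delta>)) *
      exp (- (2 * decay * (real m + 2)) * (of_int k)\<^sup>2 + 2 * decay * of_int J * \<bar>real_of_int k\<bar>)" for s k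
  proof -
    have "- (of_int (\<epsilon> s) * of_int J * of_int k) \<le> of_int J * \<bar>real_of_int k\<bar>"
      using abs_ge_minus_self[of "real_of_int (\<epsilon> s) * of_int J * of_int k"] J
      by (simp add: abs_mult norm_\<epsilon>)
    from mult_left_mono[OF this, of "2 * decay"] decay_pos show ?thesis
      unfolding E_of_int[symmetric] norm_E exp_add[symmetric] exp_le_cancel_iff
      by (simp add: e_def algebra_simps)
  qed
  have absF: "(\<lambda>p. norm (F p)) summable_on UNIV \<times> UNIV"
  proof (rule summable_on_SigmaI)
    fix x :: "bool \<times> int"
    obtain s k where x: "x = (s, k)" by fastforce
    show "((\<lambda>y. norm (F (x, y))) has_sum (\<Sum>\<^sub>\<infinity>i. norm (F (x, i)))) UNIV"
      using inner_norm[of s k] by (simp add: x)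
  next
    let ?G = "\<lambda>(s::bool, k). 1 * (exp (- (2 * decay * (real m + 2)) * (of_int k)\<^sup>2 + 2 * decay * of_int J * \<bar>real_of_int k\<bar>)
        * (exp (- 2 * decay * of_int (- \<Delta>)) * coeff_bound))"
    have bound0: "coeff_bound \<ge> 0" unfolding coeff_bound_def by (rule infsum_nonneg) simp
    have gs: "(\<lambda>k::int. exp (- (2 * decay * (real m + 2)) * (of_int k)\<^sup>2 + 2 * decay * of_int J * \<bar>real_of_int k\<bar>)
        * (exp (- 2 * decay * of_int (- \<Delta>)) * coeff_bound)) summable_on UNIV"
      by (intro summable_on_cmult_left summable_gaussian) (use decay_pos in simp)
    have "?G summable_on UNIV \<times> UNIV"
      by (rule summable_on_product_nonneg[OF summable_on_finite gs]) (use bound0 in auto)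
    hence "?G summable_on UNIV" unfolding UNIV_Times_UNIV .
    thus "(\<lambda>x. \<Sum>\<^sub>\<infinity>i. norm (F (x, i))) summable_on UNIV"
    proof (rule summable_on_comparison_test)
      fix x :: "bool \<times> int"
      obtain s k where x: "x = (s, k)" by fastforce
      have "(\<Sum>\<^sub>\<infinity>i. norm (F ((s, k), i))) \<le> norm (q powi (- e s k)) * coeff_bound" using inner_norm by blast
      also have "\<dots> \<le> ?G (s, k)" using mult_right_mono[OF norm_q[of s k] bound0] by (simp add: mult_ac)
      finally show "(\<Sum>\<^sub>\<infinity>i. norm (F (x, i))) \<le> ?G x" by (simp only: x)
      show "0 \<le> (\<Sum>\<^sub>\<infinity>i. norm (F (x, i)))" by (rule infsum_nonneg) simp
    qed
  qed simp

  define sr :: real where "sr = (of_int J)\<^sup>2 / (4 * (real m + 2)) + of_int \<Delta> - (of_int j)\<^sup>2 / (4 * real m) - 1 / 8"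
  have sexp: "s_exponent m \<Lambda> lam = of_real sr"
  proof -
    have m0: "complex_of_nat m \<noteq> 0" "complex_of_nat m + 2 \<noteq> 0"
      using m by (auto simp: add_eq_0_iff of_nat_eq_0_iff complex_eq_iff)
    have quot: "(X\<^sup>2 / 2 + 2 * y * c) / (2 * c) = X\<^sup>2 / (4 * c) + y" if "c \<noteq> 0" for X y c :: complex
      using that by (simp add: field_simps)
    have "bform (\<Lambda> + rho) (\<Lambda> + rho) = (of_int J)\<^sup>2 / 2 + 2 * (lam $ 2 + of_int \<Delta>) * (of_nat m + 2)"
      using c1 c2 c3 by (simp add: bform_def power2_eq_square field_simps)
    note 1 = this[THEN arg_cong[of _ _ "\<lambda>x. x / (2 * (of_nat m + 2))"], unfolded quot[OF m0(2)]]
    have "bform lam lam = (of_int j)\<^sup>2 / 2 + 2 * lam $ 2 * of_nat m"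
      using c1 c3 by (simp add: bform_def power2_eq_square field_simps)
    note 2 = this[THEN arg_cong[of _ _ "\<lambda>x. x / (2 * of_nat m)"], unfolded quot[OF m0(1)]]
    have 3: "bform rho rho = 1 / 2" by (simp add: bform_def)
    show ?thesis unfolding s_exponent_def 1 2 3 sr_def by simp
  qed
  have st: "string_term m J j (s, k) = E sr * (of_int (\<epsilon> s) * (q powi (- e s k) * string_coeff (a s k)))" for s k
  proof -
    have "(if s then - J else J) = \<epsilon> s * J" "(if s then - real_of_int J else of_int J) = of_int (\<epsilon> s) * of_int J"
      "(if s then - 1 else 1 :: complex) = of_int (\<epsilon> s)" by (auto simp: \<epsilon>_def)
    moreover have "(real m + 2) * (of_int (\<epsilon> s) * of_int J / (2 * (real m + 2)) + of_int k)\<^sup>2 - real m * (of_int j / (2 * real m))\<^sup>2 - 1 / 8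
        = sr + of_int (- e s k)"
    proof -
      have "(of_int (\<epsilon> s) :: real)\<^sup>2 = 1" by (simp add: \<epsilon>_def)
      moreover have "c * (X / (2 * c) + y)\<^sup>2 = X\<^sup>2 / (4 * c) + X * y + y\<^sup>2 * c" if "c \<noteq> 0" for c X y :: real
        using that by (simp add: power2_eq_square field_simps)
      from this[of "real m + 2"]
      have "(real m + 2) * (X / (2 * (real m + 2)) + of_int k)\<^sup>2 =
          X\<^sup>2 / (4 * (real m + 2)) + X * of_int k + (of_int k)\<^sup>2 * (real m + 2)" for X
        by simp
      moreover have "real m * (of_int j / (2 * real m))\<^sup>2 = (of_int j)\<^sup>2 / (4 * real m)"
        using m by (simp add: power2_eq_square field_simps)
      ultimately show ?thesis by (simp add: sr_def e_def power_mult_distrib)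
    qed
    ultimately show ?thesis
      unfolding string_term_def prod.case a_def by (simp only: E_add E_of_int mult_ac)
  qed
  have E_inv: "E (- sr) * E sr = 1" using E_add[of "- sr" sr] by (simp add: E_def)
  have outer: "((\<lambda>(s, k). of_int (\<epsilon> s) * (q powi (- e s k) * string_coeff (a s k))) has_sum (E (- sr) * S)) UNIV"
  proof -
    have "(\<lambda>(s, k). of_int (\<epsilon> s) * (q powi (- e s k) * string_coeff (a s k))) = (\<lambda>x. E (- sr) * string_term m J j x)"
    proof (rule ext)
      fix x :: "bool \<times> int"
      obtain s k where x: "x = (s, k)" by fastforce
      show "(case x of (s, k) \<Rightarrow> of_int (\<epsilon> s) * (q powi (- e s k) * string_coeff (a s k))) = E (- sr) * string_term m J j x"
        unfolding x prod.case st mult.assoc[symmetric] E_inv by simp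
    qed
    thus ?thesis using has_sum_cmult_right[OF S] by simp
  qed
  have total: "(F has_sum (E (- sr) * S)) (UNIV \<times> UNIV)"
  proof (rule has_sum_SigmaI[OF _ outer abs_summable_summable[OF absF]])
    fix x :: "bool \<times> int"
    obtain s k where x: "x = (s, k)" by fastforce
    show "((\<lambda>y. F (x, y)) has_sum (case x of (s, k) \<Rightarrow> of_int (\<epsilon> s) * (q powi (- e s k) * string_coeff (a s k)))) UNIV"
      unfolding x prod.case by (rule inner)
  qed
  define \<mu> where "\<mu> i = (\<Sum>\<^sub>\<infinity>x. F (x, i))" for i
  have "((\<lambda>(i, x). F (x, i)) has_sum (E (- sr) * S)) (UNIV \<times> UNIV)"
    using total unfolding has_sum_swap[of F] .
  hence "(\<mu> has_sum (E (- sr) * S)) UNIV"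
  proof (rule has_sum_SigmaD)
    fix i :: int
    have "(\<lambda>(i, x). F (x, i)) summable_on UNIV \<times> UNIV"
      using has_sum_imp_summable[OF total] unfolding summable_on_swap[of F] .
    from summable_on_SigmaD1[OF this, of i] have "(\<lambda>x. F (x, i)) summable_on UNIV" by simp
    thus "((\<lambda>y. case (i, y) of (i, x) \<Rightarrow> F (x, i)) has_sum \<mu> i) UNIV" by (simp add: \<mu>_def)
  qed
  also have "?this \<longleftrightarrow> (\<mu> has_sum (E (- sr) * S)) {0..}"
  proof (rule has_sum_cong_neutral)
    fix i :: int assume "i \<in> UNIV - {0..}"
    hence "F (x, i) = 0" for x using vanish[of i] by (cases x) (simp add: F_def)
    thus "\<mu> i = 0" by (simp add: \<mu>_def)
  qed auto
  also have "\<dots> \<longleftrightarrow> ((\<lambda>i. \<mu> (int i)) has_sum (E (- sr) * S)) UNIV"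
    by (rule sym, rule has_sum_reindex_bij_witness[where i = nat and j = int]) auto
  finally have "(\<lambda>i. \<mu> (int i)) sums (E (- sr) * S)" by (rule has_sum_imp_sums)
  moreover have "\<mu> (int i) = lusztig_mult \<Lambda> (lam - of_nat i *s null_root) t * exp (2 * of_real pi * \<i> * \<tau>) ^ i" for i
  proof -
    let ?\<nu> = "lam - of_nat i *s null_root"
    have "lusztig_mult \<Lambda> ?\<nu> t = (\<Sum>\<^sub>\<infinity>x. (-1) ^ weyl_length (case x of (s, k) \<Rightarrow> affine_refl s k) *
        kostant ((case x of (s, k) \<Rightarrow> affine_refl s k) (\<Lambda> + rho) - (?\<nu> + rho)) t)"
      unfolding lusztig_mult_def weyl_group_eq by (subst infsum_reindex[OF inj_affine_refl]) (simp add: o_def)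
    also have "\<dots> = (\<Sum>\<^sub>\<infinity>(s, k). of_int (\<epsilon> s) * K s k (int i))"
    proof (rule infsum_cong)
      fix x :: "bool \<times> int"
      obtain s k where x: "x = (s, k)" by fastforce
      show "(-1) ^ weyl_length (case x of (s, k) \<Rightarrow> affine_refl s k) *
          kostant ((case x of (s, k) \<Rightarrow> affine_refl s k) (\<Lambda> + rho) - (?\<nu> + rho)) t = (case x of (s, k) \<Rightarrow> of_int (\<epsilon> s) * K s k (int i))"
        unfolding x prod.case weyl_sign diff K_def by (simp add: \<epsilon>_def)
    qed
    finally have "lusztig_mult \<Lambda> ?\<nu> t * q ^ i = (\<Sum>\<^sub>\<infinity>x. (case x of (s, k) \<Rightarrow> of_int (\<epsilon> s) * K s k (int i)) * q ^ i)"
      by (simp add: infsum_cmult_left')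
    also have "\<dots> = \<mu> (int i)"
      unfolding \<mu>_def by (rule infsum_cong) (simp add: F_def case_prod_unfold)
    finally show ?thesis by (simp add: q_eq)
  qed
  ultimately have "(\<Sum>i. lusztig_mult \<Lambda> (lam - of_nat i *s null_root) t * exp (2 * of_real pi * \<i> * \<tau>) ^ i) = E (- sr) * S"
    by (simp add: sums_iff)
  hence "t_string_function m \<Lambda> lam t \<tau> = E sr * (E (- sr) * S)"
    unfolding t_string_function_def sexp E_def[of sr] by (simp only:)
  also have "\<dots> = (E (- sr) * E sr) * S" by (simp only: mult_ac)
  finally show ?thesis by (simp add: E_inv)
qed

end

section \<open>The string function as a constant term\<close>

theorem theorem2:
  fixes scale :: "complex \<Rightarrow> 'v \<Rightarrow> 'v::ab_group_add"
    and e f :: "2 \<Rightarrow> 'v \<Rightarrow> 'v" and H :: "weight \<Rightarrow> 'v \<Rightarrow> 'v"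
    and m :: nat and \<Lambda> lam :: weight and \<tau> t :: complex
  assumes "m \<ge> 1"
    and "dominant_integral \<Lambda>" and "level \<Lambda> = of_nat m"
    and "affine_module scale e f H"
    and "affine_module.irreducible_highest_weight scale e f H \<Lambda>"
    and "affine_module.maximal_weight scale H lam" and "dominant_integral lam"
    and "Im \<tau> > 0" and "0 < norm t" and "norm t < 1"
  shows "\<exists>a. laurent_series_on_annulus
           (\<lambda>z. Theta_L m (shift_AB m \<Lambda> lam) \<tau> t z * eta_deformed \<tau> t z * poisson_kernel t z)
           (norm t) (1 / norm t) a
         \<and> t_string_function m \<Lambda> lam t \<tau> = a 0"
proof -
  have L3: "\<Lambda> $ 3 = of_nat m" using assms(3) by (simp add: level_def bform_def)
  hence lev: "level \<Lambda> \<noteq> 0" using assms(1,3) by simp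
  obtain i n where lam: "lam = \<Lambda> - of_nat n *s simple_root i"
    using affine_module.maximal_dominant_weight_cases[OF assms(4,5) lev assms(2,7,6)] .
  have l3: "lam $ 3 = of_nat m" using two_cases[of i] L3 by (auto simp: lam)
  have coords: "\<exists>l::nat. l \<le> m \<and> 2 * \<mu> $ 1 = of_nat l" if "dominant_integral \<mu>" "\<mu> $ 3 = of_nat m" for \<mu>
  proof -
    have "bform \<mu> (simple_root 1) \<in> \<nat>" "bform \<mu> (simple_root 0) \<in> \<nat>"
      using that(1) by (auto simp: dominant_integral_def)
    then obtain l l' where l: "bform \<mu> (simple_root 1) = of_nat l" "bform \<mu> (simple_root 0) = of_nat l'"
      by (elim Nats_cases)
    hence "2 * \<mu> $ 1 = of_nat l" "of_nat m - 2 * \<mu> $ 1 = of_nat l'" using that(2) by (simp_all add: bform_def)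
    moreover from this have "of_nat m = (of_nat (l + l') :: complex)" by (simp add: diff_eq_eq add.commute)
    hence "m = l + l'" by (simp only: of_nat_eq_iff)
    ultimately show ?thesis by auto
  qed
  obtain l where l: "l \<le> m" "2 * \<Lambda> $ 1 = of_nat l" using coords[OF assms(2) L3] by (elim exE conjE)
  obtain p where p: "p \<le> m" "2 * lam $ 1 = of_nat p" using coords[OF assms(7) l3] by (elim exE conjE)
  define J j where "J = int l + 1" and "j = int p"
  define \<Delta> where "\<Delta> = (if i = 0 then int n else 0)"
  have rel: "j = (if i = 0 then J - 1 + 2 * int n else J - 1 - 2 * int n)"
  proof (cases "i = 0")
    case True
    hence "2 * lam $ 1 = 2 * \<Lambda> $ 1 + 2 * of_nat n" by (simp add: lam algebra_simps)
    hence "(of_nat p :: complex) = of_nat (l + 2 * n)" unfolding p(2) l(2) by simp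
    hence "p = l + 2 * n" by (simp only: of_nat_eq_iff)
    thus ?thesis using True by (simp add: J_def j_def)
  next
    case False
    hence "i = 1" using two_cases by blast
    hence "2 * lam $ 1 + 2 * of_nat n = 2 * \<Lambda> $ 1" by (simp add: lam algebra_simps)
    hence "(of_nat (p + 2 * n) :: complex) = of_nat l" unfolding p(2) l(2) by simp
    hence "p + 2 * n = l" by (simp only: of_nat_eq_iff)
    thus ?thesis using False by (simp add: J_def j_def)
  qed
  have J: "0 < J" "J < int m + 2" using l by (auto simp: J_def)
  have j: "0 \<le> j" "j \<le> int m" using p by (auto simp: j_def)
  have par: "odd (J - j)" unfolding rel by auto
  have c1: "\<Lambda> $ 1 = (of_int J - 1) / 2" "lam $ 1 = of_int j / 2" using l p by (simp_all add: J_def j_def field_simps)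
  have c2: "\<Lambda> $ 2 = lam $ 2 + of_int \<Delta>" using two_cases[of i] by (auto simp: lam \<Delta>_def)
  have edge: "\<Delta> = 0 \<or> j = J - 1 + 2 * \<Delta>" using rel by (auto simp: \<Delta>_def)
  define q where "q = exp (2 * of_real pi * \<i> * \<tau>)"
  interpret modular_nome t q \<tau>
    by unfold_locales (use assms(8-10) in \<open>simp_all add: q_def\<close>)
  have x0: "Re (bform (\<Lambda> + rho) alpha1) / (2 * (real m + 2)) = of_int J / (2 * (real m + 2))"
    and y0: "Re (bform lam alpha1) / (2 * real m) = of_int j / (2 * real m)"
  proof -
    have "bform (\<Lambda> + rho) alpha1 = of_int J" "bform lam alpha1 = of_int j"
      using c1 by (simp_all add: bform_def field_simps)
    thus "Re (bform (\<Lambda> + rho) alpha1) / (2 * (real m + 2)) = of_int J / (2 * (real m + 2))"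
      "Re (bform lam alpha1) / (2 * real m) = of_int j / (2 * real m)" by simp_all
  qed
  have m0: "real m > 0" using assms(1) by simp
  have ineq: "of_int J / (2 * (real m + 2)) \<ge> of_int j / (2 * real m) \<longleftrightarrow> j * (int m + 2) \<le> J * int m"
  proof -
    have "of_int J / (2 * (real m + 2)) \<ge> of_int j / (2 * real m) \<longleftrightarrow> real_of_int (j * (int m + 2)) \<le> of_int (J * int m)"
      using m0 by (simp add: field_simps) (rule iffI; linarith)
    thus ?thesis by (simp only: of_int_le_iff)
  qed
  show ?thesis
  proof (cases "j * (int m + 2) \<le> J * int m")
    case True
    interpret theta_data m J j t q \<tau>
      by unfold_locales (use assms(1) J j par True in auto)
    have "shift_AB m \<Lambda> lam = corner"
      unfolding shift_AB_def x0 y0 Let_def using True ineq by (simp add: corner_def A_def B_def)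
    moreover have "t_string_function m \<Lambda> lam t \<tau> = laurent_coeff 0"
      by (rule t_string_function_eq[OF assms(1) J par c1 L3 l3 c2 edge string_terms_sum])
    ultimately show ?thesis using laurent_series by (intro exI[of _ laurent_coeff] conjI) (simp_all only:)
  next
    case False
    \<comment> \<open>The second case in the definition of \<open>(A, B)\<close> belongs to the mirror images of \<open>J\<close> and \<open>j\<close>.\<close>
    interpret theta_data m "int m + 2 - J" "int m - j" t q \<tau>
      by unfold_locales (use assms(1) J j par False in \<open>auto simp: algebra_simps\<close>)
    have "shift_AB m \<Lambda> lam = corner"
      unfolding shift_AB_def x0 y0 Let_def using False ineq m0
      by (simp add: corner_def A_def B_def) (simp add: vec2_eq_iff field_simps)
    moreover have "t_string_function m \<Lambda> lam t \<tau> = laurent_coeff 0"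
      by (rule t_string_function_eq[OF assms(1) J par c1 L3 l3 c2 edge
            string_terms_flip[OF assms(1) par string_terms_sum]])
    ultimately show ?thesis using laurent_series by (intro exI[of _ laurent_coeff] conjI) (simp_all only:)
  qed
qed

end
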